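(* Let $\ell\geq 3$ and $n\geq \max\left\{2.16\times 10^{17},\ 9\times 2^{\lfloor\frac{\ell-1}{2}\rfloor}+3,\ \frac{625}{32}\left\lfloor\frac{\ell-3}{2}\right\rfloor^2+2\right\}$ be integers. (i) If $\ell=3$, then $K_{2,n-2}$ is, up to isomorphism, the unique extremal graph to $\mathrm{spex}_{\mathcal{P}}(n,C_3)$. (ii) If $\ell\geq 5$, then the $n$-vertex graph $K_2+H\left(\lceil\frac{\ell-3}{2}\rceil,\lfloor\frac{\ell-3}{2}\rfloor\right)$ is, up to isomorphism, the unique extremal graph to $\mathrm{spex}_{\mathcal{P}}(n,C_{\ell})$.
   Context: All graphs are finite and simple. $\rho(G)$ denotes the spectral radius of the adjacency matrix of $G$. A graph is $F$-free if it does not contain $F$ as a (not necessarily induced) subgraph. $\mathrm{spex}_{\mathcal{P}}(n,F)$ is the maximum of $\rho(G)$ over all $n$-vertex $F$-free planar graphs $G$; an extremal graph is an $n$-vertex $F$-free planar graph attaining this maximum. $C_\ell$ is the cycle of length $\ell$, $G+H$ denotes the join of $G$ and $H$, and $P_m$ is the path on $m$ vertices ($P_1=K_1$). For positive integers $n,n_1,n_2$ with $n_1\geq n_2$ and $n\geq n_1+2n_2+2$, let $\alpha,\beta$ be the integers with $1\leq\beta\leq n_2$ and $n-2=n_1+\alpha n_2+\beta$. Define the $(n-2)$-vertex graph $$H(n_1,n_2):=P_{n_1}\cup \alpha P_{n_2}\cup P_{\beta},$$ the disjoint union of one path on $n_1$ vertices, $\alpha$ paths on $n_2$ vertices, and one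 path on $\beta$ vertices. *)

theory Defs
  imports
    "Graph_Theory.Graph_Theory"
    "Jordan_Normal_Form.Spectral_Radius"
    "HOL-Analysis.Analysis"
begin

text \<open>
  A finite simple graph is a \<^locale>\<open>pair_graph\<close>: a finite vertex set with a symmetric, irreflexive
  set of arcs. The undirected edge \<open>{u, v}\<close> is the pair of arcs \<open>(u, v)\<close>, \<open>(v, u)\<close>.
\<close>

section \<open>Named graphs and operations\<close>

definition path_graph :: "nat \<Rightarrow> nat pair_pre_digraph" where
  "path_graph m = \<lparr> pverts = {..<m},
     parcs = {(i, j). i < m \<and> j < m \<and> (j = Suc i \<or> i = Suc j)} \<rparr>"

text \<open>Only meaningful (a simple graph) for \<open>l \<ge> 3\<close>.\<close>

definition cycle_graph :: "nat \<Rightarrow> nat pair_pre_digraph" where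
  "cycle_graph l = \<lparr> pverts = {..<l},
     parcs = {(i, j). i < l \<and> j < l \<and> (j = Suc i mod l \<or> i = Suc j mod l)} \<rparr>"

definition complete_graph :: "nat \<Rightarrow> nat pair_pre_digraph" where
  "complete_graph m = \<lparr> pverts = {..<m}, parcs = {(i, j). i < m \<and> j < m \<and> i \<noteq> j} \<rparr>"

definition complete_bipartite_graph :: "nat \<Rightarrow> nat \<Rightarrow> (nat + nat) pair_pre_digraph" where
  "complete_bipartite_graph m n = \<lparr> pverts = {..<m} <+> {..<n},
     parcs = (Inl ` {..<m}) \<times> (Inr ` {..<n}) \<union> (Inr ` {..<n}) \<times> (Inl ` {..<m}) \<rparr>"

definition disjoint_union ::
    "'a pair_pre_digraph \<Rightarrow> 'b pair_pre_digraph \<Rightarrow> ('a + 'b) pair_pre_digraph" where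
  "disjoint_union G H = \<lparr> pverts = pverts G <+> pverts H,
     parcs = {(Inl u, Inl v) | u v. (u, v) \<in> parcs G} \<union> {(Inr u, Inr v) | u v. (u, v) \<in> parcs H} \<rparr>"

definition disjoint_copies :: "nat \<Rightarrow> 'a pair_pre_digraph \<Rightarrow> (nat \<times> 'a) pair_pre_digraph" where
  "disjoint_copies k G = \<lparr> pverts = {..<k} \<times> pverts G,
     parcs = {((i, u), (i, v)) | i u v. i < k \<and> (u, v) \<in> parcs G} \<rparr>"

definition graph_join ::
    "'a pair_pre_digraph \<Rightarrow> 'b pair_pre_digraph \<Rightarrow> ('a + 'b) pair_pre_digraph" where
  "graph_join G H = \<lparr> pverts = pverts G <+> pverts H,
     parcs = parcs (disjoint_union G H)
       \<union> (Inl ` pverts G) \<times> (Inr ` pverts H) \<union> (Inr ` pverts H) \<times> (Inl ` pverts G) \<rparr>"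

text \<open>
  The numbers \<open>\<alpha>\<close> and \<open>\<beta>\<close> with \<open>1 \<le> \<beta> \<le> n\<^sub>2\<close> and \<open>n - 2 = n\<^sub>1 + \<alpha> n\<^sub>2 + \<beta>\<close>, in closed form; the
  lemma \<open>H_alpha_beta_iff\<close> shows that they are the only ones with this property.
\<close>

definition H_alpha :: "nat \<Rightarrow> nat \<Rightarrow> nat \<Rightarrow> nat" where
  "H_alpha n n1 n2 = (n - 3 - n1) div n2"

definition H_beta :: "nat \<Rightarrow> nat \<Rightarrow> nat \<Rightarrow> nat" where
  "H_beta n n1 n2 = (n - 3 - n1) mod n2 + 1"

lemma H_alpha_beta_iff:
  fixes n n1 n2 :: nat and a b :: int
  assumes "1 \<le> n2" "n1 + 2 * n2 + 2 \<le> n"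
  shows "(1 \<le> b \<and> b \<le> int n2 \<and> int n - 2 = int n1 + a * int n2 + b)
    \<longleftrightarrow> a = int (H_alpha n n1 n2) \<and> b = int (H_beta n n1 n2)"
proof -
  define m where "m = n - 3 - n1"
  have m: "int n = int m + 3 + int n1"
    using assms unfolding m_def by linarith
  have md: "int m = int (m div n2) * int n2 + int (m mod n2)"
    by (metis div_mult_mod_eq of_nat_add of_nat_mult)
  have lt: "m mod n2 < n2"
    using assms by simp
  show ?thesis
  proof
    assume L: "1 \<le> b \<and> b \<le> int n2 \<and> int n - 2 = int n1 + a * int n2 + b"
    then have e: "int m = (b - 1) + a * int n2"
      using m by linarith
    have "int m div int n2 = a"
      using L assms unfolding e by simp
    moreover have "int m mod int n2 = b - 1"
      using L assms unfolding e by simp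
    ultimately show "a = int (H_alpha n n1 n2) \<and> b = int (H_beta n n1 n2)"
      unfolding H_alpha_def H_beta_def m_def[symmetric] by (simp add: zdiv_int zmod_int)
  next
    assume "a = int (H_alpha n n1 n2) \<and> b = int (H_beta n n1 n2)"
    then show "1 \<le> b \<and> b \<le> int n2 \<and> int n - 2 = int n1 + a * int n2 + b"
      unfolding H_alpha_def H_beta_def m_def[symmetric] using m md lt by auto
  qed
qed

text \<open>\<open>H(n\<^sub>1, n\<^sub>2)\<close> depends on \<open>n\<close> through \<open>\<alpha>\<close> and \<open>\<beta>\<close>, and has \<open>n - 2\<close> vertices.\<close>

definition H_graph :: "nat \<Rightarrow> nat \<Rightarrow> nat \<Rightarrow> (nat + nat \<times> nat + nat) pair_pre_digraph" where
  "H_graph n n1 n2 =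
     disjoint_union (path_graph n1)
       (disjoint_union (disjoint_copies (H_alpha n n1 n2) (path_graph n2))
         (path_graph (H_beta n n1 n2)))"

section \<open>Containment, planarity, spectral radius\<close>

definition contains_graph :: "'a pair_pre_digraph \<Rightarrow> 'b pair_pre_digraph \<Rightarrow> bool" where
  "contains_graph G F \<longleftrightarrow>
     (\<exists>K :: 'a pair_pre_digraph. subgraph (with_proj K) (with_proj G) \<and>
        digraph_iso (with_proj F) (with_proj K))"

text \<open>
  The plane is \<^typ>\<open>complex\<close>, as in the library's Jordan curve theorem. The vertices are distinct
  points, each edge \<open>{u, v}\<close> is a simple arc \<open>\<gamma> {u, v}\<close> joining its ends and containing no other
  vertex, and distinct edges meet only in the points of common end vertices.
\<close>

definition plane_drawing ::
    "'a pair_pre_digraph \<Rightarrow> ('a \<Rightarrow> complex) \<Rightarrow> ('a set \<Rightarrow> real \<Rightarrow> complex) \<Rightarrow> bool" where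
  "plane_drawing G p \<gamma> \<longleftrightarrow>
     inj_on p (pverts G) \<and>
     (\<forall>(u, v) \<in> parcs G.
        arc (\<gamma> {u, v}) \<and>
        {pathstart (\<gamma> {u, v}), pathfinish (\<gamma> {u, v})} = {p u, p v} \<and>
        path_image (\<gamma> {u, v}) \<inter> p ` pverts G = {p u, p v}) \<and>
     (\<forall>(u, v) \<in> parcs G. \<forall>(x, y) \<in> parcs G. {u, v} \<noteq> {x, y} \<longrightarrow>
        path_image (\<gamma> {u, v}) \<inter> path_image (\<gamma> {x, y}) \<subseteq> p ` ({u, v} \<inter> {x, y}))"

definition planar_graph :: "'a pair_pre_digraph \<Rightarrow> bool" where
  "planar_graph G \<longleftrightarrow> pair_graph G \<and> (\<exists>p \<gamma>. plane_drawing G p \<gamma>)"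

definition adjacency_matrix :: "'a pair_pre_digraph \<Rightarrow> (nat \<Rightarrow> 'a) \<Rightarrow> complex mat" where
  "adjacency_matrix G f =
     Matrix.mat (card (pverts G)) (card (pverts G))
       (\<lambda>(i, j). if (f i, f j) \<in> parcs G then 1 else 0)"

text \<open>
  The choice of the enumeration of the vertices is immaterial: adjacency matrices for different
  enumerations are conjugate by a permutation matrix.
\<close>

definition graph_spectral_radius :: "'a pair_pre_digraph \<Rightarrow> real" (\<open>\<rho>\<close>) where
  "\<rho> G = spectral_radius
     (adjacency_matrix G (SOME f. bij_betw f {..<card (pverts G)} (pverts G)))"

section \<open>Planar spectral extremal graphs\<close>

definition planar_free :: "nat \<Rightarrow> 'b pair_pre_digraph \<Rightarrow> 'a pair_pre_digraph \<Rightarrow> bool" where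
  "planar_free n F G \<longleftrightarrow>
     pair_graph G \<and> card (pverts G) = n \<and> planar_graph G \<and> \<not> contains_graph G F"

text \<open>
  The maximum is taken over graphs with vertices in \<^typ>\<open>nat\<close>; every finite graph is isomorphic to
  such a graph. For fixed \<open>n\<close> only finitely many values occur.
\<close>

definition spex_planar :: "nat \<Rightarrow> 'b pair_pre_digraph \<Rightarrow> real" where
  "spex_planar n F = Max {\<rho> G | G :: nat pair_pre_digraph. planar_free n F G}"

lemma finite_spex_planar_values:
  "finite {\<rho> G | G :: nat pair_pre_digraph. planar_free n F G}"
proof (rule finite_subset)
  let ?M = "\<lambda>S. Matrix.mat n n (\<lambda>ij. if ij \<in> S then 1 else (0 :: complex))"
  show "{\<rho> G | G :: nat pair_pre_digraph. planar_free n F G}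
      \<subseteq> (\<lambda>S. spectral_radius (?M S)) ` Pow ({..<n} \<times> {..<n})"
  proof clarify
    fix G :: "nat pair_pre_digraph" assume "planar_free n F G"
    then have c: "card (pverts G) = n" by (simp add: planar_free_def)
    define f where "f = (SOME f. bij_betw f {..<card (pverts G)} (pverts G))"
    define S where "S = {(i, j). i < n \<and> j < n \<and> (f i, f j) \<in> parcs G}"
    have "adjacency_matrix G f = ?M S"
      by (rule eq_matI) (auto simp: adjacency_matrix_def S_def c)
    then have "\<rho> G = spectral_radius (?M S)"
      unfolding graph_spectral_radius_def f_def by simp
    moreover have "S \<in> Pow ({..<n} \<times> {..<n})"
      by (auto simp: S_def)
    ultimately show "\<rho> G \<in> (\<lambda>S. spectral_radius (?M S)) ` Pow ({..<n} \<times> {..<n})"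
      by blast
  qed
qed simp

definition spex_extremal :: "nat \<Rightarrow> 'b pair_pre_digraph \<Rightarrow> 'a pair_pre_digraph \<Rightarrow> bool" where
  "spex_extremal n F G \<longleftrightarrow> planar_free n F G \<and> \<rho> G = spex_planar n F"

section \<open>Sanity checks\<close>

lemma pair_graphI_simple:
  assumes "finite (pverts G)" "parcs G \<subseteq> pverts G \<times> pverts G"
    "\<And>u v. (u, v) \<in> parcs G \<Longrightarrow> (v, u) \<in> parcs G" "\<And>u. (u, u) \<notin> parcs G"
  shows "pair_graph G"
proof -
  have "finite (parcs G)"
    using assms(1,2) by (meson finite_SigmaI finite_subset)
  then show ?thesis
    using assms by unfold_locales (auto simp: symmetric_def intro: symI)
qed

lemma pair_graph_path_graph: "pair_graph (path_graph m)"
  by (rule pair_graphI_simple) (auto simp: path_graph_def)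

lemma pair_graph_cycle_graph:
  assumes "3 \<le> l" shows "pair_graph (cycle_graph l)"
  using assms by (intro pair_graphI_simple) (auto simp: cycle_graph_def mod_Suc split: if_splits)

lemma complete_graph_complete_digraph: "K\<^bsub>m\<^esub> (with_proj (complete_graph m))"
  unfolding complete_digraph_pair_def by (auto simp: complete_graph_def)

lemma complete_bipartite_graph_complete_bipartite_digraph:
  "K\<^bsub>m,n\<^esub> (with_proj (complete_bipartite_graph m n))"
proof -
  have "pverts (complete_bipartite_graph m n) = Inl ` {..<m} \<union> Inr ` {..<n}"
    by (auto simp: complete_bipartite_graph_def)
  moreover have "Inl ` {..<m} \<inter> Inr ` {..<n} = {}" by auto
  moreover have "card (Inl ` {..<m}) = m" "card (Inr ` {..<n}) = n"
    by (simp_all add: card_image)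
  ultimately show ?thesis
    unfolding complete_bipartite_digraph_pair_def
    by (intro conjI exI[of _ "Inl ` {..<m}"] exI[of _ "Inr ` {..<n}"])
      (simp_all add: complete_bipartite_graph_def)
qed

lemma card_H_graph:
  assumes "1 \<le> n2" "n1 + 2 * n2 + 2 \<le> n"
  shows "card (pverts (H_graph n n1 n2)) = n - 2"
proof -
  have "int n - 2 = int n1 + int (H_alpha n n1 n2) * int n2 + int (H_beta n n1 n2)"
    using H_alpha_beta_iff[OF assms] by blast
  then have "n - 2 = n1 + H_alpha n n1 n2 * n2 + H_beta n n1 n2"
    using assms by (simp add: flip: of_nat_mult of_nat_add)
  then show ?thesis
    by (simp add: H_graph_def disjoint_union_def disjoint_copies_def path_graph_def
        card_Plus card_cartesian_product)
qed

lemma pair_graph_disjoint_union: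
  assumes "pair_graph G" "pair_graph H" shows "pair_graph (disjoint_union G H)"
proof -
  interpret G: pair_graph G by fact
  interpret H: pair_graph H by fact
  show ?thesis
    by (rule pair_graphI_simple)
      (auto simp: disjoint_union_def G.arcs_symmetric H.arcs_symmetric G.pair_finite_verts
        H.pair_finite_verts dest: G.in_arcsD1 G.in_arcsD2 H.in_arcsD1 H.in_arcsD2
        G.pair_no_loops H.pair_no_loops)
qed

lemma pair_graph_disjoint_copies:
  assumes "pair_graph G" shows "pair_graph (disjoint_copies k G)"
proof -
  interpret G: pair_graph G by fact
  show ?thesis
    by (rule pair_graphI_simple)
      (auto simp: disjoint_copies_def G.arcs_symmetric G.pair_finite_verts
        dest: G.in_arcsD1 G.in_arcsD2 G.pair_no_loops)
qed

lemma pair_graph_graph_join: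
  assumes "pair_graph G" "pair_graph H" shows "pair_graph (graph_join G H)"
proof -
  interpret G: pair_graph G by fact
  interpret H: pair_graph H by fact
  show ?thesis
    by (rule pair_graphI_simple)
      (auto simp: graph_join_def disjoint_union_def G.arcs_symmetric H.arcs_symmetric
        G.pair_finite_verts H.pair_finite_verts
        dest: G.in_arcsD1 G.in_arcsD2 H.in_arcsD1 H.in_arcsD2 G.pair_no_loops H.pair_no_loops)
qed

lemma pair_graph_H_graph: "pair_graph (H_graph n n1 n2)"
  unfolding H_graph_def
  by (intro pair_graph_disjoint_union pair_graph_disjoint_copies pair_graph_path_graph)

end

theory Submission
  imports Defs
begin

text \<open>
  Let \<open>G\<close> be planar with \<open>\<rho>(G) \<ge> \<surd>(2n - 4)\<close>. Its Perron vector is bounded by counting walks of length two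
  with the edge bounds \<open>3n - 6\<close> and, for bipartite graphs, \<open>2n - 4\<close>: two vertices \<open>u\<close>, \<open>v\<close> have weight close
  to the maximum and are both adjacent to almost all vertices, and every other weight is small.
  Replacing all edges at the remaining vertices by edges to \<open>u\<close> and \<open>v\<close> does not decrease the quadratic
  form of the Perron vector, because planar graphs are degenerate and contain no \<open>K\<^sub>3\<^sub>,\<^sub>3\<close>. So it suffices
  to bound the form of the resulting graph, the join of \<open>{u, v}\<close> with the graph induced on the common neighbours;
  planarity and the absence of \<open>C\<^sub>l\<close> force the latter to be a linear forest whose two longest paths
  have at most \<open>l - 3\<close> vertices together.

  For such a join the spectral radius \<open>t + 1/t\<close> solves an explicit equation in which a path with \<open>m\<close>
  vertices contributes, up to a factor, \<open>m\<close> minus a defect that is strictly concave in \<open>m\<close>. The best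
  multiset of path lengths is found by moving single vertices from shorter to longer paths. A positive
  eigenvector of the optimal graph is turned into a supersolution for all competitors, and equality in the
  comparison of the quadratic forms leaves only the graphs in the theorem.

  The edge bounds come from a weighted form of Euler's inequality for drawings with arbitrary arcs. The faces
  are counted from below by inserting the edges one at a time (Jordan curve theorem) and from above by
  double counting, since every arc borders at most two faces and the boundary of every face
  contains a cycle (Janiszewski's theorem).
\<close>

hide_const (open) Digraph_Component.connected

section \<open>Plane drawings and Euler's inequality\<close>

text \<open>Maximality and uniqueness come out of one chain. A target value \<open>r\<close> is
  fixed in advance, the spectral radius of the claimed optimum. A competitor with spectral radius at
  least \<open>r\<close> yields a nonnegative \<open>y\<close> with \<open>r * y <= A y\<close>, and
  its hub graph, with adjacency matrix \<open>A'\<close>, carries an explicit positive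
  \<open>z\<close> with \<open>A' z <= r * z\<close>. Then
  \<open>r |y|^2 <= y A y <= y A' y <= r |y|^2\<close>, and equality throughout identifies the
  competitor. The parameter \<open>t\<close> arises because the path recurrence has the
  characteristic roots \<open>t\<close> and \<open>1/t\<close>. For large \<open>n\<close> it is
  about \<open>1 / sqrt (2 n)\<close>, so the ends of a path are felt only over a short distance.
  Excluding K_{3,3} bounds the degrees among the common neighbours of the hubs by 2 but leaves
  cycles. A cycle missing some common neighbour contradicts planarity; a cycle through all of them
  is a planar double wheel and can only be excluded by the absence of \<open>C_l\<close>. Weights in
  Euler's inequality adapt it to each use: 1/3 in general, 1/4 for bipartite graphs, a mixture for
  the double wheel.\<close>

lemma interior_arc_empty:
  fixes g :: "real \<Rightarrow> complex"
  assumes "arc g"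
  shows "interior (path_image g) = {}"
proof (rule ccontr)
  assume ne: "interior (path_image g) \<noteq> {}"
  obtain h where h: "homeomorphism {0..1} (path_image g) g h"
    using homeomorphism_arc[OF assms] by blast
  obtain x r where r: "r > 0" "ball x r \<subseteq> path_image g"
    using ne mem_interior by blast
  have hcont: "continuous_on (path_image g) h" using h unfolding homeomorphism_def by auto
  have hinj: "inj_on h (path_image g)"
    using h unfolding homeomorphism_def by (metis inj_on_def)
  define y where "y = x + of_real (r / 2)"
  have y: "y \<in> ball x r" "y \<noteq> x" using r by (auto simp: y_def dist_norm)
  have x: "x \<in> ball x r" using r by auto
  have "h x \<noteq> h y" using inj_onD[OF hinj, of x y] x y r by blast
  \<comment> \<open>The inverse \<open>h\<close> of the arc is continuous and injective on the disc.
    Removing the point with the middle parameter \<open>m\<close> leaves the disc connected, so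
    \<open>h\<close> must take the value \<open>m\<close> a second time.\<close>
  define m where "m = (h x + h y) / 2"
  have con_img: "connected (h ` T)" if "connected T" "T \<subseteq> ball x r" for T
    using that hcont r by (meson connected_continuous_image continuous_on_subset subset_trans)
  have between: "m \<in> h ` T" if "connected T" "T \<subseteq> ball x r" "x \<in> T" "y \<in> T" for T
  proof (cases "h x \<le> h y")
    case True
    then show ?thesis using connectedD_interval[OF con_img[OF that(1,2)], of "h x" "h y" m] that
      by (auto simp: m_def)
  next
    case False
    then show ?thesis using connectedD_interval[OF con_img[OF that(1,2)], of "h y" "h x" m] that
      by (auto simp: m_def)
  qed
  obtain p where p: "p \<in> ball x r" "h p = m" using between[of "ball x r"] x y by auto
  have "x \<noteq> p" "y \<noteq> p" using p \<open>h x \<noteq> h y\<close> by (auto simp: m_def)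
  have con: "connected (ball x r - {p})"
    using connected_open_delete[of "ball x r" p] by simp
  have "m \<in> h ` (ball x r - {p})"
    using between[OF con] x y \<open>x \<noteq> p\<close> \<open>y \<noteq> p\<close> by simp
  then obtain q where q: "q \<in> ball x r" "q \<noteq> p" "h q = m"
    by blast
  have "q \<in> path_image g" "p \<in> path_image g" using q(1) p(1) r(2) by blast+
  then have "q = p" using inj_onD[OF hinj, of q p] q(3) p(2) by simp
  with q show False by simp
qed

text \<open>
  Cores play the role of cycles: every cycle is a core, and an edge set without a core is a forest.
\<close>

definition core :: "'a set set \<Rightarrow> bool" where
  "core B \<longleftrightarrow> B \<noteq> {} \<and> (\<forall>e\<in>B. \<forall>a\<in>e. \<exists>e'\<in>B. e' \<noteq> e \<and> a \<in> e')"

text \<open>Certificate for at least \<open>card X\<close> faces: sample points in pairwise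
  different components of the complement. Under the insertion of an arc, sample points are easier to
  follow than the components themselves.\<close>

definition separated_points :: "complex set \<Rightarrow> complex set \<Rightarrow> bool" where
  "separated_points K X \<longleftrightarrow> finite X \<and> X \<subseteq> - K \<and>
     (\<forall>x\<in>X. \<forall>y\<in>X. connected_component (- K) x y \<longrightarrow> x = y)"

lemma connected_component_Compl_antimono:
  "connected_component (- K') x y \<Longrightarrow> K \<subseteq> K' \<Longrightarrow> connected_component (- K) x y"
  by (metis Compl_anti_mono connected_component_of_subset)

lemma connected_component_ball:
  fixes x y z :: complex
  assumes "x \<in> ball z r" "y \<in> ball z r" "ball z r \<subseteq> S"
  shows "connected_component S x y"
  using assms by (meson connected_ball connected_component_def)

lemma ball_minus_dense:
  fixes C :: "complex set"
  assumes "interior C = {}" "r > 0"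
  shows "\<exists>y \<in> ball x r. y \<notin> C"
proof (rule ccontr)
  assume "\<not> ?thesis"
  then have "ball x r \<subseteq> interior C" by (intro interior_maximal) auto
  then show False using assms by (metis centre_in_ball empty_iff subsetD)
qed

text \<open>A component of the complement of a closed set is open, so each sample point can be moved
  inside its own component off a set without interior. This clears the way for the next arc to be
  inserted.\<close>

lemma separated_points_avoid:
  fixes C :: "complex set"
  assumes "separated_points K X" "closed K" "interior C = {}"
  shows "\<exists>X'. separated_points K X' \<and> X' \<inter> C = {} \<and> card X' = card X"
proof -
  have "\<exists>x'. connected_component (- K) x x' \<and> x' \<notin> C" if x: "x \<in> X" for x
  proof -
    have "x \<in> - K" "open (- K)" using assms x by (auto simp: separated_points_def)
    then obtain r where r: "r > 0" "ball x r \<subseteq> - K" using open_contains_ball by blast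
    obtain y where "y \<in> ball x r" "y \<notin> C" using ball_minus_dense[OF assms(3) r(1)] by blast
    then show ?thesis using r connected_component_ball[of x x r y "-K"] by auto
  qed
  then obtain f where f: "\<And>x. x \<in> X \<Longrightarrow> connected_component (- K) x (f x) \<and> f x \<notin> C"
    by metis
  have sep: "x = y" if "x \<in> X" "y \<in> X" "connected_component (- K) (f x) (f y)" for x y
    using assms(1) f that unfolding separated_points_def
    by (meson connected_component_sym connected_component_trans)
  have inj: "inj_on f X"
  proof (rule inj_onI)
    fix x y assume xy: "x \<in> X" "y \<in> X" "f x = f y"
    have "f x \<in> - K" using f[OF xy(1)] connected_component_in by blast
    then show "x = y" using sep[OF xy(1,2)] xy(3) by (simp add: connected_component_refl)
  qed
  have "f ` X \<subseteq> - K" using f connected_component_in by blast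
  moreover have "\<forall>x\<in>f ` X. \<forall>y\<in>f ` X. connected_component (- K) x y \<longrightarrow> x = y"
    using sep by blast
  ultimately have "separated_points K (f ` X)"
    using assms(1) unfolding separated_points_def by auto
  moreover have "f ` X \<inter> C = {}" using f by auto
  ultimately show ?thesis using inj card_image by blast
qed

text \<open>Here the vertices are the points of the drawing themselves, so an edge is the pair of
  its end points and no placement map has to be carried along.\<close>

locale plane_graph =
  fixes V :: "complex set" and E :: "complex set set" and \<gamma> :: "complex set \<Rightarrow> real \<Rightarrow> complex"
  assumes finite_V: "finite V"
    and edge: "e \<in> E \<Longrightarrow> \<exists>a\<in>V. \<exists>b\<in>V. a \<noteq> b \<and> e = {a, b}"
    and arc: "e \<in> E \<Longrightarrow> arc (\<gamma> e)"
    and ends: "e \<in> E \<Longrightarrow> {pathstart (\<gamma> e), pathfinish (\<gamma> e)} = e"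
    and arc_V: "e \<in> E \<Longrightarrow> path_image (\<gamma> e) \<inter> V = e"
    and cross: "e \<in> E \<Longrightarrow> e' \<in> E \<Longrightarrow> e \<noteq> e' \<Longrightarrow>
      path_image (\<gamma> e) \<inter> path_image (\<gamma> e') \<subseteq> e \<inter> e'"
begin

definition P :: "complex set \<Rightarrow> complex set" where "P e = path_image (\<gamma> e)"
definition U :: "complex set set \<Rightarrow> complex set" where "U B = (\<Union>e\<in>B. P e)"
definition pic :: "complex set set \<Rightarrow> complex set" where "pic B = V \<union> U B"
definition arcs_of :: "complex set set \<Rightarrow> (complex \<times> complex) set" where
  "arcs_of B = {(x, y). {x, y} \<in> B}"
definition con :: "complex set set \<Rightarrow> complex \<Rightarrow> complex \<Rightarrow> bool" where
  "con B x y \<longleftrightarrow> (x, y) \<in> (arcs_of B)\<^sup>*"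

lemma finite_E: "finite E"
proof -
  have "E \<subseteq> Pow V" using edge by auto
  then show ?thesis using finite_V finite_subset by blast
qed

lemma edge_sub_P: "e \<in> E \<Longrightarrow> e \<subseteq> P e"
  using arc_V P_def by auto
lemma edge_sub_V: "e \<in> E \<Longrightarrow> e \<subseteq> V"
  using arc_V by auto
lemma P_inter: "e \<in> E \<Longrightarrow> e' \<in> E \<Longrightarrow> e \<noteq> e' \<Longrightarrow> P e \<inter> P e' \<subseteq> e \<inter> e'"
  using cross unfolding P_def by auto
lemma compact_P: "e \<in> E \<Longrightarrow> compact (P e)"
  unfolding P_def using arc compact_arc_image by blast
lemma compact_U: "B \<subseteq> E \<Longrightarrow> compact (U B)"
  unfolding U_def using compact_P finite_E by (intro compact_UN) (auto intro: finite_subset)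
lemma compact_pic: "B \<subseteq> E \<Longrightarrow> compact (pic B)"
  unfolding pic_def using compact_U finite_V by (simp add: compact_Un finite_imp_compact)
lemma interior_P: "e \<in> E \<Longrightarrow> interior (P e) = {}"
  unfolding P_def using arc interior_arc_empty by blast
lemma pic_insert: "pic (insert e B) = pic B \<union> P e"
  unfolding pic_def U_def by auto
lemma U_insert: "U (insert e B) = U B \<union> P e"
  unfolding U_def by auto

lemma P_inter_pic:
  assumes "e \<in> E" "B \<subseteq> E" "e \<notin> B" shows "P e \<inter> pic B = e"
proof
  show "P e \<inter> pic B \<subseteq> e"
    using assms P_inter arc_V unfolding pic_def U_def P_def by blast
  show "e \<subseteq> P e \<inter> pic B"
    using edge_sub_P[OF assms(1)] edge_sub_V[OF assms(1)] unfolding pic_def by blast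
qed

lemma orient:
  assumes "e \<in> E" "e = {a, b}" "a \<noteq> b"
  shows "\<exists>g. arc g \<and> path_image g = P e \<and> pathstart g = a \<and> pathfinish g = b"
proof (cases "pathstart (\<gamma> e) = a")
  case True
  then have "pathfinish (\<gamma> e) = b" using ends[OF assms(1)] assms by (metis doubleton_eq_iff)
  then show ?thesis using True arc[OF assms(1)] P_def by blast
next
  case False
  then have "pathfinish (\<gamma> e) = a" "pathstart (\<gamma> e) = b"
    using ends[OF assms(1)] assms by (metis doubleton_eq_iff)+
  then show ?thesis using arc[OF assms(1)] P_def
    by (intro exI[of _ "reversepath (\<gamma> e)"]) (auto simp: arc_reversepath)
qed

lemma con_sym: "con B x y \<Longrightarrow> con B y x"
proof -
  have "sym (arcs_of B)" unfolding arcs_of_def sym_def by (auto simp: insert_commute)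
  then show "con B x y \<Longrightarrow> con B y x" unfolding con_def using sym_rtrancl symD by metis
qed

lemma con_path_component:
  assumes "con B a b" "B \<subseteq> E" "a \<noteq> b"
  shows "path_component (U B) a b"
  using assms(1,3) unfolding con_def
proof (induction rule: rtrancl_induct)
  case base then show ?case by simp
next
  case (step y z)
  have yz: "{y, z} \<in> B" using step(2) unfolding arcs_of_def by auto
  have "path_component (P {y,z}) y z"
  proof -
    have e: "{y,z} \<in> E" using yz assms by auto
    then have "y \<noteq> z" using edge by fastforce
    then obtain g where "arc g" "path_image g = P {y,z}" "pathstart g = y" "pathfinish g = z"
      using orient[OF e] by blast
    then show ?thesis unfolding path_component_def using arc_imp_path by blast
  qed
  moreover have "P {y,z} \<subseteq> U B" using yz unfolding U_def by auto
  ultimately have "path_component (U B) y z" using path_component_of_subset by blast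
  then show ?case using step by (cases "a = y") (auto intro: path_component_trans)
qed

lemma con_arc:
  assumes "con B a b" "B \<subseteq> E" "a \<noteq> b"
  obtains g where "arc g" "path_image g \<subseteq> U B" "pathstart g = a" "pathfinish g = b"
proof -
  obtain g where "path g" "path_image g \<subseteq> U B" "pathstart g = a" "pathfinish g = b"
    using con_path_component[OF assms] unfolding path_component_def by blast
  then show ?thesis using path_contains_arc[of g a b] assms(3) that by (metis subset_trans)
qed

text \<open>Inside \<open>U B\<close> the ends of \<open>e\<close> are joined by an arc
  \<open>A\<close>, which meets \<open>P e\<close> only in \<open>a\<close> and \<open>b\<close>;
  together they form a Jordan curve.\<close>

lemma closing_curve:
  assumes "e \<in> E" "B \<subseteq> E" "e \<notin> B" "e = {a, b}" "a \<noteq> b" "con B a b"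
  obtains A where "A \<subseteq> U B" "connected A" "compact A" "a \<in> A" "b \<in> A"
    "connected (inside (A \<union> P e))" "connected (outside (A \<union> P e))"
    "open (inside (A \<union> P e))" "open (outside (A \<union> P e))"
    "frontier (inside (A \<union> P e)) = A \<union> P e" "frontier (outside (A \<union> P e)) = A \<union> P e"
proof -
  obtain g where g: "arc g" "path_image g \<subseteq> U B" "pathstart g = a" "pathfinish g = b"
    using con_arc assms by metis
  have e': "e = {b, a}" using assms by auto
  obtain d where d: "arc d" "path_image d = P e" "pathstart d = b" "pathfinish d = a"
    using orient[OF assms(1) e'] assms(5) by metis
  have "path_image g \<inter> path_image d \<subseteq> {a, b}"
    using P_inter_pic[OF assms(1-3)] g(2) d(2) assms(4) unfolding pic_def by auto
  then have s: "simple_path (g +++ d)"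
    using g d by (intro simple_path_join_loop) auto
  have im: "path_image (g +++ d) = path_image g \<union> P e"
    using g d by (simp add: path_image_join)
  have lp: "pathfinish (g +++ d) = pathstart (g +++ d)" using g d by simp
  note J = Jordan_inside_outside[OF s lp, unfolded im]
  show ?thesis
    using that[of "path_image g"] J g
    by (metis compact_arc_image connected_arc_image pathfinish_in_path_image pathstart_in_path_image)
qed

section \<open>Lower bound for the number of faces\<close>

lemma inside_outside_separated:
  fixes J :: "complex set"
  assumes "x \<in> inside J" "y \<in> outside J" "J \<subseteq> K" shows "\<not> connected_component (- K) x y"
proof
  assume "connected_component (- K) x y"
  then have "connected_component (- J) x y"
    using assms(3) connected_component_Compl_antimono by blast
  then have "connected_component_set (- J) x = connected_component_set (- J) y"
    by (simp add: connected_component_eq_eq connected_component_eq)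
  then show False using assms(1,2) unfolding inside_def outside_def by auto
qed

lemma open_edge_point:
  assumes "e \<in> E" shows "\<exists>q. q \<in> P e - e"
proof -
  have "uncountable (P e)"
    unfolding P_def using arc[OF assms] by (simp add: arc_image_uncountable)
  moreover have "finite e" using edge[OF assms] by auto
  ultimately have "\<not> P e \<subseteq> e" by (meson countable_finite finite_subset)
  then show ?thesis by blast
qed


text \<open>A small disc around an inner point \<open>q\<close> of the edge avoids the old drawing
  but meets both sides of the Jordan curve closed by \<open>e\<close>. Its points \<open>i\<close>
  and \<open>u\<close> share a face before the insertion and are separated after it, so a face is
  split.\<close>

lemma closing_edge_separates:
  assumes "e \<in> E" "B \<subseteq> E" "e \<notin> B" "e = {a, b}" "a \<noteq> b" "con B a b"
    and X: "separated_points (pic B) X"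
  shows "\<exists>X'. separated_points (pic (insert e B)) X' \<and> card X' \<ge> card X + 1"
proof -
  obtain A where A: "A \<subseteq> U B"
    "frontier (inside (A \<union> P e)) = A \<union> P e" "frontier (outside (A \<union> P e)) = A \<union> P e"
    using closing_curve[OF assms(1-6)] by metis
  define J where "J = A \<union> P e"
  have Jsub: "J \<subseteq> pic B \<union> P e" using A(1) unfolding J_def pic_def by auto
  obtain q where q: "q \<in> P e - e" using open_edge_point[OF assms(1)] by blast
  have "q \<in> - pic B" using q P_inter_pic[OF assms(1-3)] by auto
  moreover have "open (- pic B)" using compact_pic[OF assms(2)] compact_imp_closed by blast
  ultimately obtain r where r: "r > 0" "ball q r \<subseteq> - pic B" using open_contains_ball by blast
  have "q \<in> closure (inside J)" "q \<in> closure (outside J)"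
    using q A(2,3) unfolding J_def frontier_def by auto
  then obtain i u where i: "i \<in> inside J" "i \<in> ball q r" and u: "u \<in> outside J" "u \<in> ball q r"
    using r(1) unfolding closure_approachable by (metis dist_commute mem_ball)
  have iu: "i \<notin> P e" "u \<notin> P e"
    using i(1) u(1) unfolding inside_def outside_def J_def by auto
  have iu': "i \<notin> pic B" "u \<notin> pic B" using i u r by auto
  have ciu: "connected_component (- pic B) i u"
    using connected_component_ball[OF i(2) u(2) r(2)] .
  have niu: "\<not> connected_component (- (pic B \<union> P e)) i u"
    using inside_outside_separated[OF i(1) u(1) Jsub] .
  obtain X1 where X1: "separated_points (pic B) X1" "X1 \<inter> P e = {}" "card X1 = card X"
    using separated_points_avoid[OF X _ interior_P[OF assms(1)]] compact_pic[OF assms(2)]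
      compact_imp_closed by blast
  \<comment> \<open>Sample points in the face that is split: there is at most one, and it is traded
    for the two points \<open>i\<close> and \<open>u\<close>.\<close>
  define D where "D = {x \<in> X1. connected_component (- pic B) x i}"
  have "finite X1" using X1 unfolding separated_points_def by auto
  have D1: "x = y" if "x \<in> D" "y \<in> D" for x y
  proof -
    have "connected_component (- pic B) x i" "connected_component (- pic B) i y" "x \<in> X1" "y \<in> X1"
      using that connected_component_sym unfolding D_def by blast+
    then show ?thesis
      using connected_component_trans X1(1) unfolding separated_points_def by blast
  qed
  have "finite D" "D \<subseteq> X1" using \<open>finite X1\<close> unfolding D_def by auto
  then have "card D \<le> 1" using D1 card_le_Suc0_iff_eq[of D] by simp
  then have cY: "card (X1 - D) + 1 \<ge> card X1"
    using \<open>finite D\<close> \<open>D \<subseteq> X1\<close> by (simp add: card_Diff_subset)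
  define X' where "X' = insert i (insert u (X1 - D))"
  have notc: "\<not> connected_component (- pic B) x i" "\<not> connected_component (- pic B) x u"
    if "x \<in> X1 - D" for x
  proof -
    show *: "\<not> connected_component (- pic B) x i" using that unfolding D_def by auto
    show "\<not> connected_component (- pic B) x u"
      using * connected_component_trans connected_component_sym[OF ciu] by blast
  qed
  have refl: "connected_component (- pic B) i i" "connected_component (- pic B) u u"
    using iu' by (auto simp: connected_component_refl)
  have nin: "i \<notin> X1 - D" "u \<notin> X1 - D" using notc[of i] notc[of u] refl by blast+
  have "i \<noteq> u" using niu iu iu' by (auto simp: connected_component_refl)
  then have "card X' = card (X1 - D) + 2"
    using nin \<open>finite X1\<close> unfolding X'_def by auto
  moreover have "separated_points (pic B \<union> P e) X'"
    unfolding separated_points_def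
  proof (intro conjI ballI impI)
    show "finite X'" using \<open>finite X1\<close> X'_def by auto
    show "X' \<subseteq> - (pic B \<union> P e)"
      using X1 iu iu' unfolding X'_def separated_points_def by auto
    fix x y assume xy: "x \<in> X'" "y \<in> X'" "connected_component (- (pic B \<union> P e)) x y"
    have c: "connected_component (- pic B) x y"
      using xy(3) connected_component_Compl_antimono by blast
    then have c': "connected_component (- pic B) y x" by (rule connected_component_sym)
    have s: "connected_component (- (pic B \<union> P e)) y x"
      using xy(3) by (rule connected_component_sym)
    have XX: "x = y" if "x \<in> X1 - D" "y \<in> X1 - D"
      using X1(1) c that unfolding separated_points_def by auto
    show "x = y"
      using xy(1,2) XX notc c c' niu s xy(3) unfolding X'_def by blast
  qed
  ultimately show ?thesis using cY X1(3) unfolding pic_insert by (intro exI[of _ X']) auto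
qed

lemma separated_points_insert:
  assumes "e \<in> E" "B \<subseteq> E" "separated_points (pic B) X"
  shows "\<exists>X'. separated_points (pic (insert e B)) X' \<and> card X' = card X"
proof -
  obtain X' where X: "separated_points (pic B) X'" "X' \<inter> P e = {}" "card X' = card X"
    using separated_points_avoid[OF assms(3) _ interior_P[OF assms(1)]] compact_pic[OF assms(2)]
      compact_imp_closed by blast
  have "separated_points (pic B \<union> P e) X'"
    using X unfolding separated_points_def
    using connected_component_Compl_antimono[of "pic B \<union> P e" _ _ "pic B"] by blast
  then show ?thesis using X unfolding pic_insert by blast
qed

lemma con_insert:
  assumes "con (insert {a, b} B) x y"
  shows "con B x y \<or> con B x a \<and> con B b y \<or> con B x b \<and> con B a y"
proof -
  have eq: "arcs_of (insert {a, b} B) = insert (a, b) (insert (b, a) (arcs_of B))"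
    unfolding arcs_of_def by (auto simp: doubleton_eq_iff)
  have "(x, y) \<in> (insert (a, b) (insert (b, a) (arcs_of B)))\<^sup>*"
    using assms unfolding con_def eq .
  then show ?thesis unfolding con_def rtrancl_insert by (auto intro: rtrancl_trans)
qed

lemma con_refl: "con B x x" unfolding con_def by simp
lemma con_trans: "con B x y \<Longrightarrow> con B y z \<Longrightarrow> con B x z" unfolding con_def by simp

lemma con_mono: "con B x y \<Longrightarrow> B \<subseteq> B' \<Longrightarrow> con B' x y"
  unfolding con_def arcs_of_def by (rule rtrancl_mono[THEN subsetD]) auto

lemma con_edge: "{a, b} \<in> B \<Longrightarrow> con B a b"
  unfolding con_def arcs_of_def by auto

text \<open>Euler's formula as an inequality, with \<open>R\<close> a transversal of the components
  of the graph \<open>(V, B)\<close>. An inserted edge either closes a curve and creates a face, or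
  joins two components.\<close>

lemma many_faces_aux:
  assumes "B \<subseteq> E"
  shows "\<exists>X R. separated_points (pic B) X \<and> R \<subseteq> V \<and> (\<forall>v\<in>V. \<exists>r\<in>R. con B v r) \<and>
    (\<forall>x\<in>R. \<forall>y\<in>R. con B x y \<longrightarrow> x = y) \<and> card X + card V \<ge> card B + card R + 1"
proof -
  have "finite B" using assms finite_E finite_subset by blast
  then show ?thesis using assms(1)
  proof (induction B rule: finite_induct)
    case empty
    obtain x where x: "x \<notin> V" using finite_V ex_new_if_finite infinite_UNIV_char_0 by metis
    have "separated_points (pic {}) {x}"
      using x unfolding separated_points_def pic_def U_def by auto
    moreover have "\<forall>x\<in>V. \<forall>y\<in>V. con {} x y \<longrightarrow> x = y" unfolding con_def arcs_of_def by auto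
    ultimately show ?case
      using con_refl by (intro exI[of _ "{x}"] exI[of _ V] conjI ballI bexI) auto
  next
    case (insert e B)
    then obtain X R where IH: "separated_points (pic B) X" "R \<subseteq> V" "\<And>v. v \<in> V \<Longrightarrow> \<exists>r\<in>R. con B v r"
      "\<And>x y. x\<in>R \<Longrightarrow> y\<in>R \<Longrightarrow> con B x y \<Longrightarrow> x = y" "card X + card V \<ge> card B + card R + 1" by auto
    have e: "e \<in> E" "B \<subseteq> E" using insert by auto
    obtain a b where ab: "a \<in> V" "b \<in> V" "a \<noteq> b" "e = {a, b}" using edge[OF e(1)] by blast
    have finR: "finite R" using IH(2) finite_V finite_subset by blast
    have mono: "con (insert e B) x y" if "con B x y" for x y using con_mono[OF that] by blast
    show ?case
    proof (cases "con B a b")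
      case True
      obtain X' where X': "separated_points (pic (insert e B)) X'" "card X' \<ge> card X + 1"
        using closing_edge_separates[OF e insert(2) ab(4,3) True IH(1)] by blast
      have "con B x y" if "con (insert e B) x y" for x y
        using con_insert[of a b B x y] that True ab(4) con_sym con_trans by blast
      moreover have "card X' + card V \<ge> card (insert e B) + card R + 1"
        using X'(2) IH(5) insert(1,2) by simp
      ultimately show ?thesis using X'(1) IH(2-4) mono by meson
    next
      case False
      obtain X' where X': "separated_points (pic (insert e B)) X'" "card X' = card X"
        using separated_points_insert[OF e IH(1)] by blast
      obtain r1 r2 where r: "r1 \<in> R" "r2 \<in> R" "con B a r1" "con B b r2"
        using IH(3) ab(1,2) by blast
      have r': "con B r1 a" "con B r2 b" using r con_sym by auto
      have "r1 \<noteq> r2" using r r' False con_trans by blast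
      \<comment> \<open>The new edge merges the components of \<open>r1\<close> and
        \<open>r2\<close>, so \<open>r1\<close> is dropped from the transversal.\<close>
      have "x = y" if "x \<in> R - {r1}" "y \<in> R - {r1}" "con (insert e B) x y" for x y
      proof -
        have na: "\<not> con B x a" "\<not> con B y a"
          using that r(1) IH(4)[of x r1] IH(4)[of y r1] con_trans[OF _ r(3)] by blast+
        show ?thesis using con_insert[of a b B x y] that ab(4) na con_sym IH(4)[of x y] by blast
      qed
      moreover have "\<exists>s\<in>R - {r1}. con (insert e B) v s" if v: "v \<in> V" for v
      proof -
        obtain s where s: "s \<in> R" "con B v s" using IH(3) v by blast
        have "con (insert e B) r1 r2"
          using mono[OF r'(1)] mono[OF r(4)] con_edge[of a b "insert e B"] ab(4) con_trans by blast
        then show ?thesis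
          using s r(2) mono[OF s(2)] con_trans \<open>r1 \<noteq> r2\<close> by (cases "s = r1") blast+
      qed
      moreover have "card (R - {r1}) + 1 = card R" using r finR
        by (metis Suc_eq_plus1 card_Suc_Diff1)
      then have "card X' + card V \<ge> card (insert e B) + card (R - {r1}) + 1"
        using X'(2) IH(5) insert(1,2) by simp
      ultimately show ?thesis using X'(1) IH(2)
        by (intro exI[of _ X'] exI[of _ "R - {r1}"]) blast
    qed
  qed
qed

lemma many_faces:
  assumes "V \<noteq> {}"
  shows "\<exists>X. separated_points (pic E) X \<and> card X + card V \<ge> card E + 2"
proof -
  obtain X R where X: "separated_points (pic E) X" "R \<subseteq> V" "\<forall>v\<in>V. \<exists>r\<in>R. con E v r"
    "card X + card V \<ge> card E + card R + 1" using many_faces_aux[of E] by blast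
  have "R \<noteq> {}" "finite R" using assms X finite_V finite_subset by blast+
  then have "card R \<ge> 1" by (simp add: Suc_leI card_gt_0_iff)
  then show ?thesis using X by (intro exI[of _ X]) auto
qed

text \<open>A drawing without a core is built up by leaves, and attaching a leaf never separates the plane.\<close>

lemma forest_not_separating:
  assumes "B \<subseteq> E" "\<And>C. C \<subseteq> B \<Longrightarrow> \<not> core C"
  shows "connected (- U B)"
proof -
  have "finite B" using assms finite_E finite_subset by blast
  then show ?thesis using assms
  proof (induction B rule: finite_psubset_induct)
    case (psubset B)
    show ?case
    proof (cases "B = {}")
      case True then show ?thesis unfolding U_def by (simp add: connected_UNIV)
    next
      case False
      then obtain e a where ea: "e \<in> B" "a \<in> e" "\<And>e'. e' \<in> B \<Longrightarrow> e' \<noteq> e \<Longrightarrow> a \<notin> e'"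
        using psubset(4)[of B] unfolding core_def by blast
      define B' where "B' = B - {e}"
      have B': "B' \<subset> B" "B = insert e B'" "e \<notin> B'" using ea B'_def by auto
      have eE: "e \<in> E" "B' \<subseteq> E" using ea psubset B' by auto
      obtain b where b: "e = {a, b}" using edge[OF eE(1)] ea(2) by auto
      have con': "connected (- U B')"
      proof (rule psubset.IH[OF B'(1)])
        show "B' \<subseteq> E" by fact
        show "\<And>C. C \<subseteq> B' \<Longrightarrow> \<not> core C" using psubset(4) B'(1) by blast
      qed
      have conP: "connected (- P e)"
        unfolding P_def using arc[OF eE(1)] by (intro connected_arc_complement) auto
      have "P e \<inter> U B' \<subseteq> {b}"
      proof
        fix x assume "x \<in> P e \<inter> U B'"
        then obtain e' where e': "e' \<in> B'" "x \<in> P e \<inter> P e'" unfolding U_def by auto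
        then have "x \<in> e \<inter> e'" using P_inter[of e e'] eE B'(3) by blast
        moreover have "a \<notin> e'" using ea(3) e' B'_def by auto
        ultimately show "x \<in> {b}" using b by auto
      qed
      then have c: "connected (P e \<inter> U B')"
        by (metis connected_empty connected_sing subset_singletonD)
      have "connected (- (P e \<union> U B'))"
        using Janiszewski_connected[OF compact_P[OF eE(1)] compact_imp_closed[OF compact_U[OF eE(2)]] c]
          con' conP by blast
      then show ?thesis using B'(2) U_insert by (simp add: Un_commute)
    qed
  qed
qed

section \<open>Faces along an edge and the upper bound for their number\<close>

definition faces_at :: "complex \<Rightarrow> complex set set" where
  "faces_at q = {f \<in> components (- pic E). q \<in> closure f}"

text \<open>Common end of the two cases in \<open>faces_at_locally_constant\<close>. The sides
  \<open>S\<close> of the arc, one for a bridge and two for an edge on a closed curve, each lie in a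
  single face within the disc and reach every point of the arc. So the faces touching the arc near
  \<open>q\<close> are exactly the faces of these sides, whichever point \<open>q'\<close> is
  taken.\<close>

lemma sides_faces:
  assumes e: "e \<in> E" and q: "q \<in> P e" "r > 0" "ball q r \<inter> pic E \<subseteq> P e"
    and S: "finite S" "card S \<le> 2" "ball q r - P e \<subseteq> \<Union>S"
    and cl: "\<And>T q'. T \<in> S \<Longrightarrow> q' \<in> P e \<Longrightarrow> q' \<in> closure T"
    and disj: "\<And>T. T \<in> S \<Longrightarrow> T \<inter> P e = {}"
    and conn: "\<And>T x y. T \<in> S \<Longrightarrow> x \<in> T \<inter> ball q r \<Longrightarrow> y \<in> T \<inter> ball q r \<Longrightarrow>
      connected_component (- pic E) x y"
  shows "\<exists>F. finite F \<and> card F \<le> 2 \<and> (\<forall>q'\<in>ball q r \<inter> P e. faces_at q' = F)"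
proof -
  have near: "\<exists>x. x \<in> T \<inter> ball q r \<inter> ball q' d" if "T \<in> S" "q' \<in> ball q r \<inter> P e" "d > 0" for T q' d
  proof -
    have "open (ball q r \<inter> ball q' d)" "q' \<in> ball q r \<inter> ball q' d" using that by auto
    moreover have "q' \<in> closure T" using cl that by auto
    ultimately have "T \<inter> (ball q r \<inter> ball q' d) \<noteq> {}"
      by (metis IntI Int_commute empty_iff open_Int_closure_eq_empty)
    then show ?thesis by auto
  qed
  have "\<exists>x. x \<in> T \<inter> ball q r" if "T \<in> S" for T
    using near[OF that, of q r] q by auto
  then obtain c where c: "\<And>T. T \<in> S \<Longrightarrow> c T \<in> T \<inter> ball q r" by metis
  define F where "F = (\<lambda>T. connected_component_set (- pic E) (c T)) ` S"
  have "finite F" "card F \<le> 2" using S card_image_le[OF S(1)] unfolding F_def by (auto intro: le_trans)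
  moreover have "faces_at q' = F" if q': "q' \<in> ball q r \<inter> P e" for q'
  proof
    show "faces_at q' \<subseteq> F"
    proof
      fix f assume "f \<in> faces_at q'"
      then have f: "f \<in> components (- pic E)" "q' \<in> closure f" unfolding faces_at_def by auto
      have "ball q r \<inter> f \<noteq> {}"
        using f(2) q' by (metis Int_iff empty_iff open_Int_closure_eq_empty open_ball)
      then obtain x where x: "x \<in> ball q r" "x \<in> f" by auto
      have fx: "f = connected_component_set (- pic E) x"
        using f(1) x(2) by (metis components_iff connected_component_eq)
      have "x \<notin> pic E" using f(1) x(2) in_components_subset by fastforce
      moreover have "P e \<subseteq> pic E" using e unfolding pic_def U_def by auto
      ultimately have "x \<in> ball q r - P e" using x by auto
      then obtain T where T: "T \<in> S" "x \<in> T" using S(3) by auto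
      have "connected_component (- pic E) x (c T)" using conn[OF T(1)] T(2) x(1) c[OF T(1)] by auto
      then have "f = connected_component_set (- pic E) (c T)"
        using fx connected_component_eq by fastforce
      then show "f \<in> F" unfolding F_def using T(1) by auto
    qed
    show "F \<subseteq> faces_at q'"
    proof
      fix f assume "f \<in> F"
      then obtain T where T: "T \<in> S" "f = connected_component_set (- pic E) (c T)"
        unfolding F_def by auto
      have "connected_component (- pic E) (c T) (c T)" using conn[OF T(1) c[OF T(1)] c[OF T(1)]] .
      then have "c T \<in> - pic E" using connected_component_in by blast
      then have "f \<in> components (- pic E)" using T(2) by (simp add: componentsI)
      moreover have "q' \<in> closure f"
        unfolding closure_approachable
      proof (intro allI impI)
        fix d :: real assume "d > 0"
        then obtain x where x: "x \<in> T \<inter> ball q r" "x \<in> ball q' d" using near[OF T(1) q'] by blast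
        then have "x \<in> f" using conn[OF T(1) c[OF T(1)]] T(2) by auto
        then show "\<exists>y\<in>f. dist y q' < d" using x(2) by (auto simp: dist_commute)
      qed
      ultimately show "f \<in> faces_at q'" unfolding faces_at_def by auto
    qed
  qed
  ultimately show ?thesis by blast
qed

text \<open>Without \<open>e\<close> the drawing falls into two disjoint compact parts,
  \<open>K1\<close> containing \<open>a\<close> and \<open>K2\<close> containing \<open>b\<close>,
  and \<open>P e\<close> meets each of them in one point. The parts are added to the arc one after
  the other; Janiszewski's theorem applies both times because the intersections \<open>{a}\<close>
  and \<open>{b}\<close> are connected.\<close>

lemma bridge_sides:
  assumes e: "e \<in> E" "e = {a, b}" "a \<noteq> b" and nc: "\<not> con (E - {e}) a b"
    and xy: "x \<notin> P e" "y \<notin> P e" "connected_component (- pic (E - {e})) x y"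
  shows "connected_component (- pic E) x y"
proof -
  define B where "B = E - {e}"
  have B: "B \<subseteq> E" "e \<notin> B" "E = insert e B" using e B_def by auto
  define B1 where "B1 = {e'\<in>B. \<exists>v\<in>e'. con B a v}"
  define K1 where "K1 = {v\<in>V. con B a v} \<union> U B1"
  define K2 where "K2 = {v\<in>V. \<not> con B a v} \<union> U (B - B1)"
  have K12: "K1 \<union> K2 = pic B" unfolding K1_def K2_def pic_def U_def B1_def by auto
  have allcon: "con B a w" if e': "e' \<in> B1" "w \<in> e'" for e' w
  proof -
    obtain v where v: "v \<in> e'" "con B a v" "e' \<in> B" using e' B1_def by auto
    obtain c d where "e' = {c, d}" using edge v(3) B(1) by blast
    then have "v = w \<or> e' = {v, w}" using v(1) e'(2) by auto
    then show ?thesis using v con_edge con_trans by blast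
  qed
  have disj: "K1 \<inter> K2 = {}"
  proof (rule ccontr)
    assume "K1 \<inter> K2 \<noteq> {}"
    then obtain z where z: "z \<in> K1" "z \<in> K2" by auto
    have Vin: "z \<in> e'" if "z \<in> V" "e' \<in> B" "z \<in> P e'" for e'
      using that arc_V[of e'] B(1) unfolding P_def by auto
    have "con B a z \<and> z \<in> V"
    proof (cases "z \<in> V \<and> con B a z")
      case False
      then obtain e' where e': "e' \<in> B1" "z \<in> P e'" using z(1) unfolding K1_def U_def by auto
      have "z \<in> e'"
      proof (cases "z \<in> V")
        case True then show ?thesis using Vin e' B1_def by auto
      next
        case False
        then obtain e'' where e'': "e'' \<in> B - B1" "z \<in> P e''" using z(2) unfolding K2_def U_def by auto
        then show ?thesis using P_inter[of e' e''] e' B(1) B1_def by auto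
      qed
      then show ?thesis using allcon[OF e'(1)] edge_sub_V[of e'] e' B1_def B(1) by auto
    qed auto
    moreover from this obtain e'' where "e'' \<in> B - B1" "z \<in> P e''"
      using z(2) unfolding K2_def U_def by auto
    ultimately show False using Vin unfolding B1_def by auto
  qed
  have aV: "a \<in> V" "b \<in> V" using e edge_sub_V by auto
  have ab: "a \<in> K1" "b \<in> K2" using aV nc con_refl unfolding K1_def K2_def B_def by auto
  have fin: "finite {v\<in>V. con B a v}" "finite {v\<in>V. \<not> con B a v}" using finite_V by auto
  have "B1 \<subseteq> E" "B - B1 \<subseteq> E" using B unfolding B1_def by auto
  then have comp: "compact K1" "compact K2"
    unfolding K1_def K2_def by (auto intro!: compact_Un compact_U finite_imp_compact[OF fin(1)] finite_imp_compact[OF fin(2)])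
  have PB: "P e \<inter> (K1 \<union> K2) = {a, b}" using P_inter_pic[OF e(1) B(1,2)] K12 e(2) by simp
  have i1: "P e \<inter> K1 = {a}" using PB ab disj by auto
  have i2: "(P e \<union> K1) \<inter> K2 = {b}" using PB ab disj by auto
  have cP: "connected (- P e)"
    unfolding P_def using arc[OF e(1)] by (intro connected_arc_complement) auto
  have "connected_component (- P e) x y" using cP xy by (auto simp: connected_component_def)
  moreover have "connected_component (- K1) x y" "connected_component (- K2) x y"
    using xy(3) connected_component_Compl_antimono K12 unfolding B_def by blast+
  ultimately have "connected_component (- (P e \<union> K1)) x y"
    using Janiszewski[of "P e" K1] compact_P[OF e(1)] comp i1 compact_imp_closed by auto
  then have "connected_component (- (P e \<union> K1 \<union> K2)) x y"
    using Janiszewski[of "P e \<union> K1" K2] compact_P[OF e(1)] comp i2 compact_imp_closed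
      \<open>connected_component (- K2) x y\<close> compact_Un by auto
  moreover have "pic E = P e \<union> K1 \<union> K2" using K12 B(3) pic_insert[of e B] by auto
  ultimately show ?thesis by simp
qed

text \<open>If the ends of the edge are connected without it, it lies on a Jordan curve and has two
  sides; otherwise it is a bridge, and the complement of its arc is a single side.\<close>

lemma faces_at_locally_constant:
  assumes e: "e \<in> E" and q: "q \<in> P e - e"
  shows "\<exists>r>0. \<exists>F. finite F \<and> card F \<le> 2 \<and> (\<forall>q'\<in>ball q r \<inter> P e. faces_at q' = F)"
proof -
  define B where "B = E - {e}"
  have B: "B \<subseteq> E" "e \<notin> B" "E = insert e B" using e B_def by auto
  have picE: "pic E = pic B \<union> P e" using B(3) pic_insert by metis
  obtain a b where ab: "a \<in> V" "b \<in> V" "a \<noteq> b" "e = {a, b}" using edge[OF e] by blast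
  obtain g where g: "arc g" "path_image g = P e" "pathstart g = a" "pathfinish g = b"
    using orient[OF e ab(4,3)] by blast
  have "q \<in> g ` {0..1}" using q g(2) unfolding path_image_def by blast
  then obtain s where s: "s \<in> {0..1}" "q = g s" by blast
  have "s \<noteq> 0" "s \<noteq> 1" using s q g(3,4) ab(4) unfolding pathstart_def pathfinish_def by auto
  then have s01: "0 < s" "s < 1" using s by auto
  have ginj: "inj_on g {0..1}" using g(1) arc_def by blast
  have gcont: "continuous_on {0..1} g" using g(1) unfolding arc_def path_def by blast
  \<comment> \<open>The two end pieces of the edge stop short of \<open>q\<close>. A small disc
    around \<open>q\<close> therefore avoids \<open>Z\<close>, while the Jordan curve
    \<open>J\<close> below still meets \<open>Z\<close> in a connected set.\<close>
  define Q1 where "Q1 = g ` {0..s/2}"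
  define Q2 where "Q2 = g ` {(1+s)/2..1}"
  have sub01: "{0..s/2} \<subseteq> {0..1}" "{(1+s)/2..1} \<subseteq> {0..1}" using s01 by auto
  have Q: "compact Q1" "compact Q2" "connected Q1" "connected Q2"
    unfolding Q1_def Q2_def
    using sub01 gcont continuous_on_subset compact_continuous_image connected_continuous_image
    by (metis compact_Icc connected_Icc)+
  have aQ: "a \<in> Q1" "b \<in> Q2"
    using g(3,4) s01 unfolding Q1_def Q2_def pathstart_def pathfinish_def by (auto intro!: imageI)
  have QP: "Q1 \<subseteq> P e" "Q2 \<subseteq> P e"
    using sub01 g(2) unfolding Q1_def Q2_def path_image_def by auto
  have qQ: "q \<notin> Q1" "q \<notin> Q2"
  proof -
    have "g s \<noteq> g t" if "t \<in> {0..1}" "t \<noteq> s" for t using ginj s(1) that by (auto dest: inj_onD)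
    moreover have "t \<in> {0..1} \<and> t \<noteq> s" if "t \<in> {0..s/2} \<or> t \<in> {(1+s)/2..1}" for t
      using that s01 by auto
    ultimately show "q \<notin> Q1" "q \<notin> Q2" unfolding Q1_def Q2_def s(2) by blast+
  qed
  define Z where "Z = pic B \<union> Q1 \<union> Q2"
  have "compact Z" unfolding Z_def using Q compact_pic[OF B(1)] by (intro compact_Un)
  moreover have "q \<notin> Z" using qQ q P_inter_pic[OF e B(1,2)] unfolding Z_def by auto
  ultimately obtain r where r: "r > 0" "ball q r \<subseteq> - Z"
    by (metis Compl_iff compact_imp_closed open_Compl open_contains_ball)
  have qP: "q \<in> P e" using q by auto
  have ballK: "ball q r \<inter> pic E \<subseteq> P e" using r(2) picE unfolding Z_def by auto
  show ?thesis
  proof (cases "con B a b")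
    case False
    have "\<exists>F. finite F \<and> card F \<le> 2 \<and> (\<forall>q'\<in>ball q r \<inter> P e. faces_at q' = F)"
    proof (rule sides_faces[OF e qP r(1) ballK, of "{- P e}"])
      show "q' \<in> closure T" if "T \<in> {- P e}" for T q'
        using that interior_P[OF e] by (simp add: closure_complement)
      fix T x y assume T: "T \<in> {- P e}" and x: "x \<in> T \<inter> ball q r" and y: "y \<in> T \<inter> ball q r"
      have "ball q r \<subseteq> - pic B" using r(2) Z_def by auto
      then have "connected_component (- pic B) x y"
        using connected_component_ball[of x q r y] x y by auto
      then show "connected_component (- pic E) x y"
        using bridge_sides[OF e ab(4,3), of x y] False x y T unfolding B_def by auto
    qed auto
    then show ?thesis using r(1) by blast
  next
    case True
    obtain A where A: "A \<subseteq> U B" "connected A" "compact A" "a \<in> A" "b \<in> A"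
      "connected (inside (A \<union> P e))" "connected (outside (A \<union> P e))"
      "frontier (inside (A \<union> P e)) = A \<union> P e" "frontier (outside (A \<union> P e)) = A \<union> P e"
      using closing_curve[OF e B(1,2) ab(4,3) True] by metis
    define J where "J = A \<union> P e"
    have cJ: "compact J" unfolding J_def using A(3) compact_P[OF e] by (rule compact_Un)
    have JZ: "J \<inter> Z = A \<union> Q1 \<union> Q2"
      using A(1,4,5) QP P_inter_pic[OF e B(1,2)] ab(4) aQ unfolding J_def Z_def pic_def by auto
    have "connected (A \<union> Q1)" using A(2,4) aQ(1) Q(3) by (intro connected_Un) auto
    then have conJZ: "connected (J \<inter> Z)"
      unfolding JZ using connected_Un[of "A \<union> Q1" Q2] A(5) aQ(2) Q(4) by blast
    have "\<exists>F. finite F \<and> card F \<le> 2 \<and> (\<forall>q'\<in>ball q r \<inter> P e. faces_at q' = F)"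
    proof (rule sides_faces[OF e qP r(1) ballK, of "{inside J, outside J}"])
      show "card {inside J, outside J} \<le> 2" by (simp add: card_insert_if)
      have "ball q r \<inter> J \<subseteq> P e" using A(1) r(2) unfolding J_def Z_def pic_def by auto
      moreover have "inside J \<union> outside J = - J" using inside_Un_outside by blast
      ultimately show "ball q r - P e \<subseteq> \<Union>{inside J, outside J}" by auto
      show "q' \<in> closure T" if "T \<in> {inside J, outside J}" "q' \<in> P e" for T q'
        using that A(8,9) unfolding J_def frontier_def by auto
      show "T \<inter> P e = {}" if "T \<in> {inside J, outside J}" for T
        using that inside_no_overlap[of J] outside_no_overlap[of J] unfolding J_def by blast
      fix T x y assume T: "T \<in> {inside J, outside J}"
        and x: "x \<in> T \<inter> ball q r" and y: "y \<in> T \<inter> ball q r"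
      have "connected T" "T \<subseteq> - J"
        using T A(6,7) inside_no_overlap[of J] outside_no_overlap[of J] unfolding J_def by blast+
      then have cJxy: "connected_component (- J) x y"
        using x y unfolding connected_component_def by auto
      have cZxy: "connected_component (- Z) x y"
        using connected_component_ball[of x q r y] x y r(2) by auto
      \<comment> \<open>Neither \<open>J\<close> nor \<open>Z\<close> separates \<open>x\<close>
        from \<open>y\<close>, and together they cover the drawing.\<close>
      have "connected_component (- (J \<union> Z)) x y"
        using Janiszewski[OF cJ compact_imp_closed[OF \<open>compact Z\<close>] conJZ cJxy cZxy] .
      moreover have "pic E \<subseteq> J \<union> Z" unfolding picE J_def Z_def by auto
      ultimately show "connected_component (- pic E) x y"
        using connected_component_Compl_antimono by blast
    qed auto
    then show ?thesis using r(1) by blast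
  qed
qed

text \<open>The open edge is connected and \<open>faces_at\<close> is locally constant on it, hence
  constant.\<close>

lemma edge_two_faces:
  assumes e: "e \<in> E"
  shows "\<exists>F. finite F \<and> card F \<le> 2 \<and> {f \<in> components (- pic E). closure f \<inter> (P e - e) \<noteq> {}} \<subseteq> F"
proof -
  obtain a b where ab: "a \<in> V" "b \<in> V" "a \<noteq> b" "e = {a, b}" using edge[OF e] by blast
  obtain g where g: "arc g" "path_image g = P e" "pathstart g = a" "pathfinish g = b"
    using orient[OF e ab(4,3)] by blast
  have ginj: "inj_on g {0..1}" using g(1) arc_def by blast
  have gcont: "continuous_on {0..1} g" using g(1) unfolding arc_def path_def by blast
  have "{0<..<1} = {0..1} - {0, 1::real}" by auto
  then have "g ` {0<..<1} = g ` {0..1} - g ` {0, 1}"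
    using inj_on_image_set_diff[OF ginj, of "{0..1}" "{0,1}"] by auto
  also have "\<dots> = P e - e" using g ab(4) unfolding path_image_def pathstart_def pathfinish_def by auto
  finally have im: "P e - e = g ` {0<..<1}" by simp
  have con: "connected (P e - e)"
    unfolding im by (rule connected_continuous_image)
      (auto intro: continuous_on_subset[OF gcont])
  obtain q0 where q0: "q0 \<in> P e - e" using open_edge_point[OF e] by blast
  obtain r F where F: "r > 0" "finite F" "card F \<le> 2" "\<forall>q'\<in>ball q0 r \<inter> P e. faces_at q' = F"
    using faces_at_locally_constant[OF e q0] by blast
  have eq: "faces_at q0 = faces_at q" if q: "q \<in> P e - e" for q
  proof (rule connected_local_const[OF con q0 q], intro ballI)
    fix p assume p: "p \<in> P e - e"
    obtain r F where F: "r > 0" "\<forall>q'\<in>ball p r \<inter> P e. faces_at q' = F"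
      using faces_at_locally_constant[OF e p] by blast
    have "faces_at p = faces_at z" if "z \<in> P e - e" "dist z p < r" for z
      using F p that by (auto simp: dist_commute)
    then show "\<forall>\<^sub>F z in at p within P e - e. faces_at p = faces_at z"
      unfolding eventually_at using F(1) by blast
  qed
  have "faces_at q0 = F" using F q0 by auto
  then have "{f \<in> components (- pic E). closure f \<inter> (P e - e) \<noteq> {}} \<subseteq> F"
    using eq unfolding faces_at_def by blast
  then show ?thesis using F by blast
qed

text \<open>If the edges bordering \<open>f\<close> contained no core, neither their union nor the
  finitely many vertices would separate the plane. But \<open>f\<close> is open and closed in that
  connected complement, so it would be all of it, and there would be no second face.\<close>

lemma face_has_core:
  assumes f: "f \<in> components (- pic E)" and other: "f \<noteq> - pic E"
  shows "\<exists>C \<subseteq> {e \<in> E. closure f \<inter> (P e - e) \<noteq> {}}. core C"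
proof (rule ccontr)
  define B where "B = {e \<in> E. closure f \<inter> (P e - e) \<noteq> {}}"
  assume "\<not> ?thesis"
  then have nc: "\<And>C. C \<subseteq> B \<Longrightarrow> \<not> core C" unfolding B_def by blast
  have BE: "B \<subseteq> E" unfolding B_def by auto
  have "connected (- U B)" using forest_not_separating[OF BE nc] by blast
  moreover have "open (- U B)" using compact_U[OF BE] compact_imp_closed by blast
  ultimately have con: "connected (- U B - V)" using connected_open_delete_finite[of "- U B" V] finite_V by simp
  have eq: "- U B - V = - pic B" unfolding pic_def by auto
  have openE: "open (- pic E)" using compact_pic[of E] compact_imp_closed by blast
  have opf: "open f" using open_components[OF openE f] .
  have fsub: "f \<subseteq> - pic E" using f in_components_subset by blast
  have fne: "f \<noteq> {}" using f in_components_nonempty by blast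
  have picsub: "- pic E \<subseteq> - pic B" using BE unfolding pic_def U_def by auto
  have cl: "closure f \<inter> - pic B \<subseteq> f"
  proof
    fix x assume x: "x \<in> closure f \<inter> - pic B"
    have "x \<in> - pic E"
    proof (rule ccontr)
      assume "x \<notin> - pic E"
      then have "x \<in> V \<or> (\<exists>e\<in>E. x \<in> P e - e)"
        using edge_sub_V unfolding pic_def U_def by blast
      moreover have "x \<notin> V" using x unfolding pic_def by auto
      ultimately obtain e where "e \<in> E" "x \<in> P e - e" by blast
      then have "e \<in> B" using x unfolding B_def by auto
      then show False using x \<open>x \<in> P e - e\<close> unfolding pic_def U_def by auto
    qed
    moreover obtain C where "closed C" "f = - pic E \<inter> C"
      using closedin_component[OF f] closedin_closed by blast
    moreover from this have "closure f \<subseteq> C" by (simp add: closure_minimal)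
    ultimately show "x \<in> f" using x by auto
  qed
  have "f = - pic B"
  proof -
    have "openin (top_of_set (- pic B)) f"
      unfolding openin_open using opf fsub picsub by blast
    moreover have "closedin (top_of_set (- pic B)) f"
      unfolding closedin_closed
      using cl fsub picsub closure_subset[of f] by (intro exI[of _ "closure f"]) auto
    ultimately show ?thesis using con[unfolded eq] fne unfolding connected_clopen by blast
  qed
  then show False using other fsub picsub by blast
qed

text \<open>Each face collects weight at least 1 from a core on its boundary, and each edge pays for
  at most two faces; so there are at most \<open>2 * sum w E\<close> faces. The maximum with 1
  covers a drawing with a single face, which need not border a core.\<close>

theorem weighted_euler:
  fixes w :: "complex set \<Rightarrow> real"
  assumes w0: "\<And>e. e \<in> E \<Longrightarrow> w e \<ge> 0" and wc: "\<And>C. C \<subseteq> E \<Longrightarrow> core C \<Longrightarrow> sum w C \<ge> 1"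
    and "V \<noteq> {}"
  shows "real (card E) + 2 \<le> real (card V) + max 1 (2 * sum w E)"
proof -
  obtain X where X: "separated_points (pic E) X" "card X + card V \<ge> card E + 2"
    using many_faces[OF assms(3)] by blast
  have finX: "finite X" using X separated_points_def by auto
  show ?thesis
  proof (cases "card X \<le> 1")
    case True then show ?thesis using X(2) by simp
  next
    case False
    define f where "f x = connected_component_set (- pic E) x" for x
    define Bd where "Bd x = {e \<in> E. closure (f x) \<inter> (P e - e) \<noteq> {}}" for x
    have fc: "f x \<in> components (- pic E)" if "x \<in> X" for x
      unfolding f_def using X(1) that unfolding separated_points_def by (auto intro: componentsI)
    have finj: "inj_on f X"
    proof (rule inj_onI)
      fix x y assume xy: "x \<in> X" "y \<in> X" "f x = f y"
      have "y \<in> f y" unfolding f_def using X(1) xy(2) unfolding separated_points_def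
        by (auto simp: connected_component_refl)
      then have "y \<in> f x" using xy(3) by simp
      then have "connected_component (- pic E) x y" unfolding f_def by simp
      then show "x = y" using X(1) xy(1,2) unfolding separated_points_def by blast
    qed
    have one: "1 \<le> sum w (Bd x)" if x: "x \<in> X" for x
    proof -
      obtain y where y: "y \<in> X" "y \<noteq> x"
        using False finX x card_le_Suc0_iff_eq[of X] by auto
      then have "y \<notin> f x" "y \<in> - pic E"
        using X(1) x unfolding f_def separated_points_def by auto
      then have "f x \<noteq> - pic E" by auto
      then obtain C where C: "C \<subseteq> Bd x" "core C"
        using face_has_core[OF fc[OF x]] unfolding Bd_def by blast
      have "Bd x \<subseteq> E" "finite (Bd x)" unfolding Bd_def using finite_E by auto
      then have "sum w C \<le> sum w (Bd x)"
        using C(1) w0 by (intro sum_mono2) auto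
      then show ?thesis using wc[of C] C \<open>Bd x \<subseteq> E\<close> by force
    qed
    have two: "card {x\<in>X. e \<in> Bd x} \<le> 2" if e: "e \<in> E" for e
    proof -
      obtain F where F: "finite F" "card F \<le> 2"
        "{f \<in> components (- pic E). closure f \<inter> (P e - e) \<noteq> {}} \<subseteq> F"
        using edge_two_faces[OF e] by blast
      have "f ` {x\<in>X. e \<in> Bd x} \<subseteq> F" using F(3) fc unfolding Bd_def by auto
      moreover have "inj_on f {x\<in>X. e \<in> Bd x}" using finj by (rule inj_on_subset) auto
      ultimately show ?thesis using F(1,2) by (metis card_inj_on_le le_trans)
    qed
    have "real (card X) \<le> (\<Sum>x\<in>X. sum w (Bd x))"
      using sum_mono[of X "\<lambda>_. 1::real"] one by simp
    also have "\<dots> = (\<Sum>x\<in>X. \<Sum>e\<in>E. if e \<in> Bd x then w e else 0)"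
    proof (rule sum.cong[OF refl])
      fix x
      have "sum w (Bd x) = sum w {e \<in> E. e \<in> Bd x}" by (rule sum.cong) (auto simp: Bd_def)
      also have "\<dots> = (\<Sum>e\<in>E. if e \<in> Bd x then w e else 0)" by (rule sum.inter_filter[OF finite_E])
      finally show "sum w (Bd x) = (\<Sum>e\<in>E. if e \<in> Bd x then w e else 0)" .
    qed
    also have "\<dots> = (\<Sum>e\<in>E. \<Sum>x\<in>X. if e \<in> Bd x then w e else 0)" by (rule sum.swap)
    also have "\<dots> = (\<Sum>e\<in>E. real (card {x\<in>X. e \<in> Bd x}) * w e)"
      using finX by (intro sum.cong refl) (simp add: sum.inter_filter[symmetric])
    also have "\<dots> \<le> (\<Sum>e\<in>E. 2 * w e)"
      using two w0 by (intro sum_mono mult_right_mono) (simp_all add: numeral_le_real_of_nat_iff)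
    finally have "real (card X) \<le> 2 * sum w E" by (simp add: sum_distrib_left)
    then show ?thesis using X(2) by linarith
  qed
qed

end

section \<open>Edge bounds for planar graphs\<close>

definition edges_of :: "'a pair_pre_digraph \<Rightarrow> 'a set set" where
  "edges_of G = {{a, b} | a b. (a, b) \<in> parcs G}"

text \<open>A drawing of \<open>G\<close> restricts to any vertices \<open>V'\<close> and edges
  \<open>E'\<close>, so the edges can be selected to suit the counting, for instance those between
  two disjoint sets. The points \<open>p a\<close> replace the vertices, and \<open>q\<close> leads
  back to the edge under which \<open>\<gamma>\<close> stores its arc.\<close>

lemma planar_weighted_euler:
  fixes w :: "'a set \<Rightarrow> real"
  assumes G: "planar_graph G" and V': "V' \<subseteq> pverts G" "V' \<noteq> {}"
    and E': "E' \<subseteq> edges_of G" "\<Union>E' \<subseteq> V'"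
    and w0: "\<And>e. e \<in> E' \<Longrightarrow> w e \<ge> 0" and wc: "\<And>C. C \<subseteq> E' \<Longrightarrow> core C \<Longrightarrow> sum w C \<ge> 1"
  shows "real (card E') + 2 \<le> real (card V') + max 1 (2 * sum w E')"
proof -
  obtain p \<gamma> where pg: "plane_drawing G p \<gamma>" "pair_graph G"
    using G unfolding planar_graph_def by blast
  interpret pair_graph G by fact
  have inj: "inj_on p (pverts G)" using pg(1) unfolding plane_drawing_def by blast
  define q where "q = inv_into (pverts G) p"
  have qp: "q (p x) = x" if "x \<in> pverts G" for x using inj that unfolding q_def by simp
  have qpS: "q ` (p ` S) = S" if "S \<subseteq> pverts G" for S
    unfolding q_def using inv_into_image_cancel[OF inj that] .
  define EE where "EE = (`) p ` E'"
  have E'sub: "e \<subseteq> pverts G" if "e \<in> E'" for e using E' V' that by blast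
  have E'D: "\<exists>a b. e = {a, b} \<and> (a, b) \<in> parcs G \<and> a \<noteq> b \<and> a \<in> V' \<and> b \<in> V'" if e: "e \<in> E'" for e
  proof -
    obtain a b where "e = {a, b}" "(a, b) \<in> parcs G"
      using E' e unfolding edges_of_def by blast
    moreover from this have "a \<noteq> b" using pair_no_loops[of "(a, b)"] by simp
    moreover have "a \<in> V'" "b \<in> V'" using E' e calculation by auto
    ultimately show ?thesis by blast
  qed
  have drawE: "Path_Connected.arc (\<gamma> {u, v})" "{pathstart (\<gamma> {u, v}), pathfinish (\<gamma> {u, v})} = {p u, p v}"
      "path_image (\<gamma> {u, v}) \<inter> p ` pverts G = {p u, p v}"
    if "(u, v) \<in> parcs G" for u v using pg(1) that unfolding plane_drawing_def by blast+
  have drawX: "path_image (\<gamma> {u, v}) \<inter> path_image (\<gamma> {x, y}) \<subseteq> p ` ({u, v} \<inter> {x, y})"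
    if "(u, v) \<in> parcs G" "(x, y) \<in> parcs G" "{u, v} \<noteq> {x, y}" for u v x y
    using pg(1) that unfolding plane_drawing_def by blast
  have EED: "\<exists>a b. e = {p a, p b} \<and> q ` e = {a, b} \<and> (a, b) \<in> parcs G \<and> a \<noteq> b \<and> a \<in> V' \<and> b \<in> V'"
    if e: "e \<in> EE" for e
  proof -
    obtain e' where e': "e' \<in> E'" "e = p ` e'" using e EE_def by auto
    obtain a b where ab: "e' = {a, b}" "(a, b) \<in> parcs G" "a \<noteq> b" "a \<in> V'" "b \<in> V'"
      using E'D[OF e'(1)] by blast
    have "q ` e = {a, b}" using e'(2) qpS[OF E'sub[OF e'(1)]] ab(1) by simp
    moreover have "e = {p a, p b}" using e'(2) ab(1) by simp
    ultimately show ?thesis using ab by blast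
  qed
  interpret plane_graph "p ` V'" EE "\<lambda>e. \<gamma> (q ` e)"
  proof
    show "finite (p ` V')" using V' pair_finite_verts finite_subset by blast
    fix e assume e: "e \<in> EE"
    obtain a b where ab: "e = {p a, p b}" "q ` e = {a, b}" "(a, b) \<in> parcs G" "a \<noteq> b" "a \<in> V'" "b \<in> V'"
      using EED[OF e] by blast
    have "p a \<noteq> p b" using ab inj V' by (meson inj_onD subsetD)
    then show "\<exists>a\<in>p ` V'. \<exists>b\<in>p ` V'. a \<noteq> b \<and> e = {a, b}" using ab by blast
    show "Path_Connected.arc (\<gamma> (q ` e))" "{pathstart (\<gamma> (q ` e)), pathfinish (\<gamma> (q ` e))} = e"
      using drawE[OF ab(3)] ab(1,2) by auto
    have "path_image (\<gamma> (q ` e)) \<inter> p ` pverts G = e" using drawE(3)[OF ab(3)] ab(1,2) by simp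
    moreover have "e \<subseteq> p ` V'" "p ` V' \<subseteq> p ` pverts G" using ab(1,5,6) V'(1) by auto
    ultimately show "path_image (\<gamma> (q ` e)) \<inter> p ` V' = e" by blast
    fix e' assume e': "e' \<in> EE" "e \<noteq> e'"
    obtain c d where cd: "e' = {p c, p d}" "q ` e' = {c, d}" "(c, d) \<in> parcs G"
      using EED[OF e'(1)] by blast
    have "{a, b} \<noteq> {c, d}"
    proof
      assume "{a, b} = {c, d}"
      then have "p ` {a, b} = p ` {c, d}" by simp
      then show False using e'(2) ab(1) cd(1) by simp
    qed
    then have "path_image (\<gamma> (q ` e)) \<inter> path_image (\<gamma> (q ` e')) \<subseteq> p ` ({a, b} \<inter> {c, d})"
      using drawX[OF ab(3) cd(3)] ab(2) cd(2) by simp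
    also have "\<dots> \<subseteq> e \<inter> e'" using ab(1) cd(1) by auto
    finally show "path_image (\<gamma> (q ` e)) \<inter> path_image (\<gamma> (q ` e')) \<subseteq> e \<inter> e'" .
  qed
  have injE: "inj_on ((`) p) E'" using qpS E'sub by (intro inj_onI) metis
  have injq: "inj_on ((`) q) EE"
  proof (rule inj_onI)
    fix e f assume "e \<in> EE" "f \<in> EE" "q ` e = q ` f"
    then show "e = f" using EE_def qpS E'sub by auto
  qed
  have qE: "q ` e \<in> E'" if "e \<in> EE" for e using that qpS E'sub unfolding EE_def by auto
  have "real (card EE) + 2 \<le> real (card (p ` V')) + max 1 (2 * sum (\<lambda>e. w (q ` e)) EE)"
  proof (rule weighted_euler)
    show "w (q ` e) \<ge> 0" if "e \<in> EE" for e using w0 qE that by blast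
    show "p ` V' \<noteq> {}" using V' by auto
    fix C assume C: "C \<subseteq> EE" "core C"
    define C' where "C' = (`) q ` C"
    have C'E: "C' \<subseteq> E'" unfolding C'_def using qE C by auto
    have injC: "inj_on ((`) q) C" using injq C(1) inj_on_subset by blast
    have "core C'"
      unfolding core_def
    proof (intro conjI ballI)
      show "C' \<noteq> {}" using C(2) unfolding core_def C'_def by auto
      fix e a assume ea: "e \<in> C'" "a \<in> e"
      then obtain f b where fb: "f \<in> C" "e = q ` f" "b \<in> f" "a = q b" unfolding C'_def by auto
      obtain f' where f': "f' \<in> C" "f' \<noteq> f" "b \<in> f'" using C(2) fb unfolding core_def by blast
      have "q ` f' \<noteq> q ` f" using injC f' fb by (meson inj_onD)
      then show "\<exists>e'\<in>C'. e' \<noteq> e \<and> a \<in> e'" using f' fb unfolding C'_def by blast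
    qed
    then have "1 \<le> sum w C'" using wc C'E by blast
    also have "\<dots> = sum (\<lambda>e. w (q ` e)) C" unfolding C'_def using injC by (simp add: sum.reindex)
    finally show "1 \<le> (\<Sum>e\<in>C. w (q ` e))" .
  qed
  moreover have "card EE = card E'" unfolding EE_def using injE card_image by blast
  moreover have "card (p ` V') = card V'" using inj V' inj_on_subset card_image by blast
  moreover have "sum (\<lambda>e. w (q ` e)) EE = sum w E'"
    unfolding EE_def using injE qpS E'sub by (simp add: sum.reindex)
  ultimately show ?thesis by simp
qed

lemma core_card_ge_3:
  assumes C: "core C" "finite C" and two: "\<And>e. e \<in> C \<Longrightarrow> \<exists>a b. a \<noteq> b \<and> e = {a, b}"
  shows "card C \<ge> 3"
proof -
  obtain e where e: "e \<in> C" using C unfolding core_def by auto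
  obtain a b where ab: "a \<noteq> b" "e = {a, b}" using two[OF e] by blast
  obtain f where f: "f \<in> C" "f \<noteq> e" "a \<in> f" using C e ab unfolding core_def by blast
  obtain g where g: "g \<in> C" "g \<noteq> e" "b \<in> g" using C e ab unfolding core_def by blast
  have "f \<noteq> g"
  proof
    assume "f = g"
    then have "{a, b} \<subseteq> f" using f g by auto
    moreover obtain c d where "f = {c, d}" using two[OF f(1)] by blast
    ultimately have "f = {a, b}" using ab(1) by auto
    then show False using f ab by auto
  qed
  then have "card {e, f, g} = 3" using f g by auto
  moreover have "{e, f, g} \<subseteq> C" using e f g by auto
  ultimately show ?thesis using C(2) by (metis card_mono)
qed

text \<open>The edges \<open>f\<close> and \<open>g\<close> that continue \<open>e\<close> at its
  two ends lead to \<open>b'\<close> and \<open>a'\<close> on opposite sides of the bipartition. The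
  further edge at \<open>b'\<close> can be neither \<open>e\<close> nor \<open>g\<close>, since
  these do not contain \<open>b'\<close>.\<close>

lemma core_card_ge_4:
  assumes C: "core C" "finite C" and dis: "A \<inter> B = {}"
    and two: "\<And>e. e \<in> C \<Longrightarrow> \<exists>a\<in>A. \<exists>b\<in>B. e = {a, b}"
  shows "card C \<ge> 4"
proof -
  obtain e where e: "e \<in> C" using C unfolding core_def by auto
  obtain a b where ab: "a \<in> A" "b \<in> B" "e = {a, b}" using two[OF e] by blast
  obtain f where f: "f \<in> C" "f \<noteq> e" "a \<in> f" using C e ab unfolding core_def by blast
  obtain g where g: "g \<in> C" "g \<noteq> e" "b \<in> g" using C e ab unfolding core_def by blast
  obtain b' where b': "b' \<in> B" "f = {a, b'}" using two[OF f(1)] f(3) ab dis by blast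
  obtain a' where a': "a' \<in> A" "g = {a', b}" using two[OF g(1)] g(3) ab dis by blast
  have ne: "b' \<noteq> b" "a' \<noteq> a" using f g ab b' a' by auto
  obtain h where h: "h \<in> C" "h \<noteq> f" "b' \<in> h" using C f b' unfolding core_def by blast
  have "e \<noteq> f" "e \<noteq> g" "f \<noteq> g" "h \<noteq> e" "h \<noteq> g" "h \<noteq> f"
    using f g h ne ab a' b' dis by (auto simp: doubleton_eq_iff)
  then have "card {e, f, g, h} = 4" by auto
  moreover have "{e, f, g, h} \<subseteq> C" using e f g h by auto
  ultimately show ?thesis using C(2) by (metis card_mono)
qed

definition arcs_in :: "'a pair_pre_digraph \<Rightarrow> 'a set \<Rightarrow> 'a set \<Rightarrow> ('a \<times> 'a) set" where
  "arcs_in G A B = {(a, b) \<in> parcs G. a \<in> A \<and> b \<in> B}"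

lemma edges_of_finite: "pair_graph G \<Longrightarrow> finite (edges_of G)"
proof -
  assume "pair_graph G"
  then interpret pair_graph G .
  have "edges_of G = (\<lambda>(a, b). {a, b}) ` parcs G" unfolding edges_of_def by auto
  then show ?thesis using pair_finite_arcs by simp
qed

lemma card_arcs_in:
  assumes "finite A" "finite B"
  shows "card (arcs_in G A B) = (\<Sum>a\<in>A. card {b\<in>B. (a, b) \<in> parcs G})"
proof -
  have "arcs_in G A B = Sigma A (\<lambda>a. {b\<in>B. (a, b) \<in> parcs G})" unfolding arcs_in_def by auto
  then show ?thesis using assms by simp
qed

lemma card_arcs_le_edges:
  assumes "finite {{a, b} | a b. (a, b) \<in> arcs_in G S S}"
  shows "card (arcs_in G S S) \<le> 2 * card {{a, b} | a b. (a, b) \<in> arcs_in G S S}"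
proof -
  define E' where "E' = {{a, b} | a b. (a, b) \<in> arcs_in G S S}"
  have fin: "finite E'" using assms E'_def by simp
  have sub: "arcs_in G S S \<subseteq> (\<Union>e\<in>E'. {x. {fst x, snd x} = e})"
    unfolding E'_def by clarsimp blast
  have two: "card {x. {fst x, snd x} = e} \<le> 2 \<and> finite {x. {fst x, snd x} = e}" if e: "e \<in> E'" for e
  proof -
    obtain a b where "e = {a, b}" using e unfolding E'_def by blast
    then have "{x. {fst x, snd x} = e} \<subseteq> {(a, b), (b, a)}" by (auto simp: doubleton_eq_iff)
    moreover have "card {x, y} \<le> 2" for x y :: "'a \<times> 'a" by (cases "x = y") auto
    ultimately show ?thesis by (meson card_mono finite.emptyI finite.insertI finite_subset le_trans)
  qed
  have "card (arcs_in G S S) \<le> card (\<Union>e\<in>E'. {x. {fst x, snd x} = e})"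
    using fin sub two by (intro card_mono) auto
  also have "\<dots> \<le> (\<Sum>e\<in>E'. card {x. {fst x, snd x} = e})" using card_UN_le[OF fin] .
  also have "\<dots> \<le> (\<Sum>e\<in>E'. 2)" using two by (intro sum_mono) auto
  finally show ?thesis unfolding E'_def by simp
qed

text \<open>Weight 1/3 is admissible because a core has at least three edges. An edge is two arcs,
  hence the factor 6; the additive constant of Euler's bound is dropped, as only the order of
  magnitude is used.\<close>

lemma planar_arcs_le:
  assumes G: "planar_graph G" and S: "S \<subseteq> pverts G"
  shows "card (arcs_in G S S) \<le> 6 * card S"
proof (cases "S = {}")
  case True then show ?thesis unfolding arcs_in_def by simp
next
  case False
  interpret pair_graph G using G unfolding planar_graph_def by blast
  define E' where "E' = {{a, b} | a b. (a, b) \<in> arcs_in G S S}"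
  have fin: "finite E'" using edges_of_finite[OF pair_graph_axioms]
    by (rule finite_subset[rotated]) (auto simp: E'_def edges_of_def arcs_in_def)
  have "real (card E') + 2 \<le> real (card S) + max 1 (2 * sum (\<lambda>_. 1/3) E')"
  proof (rule planar_weighted_euler[OF G S False])
    show "E' \<subseteq> edges_of G" "\<Union>E' \<subseteq> S" unfolding E'_def edges_of_def arcs_in_def by auto
    fix C assume C: "C \<subseteq> E'" "core C"
    have "card C \<ge> 3"
    proof (rule core_card_ge_3[OF C(2)])
      show "finite C" using C fin finite_subset by blast
      fix e assume "e \<in> C"
      then obtain a b where "e = {a, b}" "(a, b) \<in> parcs G" using C unfolding E'_def arcs_in_def by auto
      moreover from this have "a \<noteq> b" using pair_no_loops[of "(a, b)"] by simp
      ultimately show "\<exists>a b. a \<noteq> b \<and> e = {a, b}" by blast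
    qed
    then show "1 \<le> (\<Sum>e\<in>C. 1/3::real)" by simp
  qed simp
  then have "real (card E') \<le> 3 * real (card S)" by (simp add: max_def split: if_splits)
  moreover have "card (arcs_in G S S) \<le> 2 * card E'"
    unfolding E'_def by (rule card_arcs_le_edges) (use fin E'_def in simp)
  ultimately show ?thesis by linarith
qed

text \<open>Weight 1/4, because a bipartite core has at least four edges. The 4 on the left is what
  excludes K_{3,3}: 9 is at most 12, but 9 + 4 is not. The second alternative comes from the maximum
  with 1.\<close>

lemma planar_bipartite_arcs_le:
  assumes G: "planar_graph G" and AB: "A \<subseteq> pverts G" "B \<subseteq> pverts G" "A \<inter> B = {}"
  shows "card (arcs_in G A B) + 4 \<le> 2 * (card A + card B) \<or> card (arcs_in G A B) \<le> card A + card B - 1"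
proof (cases "A \<union> B = {}")
  case True then show ?thesis unfolding arcs_in_def by auto
next
  case False
  interpret pair_graph G using G unfolding planar_graph_def by blast
  have finAB: "finite A" "finite B" using AB pair_finite_verts finite_subset by blast+
  define E' where "E' = (\<lambda>(a, b). {a, b}) ` arcs_in G A B"
  have fin: "finite E'" using edges_of_finite[OF pair_graph_axioms]
    by (rule finite_subset[rotated]) (auto simp: E'_def edges_of_def arcs_in_def)
  have inj: "inj_on (\<lambda>(a, b). {a, b}) (arcs_in G A B)"
    using AB(3) unfolding arcs_in_def by (intro inj_onI) (auto simp: doubleton_eq_iff)
  have "real (card E') + 2 \<le> real (card (A \<union> B)) + max 1 (2 * sum (\<lambda>_. 1/4) E')"
  proof (rule planar_weighted_euler[OF G _ False])
    show "A \<union> B \<subseteq> pverts G" using AB by auto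
    show "E' \<subseteq> edges_of G" "\<Union>E' \<subseteq> A \<union> B" unfolding E'_def edges_of_def arcs_in_def by auto
    fix C assume C: "C \<subseteq> E'" "core C"
    have "card C \<ge> 4"
    proof (rule core_card_ge_4[OF C(2) _ AB(3)])
      show "finite C" using C fin finite_subset by blast
      show "\<exists>a\<in>A. \<exists>b\<in>B. e = {a, b}" if e: "e \<in> C" for e
      proof -
        obtain x where "x \<in> arcs_in G A B" "e = (case x of (a, b) \<Rightarrow> {a, b})"
          using e C(1) unfolding E'_def by blast
        then show ?thesis unfolding arcs_in_def by auto
      qed
    qed
    then show "1 \<le> (\<Sum>e\<in>C. 1/4::real)" by simp
  qed simp
  moreover have "card E' = card (arcs_in G A B)" unfolding E'_def using inj card_image by blast
  moreover have "card (A \<union> B) = card A + card B" using AB(3) finAB card_Un_disjoint by blast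
  ultimately have "real (card (arcs_in G A B)) + 2 \<le>
      real (card A) + real (card B) + max 1 (real (card (arcs_in G A B)) / 2)" by simp
  then show ?thesis by (auto simp: max_def split: if_splits)
qed

lemma planar_no_K33:
  assumes G: "planar_graph G" and AB: "A \<subseteq> pverts G" "B \<subseteq> pverts G" "A \<inter> B = {}"
    and card: "card A = 3" "card B = 3"
    and all: "\<And>a b. a \<in> A \<Longrightarrow> b \<in> B \<Longrightarrow> (a, b) \<in> parcs G"
  shows False
proof -
  have "arcs_in G A B = A \<times> B" using all unfolding arcs_in_def by auto
  then have "card (arcs_in G A B) = 9" using card by (simp add: card_cartesian_product)
  then show False using planar_bipartite_arcs_le[OF G AB] card by simp
qed

text \<open>
  A double wheel whose two hubs are joined by a path of length two through a further vertex
  is a subdivision of a triangulation plus an edge; giving both halves of that path half weight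
  makes the weighted Euler inequality fail.
\<close>

lemma planar_no_double_wheel:
  assumes G: "planar_graph G" and S: "S \<subseteq> pverts G" "S \<noteq> {}"
    and uvw: "u \<in> pverts G - S" "v \<in> pverts G - S" "w \<in> pverts G - S" "u \<noteq> v" "u \<noteq> w" "v \<noteq> w"
    and adjw: "(u, w) \<in> parcs G" "(v, w) \<in> parcs G"
    and adj: "\<And>s. s \<in> S \<Longrightarrow> (u, s) \<in> parcs G \<and> (v, s) \<in> parcs G"
    and deg: "\<And>s. s \<in> S \<Longrightarrow> card {t\<in>S. (s, t) \<in> parcs G} \<ge> 2"
  shows False
proof -
  interpret pair_graph G using G unfolding planar_graph_def by blast
  have finS: "finite S" using S pair_finite_verts finite_subset by blast
  define ES where "ES = {{a, b} | a b. (a, b) \<in> arcs_in G S S}"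
  define X where "X = ES \<union> (\<lambda>s. {u, s}) ` S \<union> (\<lambda>s. {v, s}) ` S"
  define E' where "E' = X \<union> {{u, w}, {v, w}}"
  define V' where "V' = S \<union> {u, v, w}"
  define c where "c e = (if w \<in> e then 1/6 else 1/3 :: real)" for e
  have EE: "E' \<subseteq> edges_of G"
    using adj adjw unfolding E'_def X_def ES_def edges_of_def arcs_in_def by auto
  have finE: "finite E'" using finite_subset[OF EE edges_of_finite[OF pair_graph_axioms]] .
  have finES: "finite ES" using finE unfolding E'_def X_def by auto
  have two: "\<exists>a b. a \<noteq> b \<and> e = {a, b}" if e: "e \<in> E'" for e
  proof -
    obtain a b where "e = {a, b}" "(a, b) \<in> parcs G" using e EE unfolding edges_of_def by blast
    moreover from this have "a \<noteq> b" using pair_no_loops[of "(a, b)"] by simp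
    ultimately show ?thesis by blast
  qed
  have Xw: "w \<notin> e" if "e \<in> X" for e
    using that uvw unfolding X_def ES_def arcs_in_def by auto
  have "card ((\<lambda>s. {u, s}) ` S) = card S" "card ((\<lambda>s. {v, s}) ` S) = card S"
    by (rule card_image, rule inj_onI, simp add: doubleton_eq_iff, metis)+
  moreover have "ES \<inter> (\<lambda>s. {u, s}) ` S = {}" "(ES \<union> (\<lambda>s. {u, s}) ` S) \<inter> (\<lambda>s. {v, s}) ` S = {}"
  proof -
    have "e \<subseteq> S" if "e \<in> ES" for e using that unfolding ES_def arcs_in_def by blast
    then have *: "u \<notin> e \<and> v \<notin> e" if "e \<in> ES" for e using that uvw by blast
    then show "ES \<inter> (\<lambda>s. {u, s}) ` S = {}" by blast
    have "v \<notin> e" if "e \<in> ES \<union> (\<lambda>s. {u, s}) ` S" for e using * that uvw by auto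
    moreover have "v \<in> e" if "e \<in> (\<lambda>s. {v, s}) ` S" for e using that by auto
    ultimately show "(ES \<union> (\<lambda>s. {u, s}) ` S) \<inter> (\<lambda>s. {v, s}) ` S = {}" by blast
  qed
  ultimately have cX: "card X = card ES + 2 * card S"
    unfolding X_def using finS finES by (simp add: card_Un_disjoint)
  have Xdis: "X \<inter> {{u, w}, {v, w}} = {}" using Xw by auto
  have neq: "{u, w} \<noteq> {v, w}" using uvw by (auto simp: doubleton_eq_iff)
  have finX: "finite X" using finE E'_def by auto
  have cE: "card E' = card ES + 2 * card S + 2"
    unfolding E'_def using cX Xdis finX neq by (simp add: card_Un_disjoint)
  have "sum c E' = sum c X + sum c {{u, w}, {v, w}}"
    unfolding E'_def using finX Xdis by (intro sum.union_disjoint) auto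
  also have "sum c X = (\<Sum>e\<in>X. 1/3)" using Xw by (intro sum.cong) (auto simp: c_def)
  also have "sum c {{u, w}, {v, w}} = 1/3" using neq by (simp add: c_def)
  finally have sE: "sum c E' = (card ES + 2 * card S + 1) / 3" using cX by simp
  have "(\<Sum>s\<in>S. 2) \<le> (\<Sum>a\<in>S. card {b\<in>S. (a, b) \<in> parcs G})" using deg by (intro sum_mono) auto
  then have "2 * card S \<le> card (arcs_in G S S)" using card_arcs_in[OF finS finS] by simp
  then have mES: "card S \<le> card ES"
    using card_arcs_le_edges[of G S] finES unfolding ES_def by simp
  have "real (card E') + 2 \<le> real (card V') + max 1 (2 * sum c E')"
  proof (rule planar_weighted_euler[OF G _ _ EE])
    show "V' \<subseteq> pverts G" "V' \<noteq> {}" using S uvw unfolding V'_def by auto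
    show "\<Union>E' \<subseteq> V'" unfolding E'_def X_def ES_def V'_def arcs_in_def by auto
    show "c e \<ge> 0" for e unfolding c_def by simp
    fix C assume C: "C \<subseteq> E'" "core C"
    have finC: "finite C" using C(1) finE finite_subset by blast
    have cE': "e = {u, w} \<or> e = {v, w}" if "e \<in> C" "w \<in> e" for e
      using that C(1) Xw unfolding E'_def by auto
    show "1 \<le> sum c C"
    proof (cases "\<exists>e\<in>C. w \<in> e")
      case True
      then obtain e1 where e1: "e1 \<in> C" "w \<in> e1" by blast
      then obtain e2 where e2: "e2 \<in> C" "w \<in> e2" "e2 \<noteq> e1" using C(2) unfolding core_def by blast
      \<comment> \<open>A core through \<open>w\<close> contains both light edges and one further
        edge at each of \<open>u\<close> and \<open>v\<close>: 1/6 + 1/6 + 1/3 + 1/3 = 1.\<close>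
      have uv: "{u, w} \<in> C" "{v, w} \<in> C" using cE'[OF e1] cE'[OF e2(1,2)] e1 e2 by auto
      obtain f where f: "f \<in> C" "f \<noteq> {u, w}" "u \<in> f" using C(2) uv(1) unfolding core_def by blast
      obtain g where g: "g \<in> C" "g \<noteq> {v, w}" "v \<in> g" using C(2) uv(2) unfolding core_def by blast
      have "w \<notin> f" "w \<notin> g" using cE'[of f] cE'[of g] f g uvw by auto
      have "v \<notin> f"
        using f C(1) \<open>w \<notin> f\<close> uvw unfolding E'_def X_def ES_def arcs_in_def by auto
      then have fg: "f \<noteq> g" using g by auto
      have "f \<notin> {g, {u, w}, {v, w}}" "g \<notin> {{u, w}, {v, w}}" "{u, w} \<notin> {{v, w}}"
        using fg \<open>w \<notin> f\<close> \<open>w \<notin> g\<close> neq by blast+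
      then have "sum c {f, g, {u, w}, {v, w}} = c f + (c g + (c {u, w} + c {v, w}))" by simp
      also have "\<dots> = 1" using \<open>w \<notin> f\<close> \<open>w \<notin> g\<close> by (simp add: c_def)
      finally have "sum c {f, g, {u, w}, {v, w}} = 1" .
      moreover have "sum c {f, g, {u, w}, {v, w}} \<le> sum c C"
        using f g uv finC by (intro sum_mono2) (auto simp: c_def)
      ultimately show ?thesis by simp
    next
      case False
      then have "sum c C = (\<Sum>e\<in>C. 1/3)" by (intro sum.cong) (auto simp: c_def)
      moreover have "card C \<ge> 3"
      proof (rule core_card_ge_3[OF C(2) finC])
        show "\<exists>a b. a \<noteq> b \<and> e = {a, b}" if "e \<in> C" for e using two that C(1) by auto
      qed
      ultimately show ?thesis by simp
    qed
  qed
  then have "real (card E') + 2 \<le> real (card V') + max 1 (2 * ((real (card ES) + 2 * real (card S) + 1) / 3))"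
    unfolding sE by (simp add: algebra_simps)
  moreover have "card V' \<le> card S + 3"
    unfolding V'_def using card_Un_le[of S "{u, v, w}"] uvw by simp
  then have "real (card V') \<le> real (card S) + 3" by linarith
  moreover have "real (card S) \<ge> 1" using S finS by (simp add: card_gt_0_iff Suc_leI)
  moreover have "real (card S) \<le> real (card ES)" using mES by simp
  moreover have "real (card E') = real (card ES) + 2 * real (card S) + 2" using cE by simp
  \<comment> \<open>With \<open>s\<close> rim vertices and \<open>m\<close> edges among them, the
    second value of the maximum would give \<open>m + 1 <= s\<close>.\<close>
  moreover have "False" if A: "e + 2 \<le> x + max 1 (2 * ((m + 2 * s + 1) / 3))" "x \<le> s + 3" "1 \<le> s"
    "s \<le> m" "e = m + 2 * s + 2" for e x m s :: real
  proof -
    consider "e + 2 \<le> x + 1" | "e + 2 \<le> x + 2 * ((m + 2 * s + 1) / 3)"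
      using A(1) by (auto simp: max_def split: if_splits)
    then show False
    proof cases
      case 1 then show False using A(2-5) by linarith
    next
      case 2
      then have "3 * (e + 2) \<le> 3 * x + 2 * (m + 2 * s + 1)" by (simp add: field_simps)
      then show False using A(2-5) by argo
    qed
  qed
  ultimately show False by blast
qed

section \<open>Spectral radius and quadratic form\<close>

definition nbrs :: "'a pair_pre_digraph \<Rightarrow> 'a \<Rightarrow> 'a set" where
  "nbrs G a = {b. (a, b) \<in> parcs G}"

definition qform :: "'a pair_pre_digraph \<Rightarrow> ('a \<Rightarrow> real) \<Rightarrow> real" where
  "qform G y = (\<Sum>(a, b)\<in>parcs G. y a * y b)"

context pair_graph
begin

lemma nbrs_subset: "nbrs G a \<subseteq> pverts G"
  unfolding nbrs_def using in_arcsD2 by auto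

lemma finite_nbrs: "finite (nbrs G a)"
  using nbrs_subset pair_finite_verts finite_subset by blast

lemma nbrs_sym: "b \<in> nbrs G a \<longleftrightarrow> a \<in> nbrs G b"
  unfolding nbrs_def using arcs_symmetric by auto

lemma parcs_sym: "(a, b) \<in> parcs G \<Longrightarrow> (b, a) \<in> parcs G"
  using nbrs_sym unfolding nbrs_def by simp

lemma sum_arcs:
  fixes h :: "'a \<Rightarrow> 'a \<Rightarrow> real"
  shows "(\<Sum>(a, b)\<in>parcs G. h a b) = (\<Sum>a\<in>pverts G. \<Sum>b\<in>nbrs G a. h a b)"
proof -
  have "parcs G = Sigma (pverts G) (nbrs G)"
    unfolding nbrs_def using in_arcsD1 by auto
  then show ?thesis using pair_finite_verts finite_nbrs by (simp add: sum.Sigma)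
qed

lemma sum_arcs_swap:
  fixes h :: "'a \<Rightarrow> 'a \<Rightarrow> real"
  shows "(\<Sum>(a, b)\<in>parcs G. h a b) = (\<Sum>(a, b)\<in>parcs G. h b a)"
proof (rule sum.reindex_bij_witness[of _ prod.swap prod.swap])
  fix x assume "x \<in> parcs G"
  then show "prod.swap x \<in> parcs G" using parcs_sym by (cases x) auto
qed (auto intro: parcs_sym)

lemma qform_ge:
  assumes y: "\<And>a. y a \<ge> 0" and le: "\<And>a. a \<in> pverts G \<Longrightarrow> r * y a \<le> sum y (nbrs G a)"
  shows "r * (\<Sum>a\<in>pverts G. (y a)\<^sup>2) \<le> qform G y"
proof -
  have "r * (\<Sum>a\<in>pverts G. (y a)\<^sup>2) = (\<Sum>a\<in>pverts G. y a * (r * y a))"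
    by (simp add: sum_distrib_left power2_eq_square algebra_simps)
  also have "\<dots> \<le> (\<Sum>a\<in>pverts G. y a * sum y (nbrs G a))"
    using y le by (intro sum_mono mult_left_mono) auto
  also have "\<dots> = qform G y" unfolding qform_def sum_arcs by (simp add: sum_distrib_left)
  finally show ?thesis .
qed

text \<open>Ground state representation: \<open>t * |y|^2 - qform G y\<close> is half the sum of the
  squares \<open>D\<close> over all arcs plus the slack of the supersolution weighted by
  \<open>y^2\<close>. If both nonnegative parts vanish, \<open>y\<close> is proportional to
  \<open>z\<close> along every arc, and the inequality for \<open>z\<close> is tight wherever
  \<open>y\<close> is not 0.\<close>

lemma qform_supersolution:
  assumes z: "\<And>a. a \<in> pverts G \<Longrightarrow> z a > 0"
    and sup: "\<And>a. a \<in> pverts G \<Longrightarrow> sum z (nbrs G a) \<le> t * z a"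
  shows qform_le: "qform G y \<le> t * (\<Sum>a\<in>pverts G. (y a)\<^sup>2)"
    and qform_eq_arc: "qform G y = t * (\<Sum>a\<in>pverts G. (y a)\<^sup>2) \<Longrightarrow> (a, b) \<in> parcs G \<Longrightarrow> y a * z b = y b * z a"
    and qform_eq_vert: "qform G y = t * (\<Sum>a\<in>pverts G. (y a)\<^sup>2) \<Longrightarrow> a \<in> pverts G \<Longrightarrow> y a \<noteq> 0 \<Longrightarrow>
      sum z (nbrs G a) = t * z a"
proof -
  define D where "D a b = (y a * z b - y b * z a)\<^sup>2 / (z a * z b)" for a b
  define s where "s a = (y a)\<^sup>2 * (t - sum z (nbrs G a) / z a)" for a
  have D0: "D a b \<ge> 0" if "(a, b) \<in> parcs G" for a b
    using that z[of a] z[of b] in_arcsD1 in_arcsD2 unfolding D_def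
    by (auto intro!: divide_nonneg_nonneg mult_nonneg_nonneg less_imp_le)
  have s0: "s a \<ge> 0" if "a \<in> pverts G" for a
    using z[OF that] sup[OF that] unfolding s_def
    by (intro mult_nonneg_nonneg) (auto simp: divide_simps mult.commute)
  have Deq: "D a b = (y a)\<^sup>2 * z b / z a + (y b)\<^sup>2 * z a / z b - 2 * (y a * y b)"
    if "(a, b) \<in> parcs G" for a b
  proof -
    have "z a > 0" "z b > 0" using that z in_arcsD1 in_arcsD2 by auto
    then show ?thesis unfolding D_def by (simp add: field_simps power2_eq_square)
  qed
  define h where "h a b = (y a)\<^sup>2 * z b / z a" for a b
  have "(\<Sum>(a, b)\<in>parcs G. D a b) = (\<Sum>(a, b)\<in>parcs G. h a b + h b a - 2 * (y a * y b))"
    by (intro sum.cong refl) (auto simp: Deq h_def)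
  also have "\<dots> = (\<Sum>(a, b)\<in>parcs G. h a b) + (\<Sum>(a, b)\<in>parcs G. h b a) - 2 * qform G y"
    unfolding qform_def by (simp add: sum.distrib sum_subtractf sum_distrib_left case_prod_beta)
  also have "(\<Sum>(a, b)\<in>parcs G. h b a) = (\<Sum>(a, b)\<in>parcs G. h a b)"
    using sum_arcs_swap[of h] by simp
  also have "(\<Sum>(a, b)\<in>parcs G. h a b) = (\<Sum>a\<in>pverts G. (y a)\<^sup>2 * sum z (nbrs G a) / z a)"
    unfolding sum_arcs h_def by (simp add: sum_distrib_left sum_divide_distrib)
  also have "\<dots> = t * (\<Sum>a\<in>pverts G. (y a)\<^sup>2) - sum s (pverts G)"
    unfolding s_def by (simp add: sum_distrib_left sum_subtractf[symmetric] algebra_simps)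
  finally have key: "(\<Sum>(a, b)\<in>parcs G. D a b) + 2 * sum s (pverts G) =
      2 * (t * (\<Sum>a\<in>pverts G. (y a)\<^sup>2)) - 2 * qform G y" by simp
  have SD: "(\<Sum>(a, b)\<in>parcs G. D a b) \<ge> 0" using D0 by (intro sum_nonneg) auto
  have Ss: "sum s (pverts G) \<ge> 0" using s0 by (intro sum_nonneg) auto
  show "qform G y \<le> t * (\<Sum>a\<in>pverts G. (y a)\<^sup>2)" using key SD Ss by linarith
  assume eq: "qform G y = t * (\<Sum>a\<in>pverts G. (y a)\<^sup>2)"
  have zero: "(\<Sum>(a, b)\<in>parcs G. D a b) = 0" "sum s (pverts G) = 0"
    using key SD Ss eq by linarith+
  show "y a * z b = y b * z a" if ab: "(a, b) \<in> parcs G"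
  proof -
    have "\<forall>x\<in>parcs G. (case x of (a, b) \<Rightarrow> D a b) = 0"
      using zero(1) D0 pair_finite_arcs by (subst (asm) sum_nonneg_eq_0_iff) auto
    then have "D a b = 0" using ab by auto
    moreover have "z a > 0" "z b > 0" using ab z in_arcsD1 in_arcsD2 by auto
    ultimately show ?thesis unfolding D_def by simp
  qed
  show "sum z (nbrs G a) = t * z a" if a: "a \<in> pverts G" "y a \<noteq> 0"
  proof -
    have "s a = 0" using zero(2) s0 pair_finite_verts a(1) by (subst (asm) sum_nonneg_eq_0_iff) auto
    then show ?thesis using a z[OF a(1)] unfolding s_def by (auto simp: field_simps)
  qed
qed

section \<open>The spectral radius of the adjacency matrix\<close>

lemma spectral_radius_enumeration:
  obtains f where "bij_betw f {..<card (pverts G)} (pverts G)"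
    "\<rho> G = spectral_radius (adjacency_matrix G f)"
proof -
  define f where "f = (SOME f. bij_betw f {..<card (pverts G)} (pverts G))"
  have "\<exists>f. bij_betw f {..<card (pverts G)} (pverts G)"
    using ex_bij_betw_nat_finite[OF pair_finite_verts] by (simp add: atLeast0LessThan)
  then have "bij_betw f {..<card (pverts G)} (pverts G)" unfolding f_def by (rule someI_ex)
  then show ?thesis using that unfolding graph_spectral_radius_def f_def by blast
qed

lemma adjacency_matrix_mult:
  assumes f: "bij_betw f {..<card (pverts G)} (pverts G)" and i: "i < card (pverts G)"
    and v: "v \<in> carrier_vec (card (pverts G))"
  shows "(adjacency_matrix G f *\<^sub>v v) $ i =
    (\<Sum>b\<in>nbrs G (f i). v $ (inv_into {..<card (pverts G)} f b))"
proof -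
  define n where "n = card (pverts G)"
  define g where "g = inv_into {..<n} f"
  have inj: "inj_on f {..<n}" "f ` {..<n} = pverts G" using f unfolding bij_betw_def n_def by auto
  have "(adjacency_matrix G f *\<^sub>v v) $ i = (\<Sum>j\<in>{0..<n}. (if (f i, f j) \<in> parcs G then 1 else 0) * v $ j)"
    using i v unfolding adjacency_matrix_def n_def
    by (simp add: index_mult_mat_vec scalar_prod_def)
  also have "\<dots> = (\<Sum>j\<in>{..<n}. if f j \<in> nbrs G (f i) then v $ j else 0)"
    unfolding nbrs_def by (intro sum.cong) auto
  also have "\<dots> = (\<Sum>b\<in>f ` {..<n}. if b \<in> nbrs G (f i) then v $ g b else 0)"
    using inj(1) inv_into_f_f[OF inj(1)] unfolding g_def
    by (subst sum.reindex) (auto intro!: sum.cong)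
  also have "\<dots> = (\<Sum>b\<in>nbrs G (f i). v $ g b)"
  proof -
    have "{b \<in> pverts G. b \<in> nbrs G (f i)} = nbrs G (f i)" using nbrs_subset by auto
    then show ?thesis unfolding inj(2) by (subst sum.inter_filter[symmetric]) (auto simp: pair_finite_verts)
  qed
  finally show ?thesis unfolding g_def n_def .
qed

text \<open>Take the moduli of an eigenvector for an eigenvalue of largest modulus; the triangle
  inequality turns the eigenvalue equation into the inequality that \<open>qform_ge\<close> asks
  for.\<close>

lemma spectral_radius_subsolution:
  assumes "pverts G \<noteq> {}"
  obtains y where "\<And>a. y a \<ge> 0" "\<exists>a\<in>pverts G. y a > 0"
    "\<And>a. a \<in> pverts G \<Longrightarrow> \<rho> G * y a \<le> sum y (nbrs G a)"
proof -
  define n where "n = card (pverts G)"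
  have n0: "n > 0" using assms pair_finite_verts n_def by (simp add: card_gt_0_iff)
  obtain f where f: "bij_betw f {..<n} (pverts G)" "\<rho> G = spectral_radius (adjacency_matrix G f)"
    using spectral_radius_enumeration unfolding n_def by blast
  define A where "A = adjacency_matrix G f"
  have A: "A \<in> carrier_mat n n" unfolding A_def adjacency_matrix_def n_def by simp
  obtain k where k: "k \<in> spectrum A" "\<rho> G = cmod k"
    using spectral_radius_mem_max(1)[OF A n0] f(2) unfolding A_def by auto
  then obtain v where v: "v \<in> carrier_vec n" "v \<noteq> 0\<^sub>v n" "A *\<^sub>v v = k \<cdot>\<^sub>v v"
    using A unfolding spectrum_def eigenvalue_def eigenvector_def by auto
  define g where "g = inv_into {..<n} f"
  define y where "y a = cmod (v $ g a)" for a
  have fg: "f (g a) = a" "g a < n" if "a \<in> pverts G" for a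
    using f(1) that unfolding g_def bij_betw_def
    by (metis f_inv_into_f, metis inv_into_into lessThan_iff)
  have gf: "g (f i) = i" if "i < n" for i
    using f(1) that unfolding g_def bij_betw_def by simp
  have "\<exists>i<n. v $ i \<noteq> 0"
  proof (rule ccontr)
    assume "\<not> ?thesis"
    then have "v = 0\<^sub>v n" using v(1) by (intro eq_vecI) auto
    then show False using v(2) by simp
  qed
  then obtain i where i: "i < n" "v $ i \<noteq> 0" by blast
  have "f i \<in> pverts G" using f(1) i(1) unfolding bij_betw_def by auto
  then have "\<exists>a\<in>pverts G. y a > 0" using i gf unfolding y_def by (intro bexI[of _ "f i"]) auto
  moreover have "\<rho> G * y a \<le> sum y (nbrs G a)" if a: "a \<in> pverts G" for a
  proof -
    have "k * v $ g a = (A *\<^sub>v v) $ g a" using v(1,3) fg(2)[OF a] by simp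
    also have "\<dots> = (\<Sum>b\<in>nbrs G a. v $ g b)"
      using adjacency_matrix_mult[of f "g a" v] f(1) fg[OF a] v(1) unfolding A_def n_def g_def by simp
    finally have "cmod k * y a = cmod (\<Sum>b\<in>nbrs G a. v $ g b)" unfolding y_def by (metis norm_mult)
    also have "\<dots> \<le> sum y (nbrs G a)" unfolding y_def by (rule norm_sum)
    finally show ?thesis using k(2) by simp
  qed
  moreover have "y a \<ge> 0" for a unfolding y_def by simp
  ultimately show ?thesis using that by blast
qed

lemma spectral_radius_ge_eigenvalue:
  assumes z: "\<And>a. a \<in> pverts G \<Longrightarrow> sum z (nbrs G a) = t * z a" and nz: "\<exists>a\<in>pverts G. z a \<noteq> 0"
  shows "t \<le> \<rho> G"
proof -
  define n where "n = card (pverts G)"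
  have n0: "n > 0" using nz pair_finite_verts n_def card_gt_0_iff by blast
  obtain f where f: "bij_betw f {..<n} (pverts G)" "\<rho> G = spectral_radius (adjacency_matrix G f)"
    using spectral_radius_enumeration unfolding n_def by blast
  define A where "A = adjacency_matrix G f"
  have A: "A \<in> carrier_mat n n" unfolding A_def adjacency_matrix_def n_def by simp
  define g where "g = inv_into {..<n} f"
  have fg: "f (g a) = a" "g a < n" if "a \<in> pverts G" for a
    using f(1) that unfolding g_def bij_betw_def
    by (metis f_inv_into_f, metis inv_into_into lessThan_iff)
  define v where "v = Matrix.vec n (\<lambda>i. complex_of_real (z (f i)))"
  have v: "v \<in> carrier_vec n" unfolding v_def by simp
  have fV: "f i \<in> pverts G" if "i < n" for i using f(1) that unfolding bij_betw_def by auto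
  obtain a where a: "a \<in> pverts G" "z a \<noteq> 0" using nz by blast
  have "v $ g a \<noteq> 0" using a fg[OF a(1)] unfolding v_def by simp
  then have v0: "v \<noteq> 0\<^sub>v n" using fg[OF a(1)] by auto
  have "A *\<^sub>v v = complex_of_real t \<cdot>\<^sub>v v"
  proof (rule eq_vecI)
    show "dim_vec (A *\<^sub>v v) = dim_vec (complex_of_real t \<cdot>\<^sub>v v)" using A v by simp
    fix i assume "i < dim_vec (complex_of_real t \<cdot>\<^sub>v v)"
    then have i: "i < n" using v by simp
    have "(A *\<^sub>v v) $ i = (\<Sum>b\<in>nbrs G (f i). v $ g b)"
      using adjacency_matrix_mult[of f i v] f(1) i v unfolding A_def n_def g_def by simp
    also have "\<dots> = (\<Sum>b\<in>nbrs G (f i). complex_of_real (z b))"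
    proof (rule sum.cong[OF refl])
      fix b assume "b \<in> nbrs G (f i)"
      then have "b \<in> pverts G" using nbrs_subset by auto
      then show "v $ g b = complex_of_real (z b)" using fg unfolding v_def by simp
    qed
    also have "\<dots> = complex_of_real (t * z (f i))" using z[OF fV[OF i]] by (metis of_real_sum)
    finally show "(A *\<^sub>v v) $ i = (complex_of_real t \<cdot>\<^sub>v v) $ i" using i unfolding v_def by simp
  qed
  then have "complex_of_real t \<in> spectrum A"
    using v v0 A unfolding spectrum_def eigenvalue_def eigenvector_def by auto
  then have "cmod (complex_of_real t) \<in> cmod ` spectrum A" by (rule imageI)
  then have "cmod (complex_of_real t) \<le> \<rho> G"
    using spectral_radius_mem_max(2)[OF A n0] unfolding f(2) A_def by simp
  then show ?thesis by simp
qed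

text \<open>For the upper bound, the subsolution belonging to the spectral radius is tested against
  \<open>z\<close>, which is in particular a supersolution.\<close>

lemma spectral_radius_eq_positive_eigenvalue:
  assumes z: "\<And>a. a \<in> pverts G \<Longrightarrow> z a > 0" "\<And>a. a \<in> pverts G \<Longrightarrow> sum z (nbrs G a) = t * z a"
    and ne: "pverts G \<noteq> {}"
  shows "\<rho> G = t"
proof (rule antisym)
  show "t \<le> \<rho> G" using spectral_radius_ge_eigenvalue[of z t] z ne by force
  obtain y where y: "\<And>a. y a \<ge> 0" "\<exists>a\<in>pverts G. y a > 0"
    "\<And>a. a \<in> pverts G \<Longrightarrow> \<rho> G * y a \<le> sum y (nbrs G a)"
    using spectral_radius_subsolution[OF ne] by blast
  define Y where "Y = (\<Sum>a\<in>pverts G. (y a)\<^sup>2)"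
  obtain a where a: "a \<in> pverts G" "y a > 0" using y(2) by blast
  have "Y > 0" unfolding Y_def
    by (rule sum_pos2[OF pair_finite_verts a(1)]) (use a(2) in auto)
  moreover have "\<rho> G * Y \<le> qform G y" unfolding Y_def using qform_ge[of y] y by blast
  moreover have "qform G y \<le> t * Y" unfolding Y_def using qform_le[of z t y] z by force
  ultimately show "\<rho> G \<le> t" by (meson mult_le_cancel_right_pos order_trans)
qed

end

section \<open>Two hubs dominate a planar graph of large spectral radius\<close>

text \<open>The part of the quadratic form carried by arcs from \<open>A\<close> to
  \<open>B\<close>: an edge inside \<open>A\<close> counts twice in \<open>block G y A A\<close>, an
  edge between disjoint sets once.\<close>

definition block :: "'a pair_pre_digraph \<Rightarrow> ('a \<Rightarrow> real) \<Rightarrow> 'a set \<Rightarrow> 'a set \<Rightarrow> real" where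
  "block G y A B = (\<Sum>a\<in>A. \<Sum>b\<in>B. if (a, b) \<in> parcs G then y a * y b else 0)"

lemma block_Un_left:
  "finite A \<Longrightarrow> finite A' \<Longrightarrow> A \<inter> A' = {} \<Longrightarrow> block G y (A \<union> A') B = block G y A B + block G y A' B"
  unfolding block_def by (rule sum.union_disjoint)

lemma block_Un_right:
  "finite B \<Longrightarrow> finite B' \<Longrightarrow> B \<inter> B' = {} \<Longrightarrow> block G y A (B \<union> B') = block G y A B + block G y A B'"
  unfolding block_def by (simp add: sum.union_disjoint sum.distrib)

lemma block_nonneg: "(\<And>a. y a \<ge> 0) \<Longrightarrow> block G y A B \<ge> 0"
  unfolding block_def by (intro sum_nonneg) auto

lemma block_alt:
  assumes "finite B"
  shows "block G y A B = (\<Sum>a\<in>A. y a * sum y (nbrs G a \<inter> B))"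
proof -
  have "(\<Sum>b\<in>B. if (a, b) \<in> parcs G then y a * y b else 0) = y a * sum y (nbrs G a \<inter> B)" for a
  proof -
    have "nbrs G a \<inter> B = {b\<in>B. (a, b) \<in> parcs G}" unfolding nbrs_def by auto
    then show ?thesis using assms by (simp add: sum.inter_filter[symmetric] sum_distrib_left)
  qed
  then show ?thesis unfolding block_def by simp
qed

lemma (in pair_graph) block_sym: "block G y A B = block G y B A"
proof -
  have "block G y A B = (\<Sum>b\<in>B. \<Sum>a\<in>A. if (a, b) \<in> parcs G then y a * y b else 0)"
    unfolding block_def by (rule sum.swap)
  also have "\<dots> = block G y B A"
    unfolding block_def using parcs_sym by (intro sum.cong refl) (auto simp: mult.commute)
  finally show ?thesis .
qed

lemma (in pair_graph) qform_block: "qform G y = block G y (pverts G) (pverts G)"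
proof -
  have "nbrs G a \<inter> pverts G = nbrs G a" for a using nbrs_subset by auto
  then show ?thesis
    unfolding qform_def sum_arcs block_alt[OF pair_finite_verts] by (simp add: sum_distrib_left)
qed

lemma (in pair_graph) sum_deg:
  assumes "A \<subseteq> pverts G" "B \<subseteq> pverts G"
  shows "(\<Sum>a\<in>A. real (card (nbrs G a \<inter> B))) = real (card (arcs_in G A B))"
proof -
  have "finite A" "finite B" using assms pair_finite_verts finite_subset by blast+
  moreover have "nbrs G a \<inter> B = {b\<in>B. (a, b) \<in> parcs G}" for a unfolding nbrs_def by auto
  ultimately show ?thesis by (simp add: card_arcs_in)
qed

lemma planar_degenerate:
  assumes G: "planar_graph G" and T: "T \<subseteq> pverts G" "T \<noteq> {}"
  shows "\<exists>a\<in>T. card (nbrs G a \<inter> T) \<le> 6"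
proof (rule ccontr)
  interpret pair_graph G using G unfolding planar_graph_def by blast
  have finT: "finite T" using T pair_finite_verts finite_subset by blast
  assume "\<not> ?thesis"
  then have "7 \<le> real (card (nbrs G a \<inter> T))" if "a \<in> T" for a using that by (auto simp: not_le)
  then have "(\<Sum>a\<in>T. 7) \<le> (\<Sum>a\<in>T. real (card (nbrs G a \<inter> T)))" by (intro sum_mono) auto
  also have "\<dots> = real (card (arcs_in G T T))" using sum_deg T by blast
  also have "\<dots> \<le> 6 * real (card T)" using planar_arcs_le[OF G T(1)] by linarith
  finally show False using finT T by simp
qed

text \<open>Remove a vertex of degree at most 6 inside \<open>T\<close> again and again; its edges,
  counted in both directions, contribute at most \<open>2 * 6 * M * y a\<close>. The bound is linear
  in \<open>y\<close>, so it can be weighed against gains of size \<open>sum y R\<close>.\<close>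

lemma planar_block_le:
  assumes G: "planar_graph G" and y: "\<And>a. y a \<ge> 0"
    and T: "T \<subseteq> pverts G" and M: "\<And>a. a \<in> T \<Longrightarrow> y a \<le> M"
  shows "block G y T T \<le> 12 * M * sum y T"
proof -
  interpret pair_graph G using G unfolding planar_graph_def by blast
  have "finite T" using T pair_finite_verts finite_subset by blast
  then show ?thesis using T M
  proof (induction T rule: finite_psubset_induct)
    case (psubset T)
    show ?case
    proof (cases "T = {}")
      case True then show ?thesis unfolding block_def by simp
    next
      case False
      obtain a where a: "a \<in> T" "card (nbrs G a \<inter> T) \<le> 6"
        using planar_degenerate[OF G psubset.prems(1) False] by blast
      define T' where "T' = T - {a}"
      have T': "T = {a} \<union> T'" "{a} \<inter> T' = {}" "finite T'" "T' \<subset> T"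
        using a psubset.hyps unfolding T'_def by auto
      have M0: "0 \<le> M" using psubset.prems(2)[OF a(1)] y[of a] by linarith
      have IH: "block G y T' T' \<le> 12 * M * sum y T'"
        using psubset.IH[OF T'(4)] psubset.prems T'(4) by blast
      have "(a, a) \<notin> parcs G" using pair_no_loops[of "(a, a)"] by auto
      then have aa: "block G y {a} {a} = 0" unfolding block_def by simp
      have "sum y (nbrs G a \<inter> T') \<le> (\<Sum>b\<in>nbrs G a \<inter> T'. M)"
        using psubset.prems(2) T'(4) by (intro sum_mono) auto
      also have "\<dots> \<le> 6 * M"
      proof -
        have "card (nbrs G a \<inter> T') \<le> card (nbrs G a \<inter> T)"
          using T'(4) finite_nbrs by (intro card_mono) auto
        then show ?thesis using a(2) M0 by (simp add: mult_right_mono)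
      qed
      finally have "block G y {a} T' \<le> 6 * M * y a"
        unfolding block_alt[OF T'(3)] using y[of a] by (simp add: mult_left_mono mult.commute)
      moreover have "block G y T T = block G y {a} {a} + block G y {a} T' + (block G y T' {a} + block G y T' T')"
        unfolding T'(1) using T' by (simp add: block_Un_left block_Un_right del: Un_insert_left)
      moreover have "block G y T' {a} = block G y {a} T'" by (rule block_sym)
      moreover have "sum y T = y a + sum y T'" unfolding T'(1) using T' by (simp add: sum.insert_if)
      ultimately show ?thesis using IH aa by (simp add: algebra_simps)
    qed
  qed
qed

lemma planar_common_nbrs:
  assumes G: "planar_graph G" and uvz: "u \<noteq> v" "u \<noteq> z" "v \<noteq> z" "u \<in> pverts G" "v \<in> pverts G" "z \<in> pverts G"
  shows "card (nbrs G z \<inter> (nbrs G u \<inter> nbrs G v)) \<le> 2"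
proof (rule ccontr)
  interpret pair_graph G using G unfolding planar_graph_def by blast
  assume "\<not> ?thesis"
  then have "3 \<le> card (nbrs G z \<inter> (nbrs G u \<inter> nbrs G v))" by simp
  then obtain B where B: "B \<subseteq> nbrs G z \<inter> (nbrs G u \<inter> nbrs G v)" "card B = 3"
    by (rule obtain_subset_with_card_n)
  show False
  proof (rule planar_no_K33[OF G, of "{u, v, z}" B])
    show "B \<subseteq> pverts G" using B nbrs_subset by blast
    have nl: "a \<notin> nbrs G a" for a unfolding nbrs_def using pair_no_loops[of "(a, a)"] by auto
    show "{u, v, z} \<inter> B = {}" using B(1) nl[of u] nl[of v] nl[of z] by blast
    show "card {u, v, z} = 3" using uvz by simp
    fix a b assume "a \<in> {u, v, z}" "b \<in> B"
    then have "b \<in> nbrs G a" using B by auto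
    then show "(a, b) \<in> parcs G" unfolding nbrs_def by simp
  qed (use uvz B in auto)
qed

text \<open>\<open>y\<close> is scaled to maximum 1. For \<open>r\<close> the target value is
  inserted, a lower bound for the spectral radius of \<open>G\<close> rather than this radius
  itself, so that equality with the target can later be forced.\<close>

locale large_subsolution = pair_graph G for G :: "'a pair_pre_digraph" (structure) +
  fixes y :: "'a \<Rightarrow> real" and r :: real
  assumes planar: "planar_graph G"
    and big: "real (card (pverts G)) \<ge> 2 * 10 ^ 17"
    and r: "r > 0" "r\<^sup>2 \<ge> 2 * real (card (pverts G)) - 4"
    and y01: "\<And>a. 0 \<le> y a" "\<And>a. a \<in> pverts G \<Longrightarrow> y a \<le> 1" and y1: "\<exists>a\<in>pverts G. y a = 1"
    and sub: "\<And>a. a \<in> pverts G \<Longrightarrow> r * y a \<le> sum y (nbrs G a)"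
begin

abbreviation "V \<equiv> pverts G"
definition "N = real (card V)"
definition "L = {a \<in> V. y a \<ge> 1 / 10000}"

text \<open>
  For \<open>n \<ge> 2 \<cdot> 10\<^sup>1\<^sup>7\<close> the threshold in \<open>L\<close> makes both the size of \<open>L\<close> and the contribution of
  the vertices outside \<open>L\<close> to the two-step walks negligible against \<open>n\<close>.
\<close>

lemma N_big: "N \<ge> 2 * 10 ^ 17" using big N_def by simp

lemma N_ge: "N \<ge> 1000000"
  using N_big by simp

lemma r_big: "r \<ge> 6 * 10 ^ 8"
proof (rule ccontr)
  assume "\<not> ?thesis"
  then have "r\<^sup>2 < (6 * 10 ^ 8)\<^sup>2" using r(1) by (intro power_strict_mono) auto
  then show False using r(2) N_big unfolding N_def by simp
qed

lemma L_sub: "L \<subseteq> V" and finite_L: "finite L"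
  unfolding L_def using pair_finite_verts by auto

section \<open>Walks of length two and the two hubs\<close>

lemma card_arcs: "(\<Sum>a\<in>V. real (card (nbrs G a))) \<le> 6 * N"
proof -
  have "nbrs G a \<inter> V = nbrs G a" for a using nbrs_subset by auto
  then have "(\<Sum>a\<in>V. real (card (nbrs G a))) = real (card (arcs_in G V V))"
    using sum_deg[of V V] by simp
  then show ?thesis using planar_arcs_le[OF planar subset_refl] unfolding N_def by linarith
qed

text \<open>A vertex of \<open>L\<close> has degree at least \<open>r / 10000\<close>, while all
  degrees add up to at most \<open>6 * N\<close>; now \<open>r >= 6 * 10 ^ 8\<close> gives the
  constant.\<close>

lemma card_L: "real (card L) \<le> N / 10000"
proof -
  have "(\<Sum>a\<in>L. r * (1 / 10000)) \<le> (\<Sum>a\<in>L. r * y a)"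
    using r(1) unfolding L_def by (intro sum_mono mult_left_mono) auto
  also have "\<dots> \<le> (\<Sum>a\<in>L. sum y (nbrs G a))" using sub L_sub by (intro sum_mono) auto
  also have "\<dots> \<le> (\<Sum>a\<in>L. real (card (nbrs G a)))"
  proof (rule sum_mono)
    fix a
    show "sum y (nbrs G a) \<le> real (card (nbrs G a))"
      using sum_mono[of "nbrs G a" y "\<lambda>_. 1"] y01(2) nbrs_subset by force
  qed
  also have "\<dots> \<le> (\<Sum>a\<in>V. real (card (nbrs G a)))"
    using L_sub pair_finite_verts by (intro sum_mono2) auto
  also have "\<dots> \<le> 6 * N" by (rule card_arcs)
  finally have "real (card L) * r \<le> 60000 * N" by simp
  moreover have "real (card L) * (6 * 10 ^ 8) \<le> real (card L) * r"
    using r_big by (intro mult_left_mono) auto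
  ultimately show ?thesis by simp
qed

text \<open>The number of walks of length two from \<open>a\<close> to \<open>b\<close> whose middle
  vertex is outside \<open>L\<close>.\<close>

definition "c a b = real (card (nbrs G b \<inter> (nbrs G a - L)))"

text \<open>The bipartite edge bound between \<open>A\<close>, consisting of \<open>a\<close> and
  \<open>L\<close>, and the neighbours \<open>B\<close> of \<open>a\<close> outside
  \<open>L\<close>. Of the at most \<open>2 * card A + 2 * card B\<close> edges,
  \<open>card B\<close> start at \<open>a\<close> itself, so at most
  \<open>card B + 2 * card A\<close> remain for the sum.\<close>

lemma sum_c:
  assumes a: "a \<in> V"
  shows "(\<Sum>b\<in>L - {a}. c a b) \<le> real (card (nbrs G a)) + N / 5000 + 2"
proof -
  define A where "A = insert a (L - {a})"
  define B where "B = nbrs G a - L"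
  have AB: "A \<subseteq> V" "B \<subseteq> V" "A \<inter> B = {}"
    using a L_sub nbrs_subset pair_no_loops[of "(a, a)"] unfolding A_def B_def nbrs_def by auto
  have "(\<Sum>b\<in>A. real (card (nbrs G b \<inter> B))) = real (card (arcs_in G A B))"
    using sum_deg AB by blast
  moreover have "(\<Sum>b\<in>A. real (card (nbrs G b \<inter> B))) = real (card B) + (\<Sum>b\<in>L - {a}. c a b)"
  proof -
    have "nbrs G a \<inter> B = B" unfolding B_def by auto
    then show ?thesis unfolding A_def c_def B_def by (subst sum.insert) (use finite_L in auto)
  qed
  moreover have "card (arcs_in G A B) \<le> 2 * (card A + card B)"
    using planar_bipartite_arcs_le[OF planar AB] by arith
  then have "real (card (arcs_in G A B)) \<le> 2 * (real (card A) + real (card B))" by simp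
  moreover have "card A \<le> card L + 1"
    unfolding A_def by (metis card_Diff_subset_Int card_insert_le_m1 card_mono finite_L Diff_subset
        finite_Diff card_insert_if Suc_eq_plus1 add_le_mono1 le_SucI le_Suc_eq)
  moreover have "card B \<le> card (nbrs G a)" unfolding B_def using finite_nbrs by (intro card_mono) auto
  ultimately show ?thesis using card_L by simp
qed

text \<open>Apply the subsolution twice and sort the walks by their end: back at \<open>a\<close>;
  outside \<open>L\<close>, where the weights are tiny; in \<open>L\<close> by way of
  \<open>L\<close>, which spans few edges; in \<open>L\<close> by way of a vertex outside, the main
  term. The second and the third kind cost \<open>6 / 10000 * N\<close> each.\<close>

lemma two_step:
  assumes a: "a \<in> V"
  shows "(2 * N - 4) * y a \<le> real (card (nbrs G a)) * y a + 12 / 10000 * N + (\<Sum>b\<in>L - {a}. c a b * y b)"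
proof -
  define S where "S = V - L"
  have "(2 * N - 4) * y a \<le> r\<^sup>2 * y a" using r(2) y01(1) unfolding N_def by (intro mult_right_mono) auto
  also have "\<dots> = r * (r * y a)" by (simp add: power2_eq_square)
  also have "\<dots> \<le> r * sum y (nbrs G a)" using sub[OF a] r(1) by (intro mult_left_mono) auto
  also have "\<dots> = (\<Sum>w\<in>nbrs G a. r * y w)" by (simp add: sum_distrib_left)
  also have "\<dots> \<le> (\<Sum>w\<in>nbrs G a. sum y (nbrs G w))"
    using sub nbrs_subset by (intro sum_mono) auto
  also have "\<dots> = (\<Sum>w\<in>nbrs G a. sum y (nbrs G w \<inter> {a}) + sum y (nbrs G w \<inter> (L - {a})) + sum y (nbrs G w \<inter> (S - {a})))"
  proof (intro sum.cong refl)
    fix w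
    have "nbrs G w = nbrs G w \<inter> {a} \<union> nbrs G w \<inter> (L - {a}) \<union> nbrs G w \<inter> (S - {a})"
      using nbrs_subset[of w] unfolding S_def by auto
    also have "sum y \<dots> = sum y (nbrs G w \<inter> {a} \<union> nbrs G w \<inter> (L - {a})) + sum y (nbrs G w \<inter> (S - {a}))"
      by (rule sum.union_disjoint) (auto simp: finite_nbrs S_def)
    also have "sum y (nbrs G w \<inter> {a} \<union> nbrs G w \<inter> (L - {a})) = sum y (nbrs G w \<inter> {a}) + sum y (nbrs G w \<inter> (L - {a}))"
      by (rule sum.union_disjoint) (auto simp: finite_nbrs)
    finally show "sum y (nbrs G w) = sum y (nbrs G w \<inter> {a}) + sum y (nbrs G w \<inter> (L - {a})) + sum y (nbrs G w \<inter> (S - {a}))" .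
  qed
  also have "\<dots> = (\<Sum>w\<in>nbrs G a. sum y (nbrs G w \<inter> {a})) + (\<Sum>w\<in>nbrs G a. sum y (nbrs G w \<inter> (L - {a})))
      + (\<Sum>w\<in>nbrs G a. sum y (nbrs G w \<inter> (S - {a})))" by (simp add: sum.distrib)
  also have "(\<Sum>w\<in>nbrs G a. sum y (nbrs G w \<inter> {a})) = real (card (nbrs G a)) * y a"
  proof -
    have "nbrs G w \<inter> {a} = {a}" if "w \<in> nbrs G a" for w using that nbrs_sym by auto
    then show ?thesis by simp
  qed
  also have "(\<Sum>w\<in>nbrs G a. sum y (nbrs G w \<inter> (S - {a}))) \<le> 6 / 10000 * N"
  proof -
    have "(\<Sum>w\<in>nbrs G a. sum y (nbrs G w \<inter> (S - {a}))) \<le> (\<Sum>w\<in>nbrs G a. real (card (nbrs G w)) * (1 / 10000))"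
    proof (rule sum_mono)
      fix w
      have "sum y (nbrs G w \<inter> (S - {a})) \<le> (\<Sum>b\<in>nbrs G w \<inter> (S - {a}). 1 / 10000)"
        by (rule sum_mono) (auto simp: S_def L_def)
      also have "\<dots> \<le> (\<Sum>b\<in>nbrs G w. 1 / 10000)" using finite_nbrs by (intro sum_mono2) auto
      finally show "sum y (nbrs G w \<inter> (S - {a})) \<le> real (card (nbrs G w)) * (1 / 10000)" by simp
    qed
    also have "\<dots> \<le> (\<Sum>w\<in>V. real (card (nbrs G w)) * (1 / 10000))"
      using nbrs_subset pair_finite_verts by (intro sum_mono2) auto
    also have "\<dots> \<le> 6 * N * (1 / 10000)"
      unfolding sum_distrib_right[symmetric] using card_arcs by (intro mult_right_mono) auto
    finally show ?thesis by simp
  qed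
  also have "(\<Sum>w\<in>nbrs G a. sum y (nbrs G w \<inter> (L - {a}))) \<le> 6 / 10000 * N + (\<Sum>b\<in>L - {a}. c a b * y b)"
  proof -
    have "(\<Sum>w\<in>nbrs G a. sum y (nbrs G w \<inter> (L - {a}))) =
        (\<Sum>w\<in>nbrs G a \<inter> L. sum y (nbrs G w \<inter> (L - {a}))) + (\<Sum>w\<in>nbrs G a - L. sum y (nbrs G w \<inter> (L - {a})))"
      using finite_nbrs by (subst sum.union_disjoint[symmetric]) (auto simp: Int_Diff_Un)
    moreover have "(\<Sum>w\<in>nbrs G a \<inter> L. sum y (nbrs G w \<inter> (L - {a}))) \<le> 6 / 10000 * N"
    proof -
      have "(\<Sum>w\<in>nbrs G a \<inter> L. sum y (nbrs G w \<inter> (L - {a}))) \<le> (\<Sum>w\<in>nbrs G a \<inter> L. real (card (nbrs G w \<inter> L)))"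
      proof (rule sum_mono)
        fix w
        have "sum y (nbrs G w \<inter> (L - {a})) \<le> (\<Sum>b\<in>nbrs G w \<inter> (L - {a}). 1)"
          using y01(2) L_sub by (intro sum_mono) auto
        also have "\<dots> \<le> (\<Sum>b\<in>nbrs G w \<inter> L. 1)" using finite_nbrs by (intro sum_mono2) auto
        finally show "sum y (nbrs G w \<inter> (L - {a})) \<le> real (card (nbrs G w \<inter> L))" by simp
      qed
      also have "\<dots> \<le> (\<Sum>w\<in>L. real (card (nbrs G w \<inter> L)))" using finite_L by (intro sum_mono2) auto
      also have "\<dots> = real (card (arcs_in G L L))" using sum_deg L_sub by blast
      also have "\<dots> \<le> 6 * real (card L)" using planar_arcs_le[OF planar L_sub] by linarith
      finally show ?thesis using card_L by simp
    qed
    moreover have "(\<Sum>w\<in>nbrs G a - L. sum y (nbrs G w \<inter> (L - {a}))) = (\<Sum>b\<in>L - {a}. c a b * y b)"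
    proof -
      have "(\<Sum>w\<in>nbrs G a - L. sum y (nbrs G w \<inter> (L - {a}))) =
          (\<Sum>w\<in>nbrs G a - L. \<Sum>b\<in>L - {a}. if b \<in> nbrs G w then y b else 0)"
      proof (rule sum.cong[OF refl])
        fix w
        show "sum y (nbrs G w \<inter> (L - {a})) = (\<Sum>b\<in>L - {a}. if b \<in> nbrs G w then y b else 0)"
          using sum.inter_restrict[of "L - {a}" y "nbrs G w"] finite_L by (simp add: Int_commute)
      qed
      also have "\<dots> = (\<Sum>b\<in>L - {a}. \<Sum>w\<in>nbrs G a - L. if b \<in> nbrs G w then y b else 0)" by (rule sum.swap)
      also have "\<dots> = (\<Sum>b\<in>L - {a}. c a b * y b)"
      proof (intro sum.cong refl)
        fix b
        have "(\<Sum>w\<in>nbrs G a - L. if b \<in> nbrs G w then y b else 0) = (\<Sum>w\<in>nbrs G a - L. if w \<in> nbrs G b then y b else 0)"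
          using nbrs_sym by (intro sum.cong refl) auto
        also have "\<dots> = sum (\<lambda>_. y b) ((nbrs G a - L) \<inter> nbrs G b)"
          using sum.inter_restrict[of "nbrs G a - L" "\<lambda>_. y b" "nbrs G b"] finite_nbrs by simp
        finally show "(\<Sum>w\<in>nbrs G a - L. if b \<in> nbrs G w then y b else 0) = c a b * y b"
          unfolding c_def by (simp add: Int_commute)
      qed
      finally show ?thesis .
    qed
    ultimately show ?thesis by linarith
  qed
  finally show ?thesis by (simp add: algebra_simps)
qed

text \<open>For a vertex \<open>u\<close> of weight 1 the main term must be almost \<open>N\<close>,
  while \<open>sum_c\<close> allows only about \<open>N\<close> walks in it; hence some other vertex
  has weight almost 1. Both then have degree close to \<open>N\<close>, and inclusion-exclusion
  counts their common neighbours.\<close>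

lemma two_hubs:
  obtains u v where "u \<in> V" "v \<in> V" "u \<noteq> v" "y u = 1" "y v \<ge> 998 / 1000"
    "real (card (nbrs G u \<inter> nbrs G v)) \<ge> 9965 / 10000 * N"
proof -
  obtain u where u: "u \<in> V" "y u = 1" using y1 by blast
  define du where "du = real (card (nbrs G u))"
  have degle: "real (card (nbrs G a)) \<le> N" for a
    unfolding N_def using nbrs_subset pair_finite_verts by (simp add: card_mono)
  define cy where "cy a = (\<Sum>b\<in>L - {a}. c a b * y b)" for a
  have cy_le: "cy a \<le> real (card (nbrs G a)) + N / 5000 + 2" if "a \<in> V" for a
  proof -
    have "cy a \<le> (\<Sum>b\<in>L - {a}. c a b * 1)"
      unfolding cy_def c_def using y01(2) L_sub by (intro sum_mono mult_left_mono) auto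
    then show ?thesis using sum_c[OF that] by simp
  qed
  have 1: "2 * N - 4 \<le> du + 12 / 10000 * N + cy u"
    using two_step[OF u(1)] u(2) unfolding du_def cy_def by simp
  \<comment> \<open>\<open>cy u\<close> is at most \<open>du + N / 5000 + 2\<close>, so
    \<open>du\<close> enters twice: \<open>2 * du >= 2 * N - 14 / 10000 * N - 6\<close>.\<close>
  have cu: "du \<ge> 9993 / 10000 * N - 3" using 1 cy_le[OF u(1)] unfolding du_def by linarith
  have "\<exists>v\<in>L - {u}. y v \<ge> 998 / 1000"
  proof (rule ccontr)
    assume "\<not> ?thesis"
    then have "y b \<le> 998 / 1000" if "b \<in> L - {u}" for b using that linear by blast
    then have "cy u \<le> (\<Sum>b\<in>L - {u}. c u b * (998 / 1000))"
      unfolding cy_def c_def by (intro sum_mono mult_left_mono) auto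
    also have "\<dots> = (\<Sum>b\<in>L - {u}. c u b) * (998 / 1000)" by (simp only: sum_distrib_right)
    also have "\<dots> \<le> (N + N / 5000 + 2) * (998 / 1000)"
      using sum_c[OF u(1)] degle[of u] by (intro mult_right_mono) auto
    finally have "cy u \<le> 9982 / 10000 * N + 2" using N_ge by (simp add: algebra_simps)
    then show False using 1 degle[of u] N_ge unfolding du_def by linarith
  qed
  then obtain v where v: "v \<in> L" "v \<noteq> u" "y v \<ge> 998 / 1000" by blast
  have vV: "v \<in> V" using v L_sub by auto
  define dv where "dv = real (card (nbrs G v))"
  have "(2 * N - 4) * (998 / 1000) \<le> (2 * N - 4) * y v"
    using v(3) N_big by (intro mult_left_mono) auto
  also have "\<dots> \<le> dv * y v + 12 / 10000 * N + cy v"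
    using two_step[OF vV] unfolding dv_def cy_def .
  finally have "1996 / 1000 * N - 4 \<le> dv * y v + 12 / 10000 * N + cy v" by (simp add: algebra_simps)
  moreover have "dv * y v \<le> dv" using y01(2)[OF vV] unfolding dv_def by (simp add: mult_left_le)
  ultimately have dv: "dv \<ge> 9973 / 10000 * N - 3"
    using cy_le[OF vV] unfolding dv_def by linarith
  have "card (nbrs G u) + card (nbrs G v) = card (nbrs G u \<union> nbrs G v) + card (nbrs G u \<inter> nbrs G v)"
    using finite_nbrs card_Un_Int by blast
  moreover have "card (nbrs G u \<union> nbrs G v) \<le> card V"
    using nbrs_subset pair_finite_verts by (intro card_mono) auto
  ultimately have "du + dv \<le> N + real (card (nbrs G u \<inter> nbrs G v))"
    unfolding du_def dv_def N_def by linarith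
  then have "real (card (nbrs G u \<inter> nbrs G v)) \<ge> 9965 / 10000 * N"
    using cu dv N_ge by linarith
  then show ?thesis using that u v vV by blast
qed

text \<open>A vertex off the hubs has at most two neighbours in \<open>D\<close>, and a vertex of
  the small set \<open>R\<close> is adjacent to at most one hub. With \<open>M\<close> the largest
  weight off the hubs this gives \<open>r * sum y R <= 9 * card R\<close> and
  \<open>r * M <= 4 + sum y R\<close>. So \<open>r^2 * M\<close> is at most
  \<open>4 * r + 9 * card R\<close>, well below \<open>r^2 / 10\<close>.\<close>

lemma small_elsewhere:
  assumes uv: "u \<in> V" "v \<in> V" "u \<noteq> v" and D: "real (card (nbrs G u \<inter> nbrs G v)) \<ge> 9965 / 10000 * N"
    and z: "z \<in> V - {u, v}"
  shows "y z \<le> 1 / 10"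
proof -
  define D where "D = nbrs G u \<inter> nbrs G v"
  define R where "R = V - {u, v} - D"
  define W where "W = V - {u, v}"
  have uvD: "u \<notin> D" "v \<notin> D" using pair_no_loops[of "(u, u)"] pair_no_loops[of "(v, v)"]
    unfolding D_def nbrs_def by auto
  have DV: "D \<subseteq> V" using nbrs_subset unfolding D_def by auto
  have WDR: "W = D \<union> R" "D \<inter> R = {}" using DV uvD unfolding W_def R_def by auto
  have fin: "finite D" "finite R" "finite W"
    using finite_subset[OF DV pair_finite_verts] pair_finite_verts unfolding R_def W_def by auto
  have "card R \<le> card (V - D)" unfolding R_def using pair_finite_verts by (intro card_mono) auto
  also have "\<dots> = card V - card D" using DV fin by (simp add: card_Diff_subset)
  finally have R_small: "real (card R) \<le> 35 / 10000 * N"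
    using D card_mono[OF pair_finite_verts DV] unfolding D_def[symmetric] N_def by linarith
  define M where "M = Max (y ` W)"
  have zW: "z \<in> W" using z W_def by simp
  have M: "y w \<le> M" if "w \<in> W" for w unfolding M_def using that fin by simp
  have "M \<in> y ` W" unfolding M_def using zW fin by (intro Max_in) auto
  then obtain m where m: "m \<in> W" "y m = M" by auto
  have M01: "0 \<le> M" "M \<le> 1" using m y01 unfolding W_def by auto
  have sumD: "sum y (nbrs G w \<inter> D) \<le> 2 * M" if "w \<in> W" for w
  proof -
    have "card (nbrs G w \<inter> D) \<le> 2"
      unfolding D_def using planar_common_nbrs[OF planar, of u v w] uv that unfolding W_def by auto
    then have "real (card (nbrs G w \<inter> D)) * M \<le> 2 * M" using M01 by (intro mult_right_mono) auto
    moreover have "sum y (nbrs G w \<inter> D) \<le> (\<Sum>b\<in>nbrs G w \<inter> D. M)"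
      using M WDR by (intro sum_mono) auto
    ultimately show ?thesis by simp
  qed
  have split: "sum y (nbrs G w) = sum y (nbrs G w \<inter> {u, v}) + sum y (nbrs G w \<inter> D) + sum y (nbrs G w \<inter> R)" for w
  proof -
    have "nbrs G w = nbrs G w \<inter> {u, v} \<union> nbrs G w \<inter> D \<union> nbrs G w \<inter> R"
      using nbrs_subset[of w] unfolding R_def by auto
    also have "sum y \<dots> = sum y (nbrs G w \<inter> {u, v} \<union> nbrs G w \<inter> D) + sum y (nbrs G w \<inter> R)"
      by (rule sum.union_disjoint) (auto simp: finite_nbrs R_def)
    also have "sum y (nbrs G w \<inter> {u, v} \<union> nbrs G w \<inter> D) = sum y (nbrs G w \<inter> {u, v}) + sum y (nbrs G w \<inter> D)"
      using uvD by (intro sum.union_disjoint) (auto simp: finite_nbrs)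
    finally show ?thesis .
  qed
  have one: "sum y (nbrs G w \<inter> {u, v}) \<le> 1" if "w \<in> R" for w
  proof -
    have "\<not> (u \<in> nbrs G w \<and> v \<in> nbrs G w)" using that nbrs_sym unfolding R_def D_def by auto
    then have "nbrs G w \<inter> {u, v} \<subseteq> {u} \<or> nbrs G w \<inter> {u, v} \<subseteq> {v}" by auto
    then show ?thesis using sum_mono2[of "{u}" "nbrs G w \<inter> {u, v}" y] sum_mono2[of "{v}" "nbrs G w \<inter> {u, v}" y]
      y01 uv by fastforce
  qed
  have "r * sum y R = (\<Sum>w\<in>R. r * y w)" by (simp add: sum_distrib_left)
  also have "\<dots> \<le> (\<Sum>w\<in>R. sum y (nbrs G w))" using sub unfolding R_def by (intro sum_mono) auto
  also have "\<dots> \<le> (\<Sum>w\<in>R. (1 + 2 * M) + real (card (nbrs G w \<inter> R)) * M)"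
  proof (rule sum_mono)
    fix w assume w: "w \<in> R"
    then have "w \<in> W" using WDR by auto
    have "sum y (nbrs G w \<inter> R) \<le> (\<Sum>b\<in>nbrs G w \<inter> R. M)" using M WDR by (intro sum_mono) auto
    then show "sum y (nbrs G w) \<le> (1 + 2 * M) + real (card (nbrs G w \<inter> R)) * M"
      unfolding split using one[OF w] sumD[OF \<open>w \<in> W\<close>] by simp
  qed
  also have "\<dots> = real (card R) * (1 + 2 * M) + real (card (arcs_in G R R)) * M"
  proof -
    have "R \<subseteq> V" unfolding R_def by auto
    then show ?thesis using sum_deg[of R R] by (simp add: sum.distrib sum_distrib_right[symmetric])
  qed
  also have "\<dots> \<le> real (card R) * 3 + 6 * real (card R)"
  proof -
    have "real (card (arcs_in G R R)) * M \<le> real (card (arcs_in G R R)) * 1"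
      using M01 by (intro mult_left_mono) auto
    moreover have "card (arcs_in G R R) \<le> 6 * card R" using planar_arcs_le[OF planar, of R] unfolding R_def by auto
    moreover have "real (card R) * (1 + 2 * M) \<le> real (card R) * 3" using M01 by (intro mult_left_mono) auto
    ultimately show ?thesis by linarith
  qed
  finally have rR: "r * sum y R \<le> 9 * (35 / 10000 * N)" using R_small by linarith
  have "r * M \<le> sum y (nbrs G m)" using sub[of m] m unfolding W_def by auto
  also have "\<dots> \<le> 2 + 2 * M + sum y R"
  proof -
    have "sum y (nbrs G m \<inter> {u, v}) \<le> sum y {u, v}" using y01 by (intro sum_mono2) auto
    also have "\<dots> \<le> 2" using uv y01(2)[OF uv(1)] y01(2)[OF uv(2)] by simp
    finally have "sum y (nbrs G m \<inter> {u, v}) \<le> 2" .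
    moreover have "sum y (nbrs G m \<inter> R) \<le> sum y R" using y01 fin by (intro sum_mono2) auto
    ultimately show ?thesis unfolding split using sumD[OF m(1)] by linarith
  qed
  also have "\<dots> \<le> 4 + sum y R" using M01 by simp
  finally have "r * (r * M) \<le> r * (4 + sum y R)" using r(1) by (intro mult_left_mono) auto
  then have rM: "r\<^sup>2 * M \<le> 4 * r + 9 * (35 / 10000 * N)"
    using rR by (simp add: power2_eq_square algebra_simps)
  have "r * (6 * 10 ^ 8) \<le> r * r" using r_big r(1) by (intro mult_left_mono) auto
  then have r4: "4 * r \<le> r\<^sup>2 * (1 / 100)" using r(1) by (simp add: power2_eq_square)
  have "M \<le> 1 / 10"
  proof (rule ccontr)
    assume "\<not> ?thesis"
    then have "r\<^sup>2 * (1 / 10) \<le> r\<^sup>2 * M" by (intro mult_left_mono) auto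
    then have "r\<^sup>2 * (9 / 100) \<le> 9 * (35 / 10000 * N)" using rM r4 zero_le_power2[of r] by linarith
    then show False using r(2) N_ge unfolding N_def[symmetric] by linarith
  qed
  then show ?thesis using M[OF zW] by linarith
qed


text \<open>Balance per unit of weight in \<open>R\<close>: the missing hub edge gains at least
  998/1000, counted in both directions. Lost are at most 2 * 2/10 on edges to \<open>D\<close>, of
  which K_{3,3} allows two per vertex, and 12/10 inside \<open>R\<close>. The remainder 396/1000
  exceeds the claimed 3/10.\<close>

lemma replace_by_hub_edges:
  assumes uv: "u \<in> V" "v \<in> V" "u \<noteq> v" "y u \<ge> 998 / 1000" "y v \<ge> 998 / 1000"
    and D: "D = nbrs G u \<inter> nbrs G v" "R = V - {u, v} - D"
    and small: "\<And>z. z \<in> V - {u, v} \<Longrightarrow> y z \<le> 1 / 10"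
    and G': "pair_graph G'" "pverts G' = V"
      "\<And>a b. a \<in> {u, v} \<Longrightarrow> b \<in> V - {u, v} \<Longrightarrow> (a, b) \<in> parcs G'"
      "\<And>a b. a \<in> D \<Longrightarrow> b \<in> D \<Longrightarrow> (a, b) \<in> parcs G \<Longrightarrow> (a, b) \<in> parcs G'"
      "(u, v) \<in> parcs G \<Longrightarrow> (u, v) \<in> parcs G'"
  shows "qform G y + 3 / 10 * sum y R + (if (u, v) \<in> parcs G' \<and> (u, v) \<notin> parcs G then y u * y v else 0) \<le> qform G' y"
proof -
  interpret G': pair_graph G' by fact
  define A where "A = {u, v}"
  define W where "W = V - A"
  have uvD: "u \<notin> D" "v \<notin> D" using pair_no_loops[of "(u, u)"] pair_no_loops[of "(v, v)"]
    unfolding D nbrs_def by auto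
  have DV: "D \<subseteq> V" using nbrs_subset unfolding D by auto
  have WDR: "W = D \<union> R" "D \<inter> R = {}" using DV uvD unfolding W_def D(2) A_def by auto
  have VAW: "V = A \<union> W" "A \<inter> W = {}" using uv unfolding W_def A_def by auto
  have fin: "finite A" "finite D" "finite R" "finite W"
    using finite_subset[OF DV pair_finite_verts] pair_finite_verts unfolding D(2) W_def A_def by auto
  have y0: "\<And>a. 0 \<le> y a" using y01 by simp
  have expand: "qform H y = block H y A A + 2 * block H y W A + block H y D D + 2 * block H y R D + block H y R R"
    if H: "pair_graph H" "pverts H = V" for H :: "'a pair_pre_digraph"
  proof -
    interpret H: pair_graph H by fact
    have "qform H y = block H y V V" using H.qform_block H(2) by simp
    also have "\<dots> = block H y A A + block H y A W + (block H y W A + block H y W W)"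
      unfolding VAW(1) using fin VAW(2) by (simp add: block_Un_left block_Un_right)
    also have "block H y W W = block H y D D + block H y D R + (block H y R D + block H y R R)"
      unfolding WDR(1) using fin WDR(2) by (simp add: block_Un_left block_Un_right)
    finally show ?thesis using H.block_sym[of y A W] H.block_sym[of y D R] by simp
  qed
  have sumA: "sum y A = y u + y v" using uv unfolding A_def by simp
  have bW: "block G' y W A = (\<Sum>w\<in>W. y w * (y u + y v))"
  proof -
    have "nbrs G' w \<inter> A = A" if "w \<in> W" for w
      using that G'(3) G'.parcs_sym unfolding A_def W_def nbrs_def by auto
    then show ?thesis unfolding block_alt[OF fin(1)] using sumA by simp
  qed
  have bA: "block G y A A + 2 * (if (u, v) \<in> parcs G' \<and> (u, v) \<notin> parcs G then y u * y v else 0) \<le> block G' y A A"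
  proof -
    have b: "block H y A A = 2 * (if (u, v) \<in> parcs H then y u * y v else 0)"
      if "pair_graph H" for H :: "'a pair_pre_digraph"
    proof -
      interpret H: pair_graph H by fact
      have "(u, u) \<notin> parcs H" "(v, v) \<notin> parcs H"
        using H.pair_no_loops[of "(u, u)"] H.pair_no_loops[of "(v, v)"] by auto
      moreover have "(v, u) \<in> parcs H \<longleftrightarrow> (u, v) \<in> parcs H" using H.parcs_sym by blast
      ultimately show ?thesis using uv unfolding block_def A_def by (simp add: mult.commute)
    qed
    show ?thesis unfolding b[OF pair_graph_axioms] b[OF G'(1)] using G'(5) y0[of u] y0[of v] by auto
  qed
  have bD: "block G y D D \<le> block G' y D D"
    unfolding block_def using G'(4) y0 by (intro sum_mono) auto
  have bRD: "block G y R D \<le> (\<Sum>w\<in>R. y w * (2 / 10))"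
    unfolding block_alt[OF fin(2)]
  proof (intro sum_mono mult_left_mono y0)
    fix w assume w: "w \<in> R"
    have "card (nbrs G w \<inter> D) \<le> 2"
      unfolding D by (rule planar_common_nbrs[OF planar]) (use uv w D(2) in auto)
    moreover have "sum y (nbrs G w \<inter> D) \<le> (\<Sum>b\<in>nbrs G w \<inter> D. 1 / 10)"
      using small DV uvD by (intro sum_mono) auto
    ultimately show "sum y (nbrs G w \<inter> D) \<le> 2 / 10" by simp
  qed
  have bRR: "block G y R R \<le> 12 * (1 / 10) * sum y R"
    by (rule planar_block_le[OF planar y0]) (use small D(2) in auto)
  have bWA: "block G y W A + 998 / 1000 * sum y R \<le> block G' y W A"
  proof -
    have "block G y W A = (\<Sum>w\<in>D. y w * sum y (nbrs G w \<inter> A)) + (\<Sum>w\<in>R. y w * sum y (nbrs G w \<inter> A))"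
      unfolding block_alt[OF fin(1)] WDR(1) using fin WDR(2) by (simp add: sum.union_disjoint)
    also have "\<dots> \<le> (\<Sum>w\<in>D. y w * (y u + y v)) + (\<Sum>w\<in>R. y w * (y u + y v - 998 / 1000))"
    proof (intro add_mono sum_mono mult_left_mono y0)
      fix w
      show "sum y (nbrs G w \<inter> A) \<le> y u + y v"
        unfolding sumA[symmetric] using y0 fin by (intro sum_mono2) auto
      assume w: "w \<in> R"
      have "\<not> (u \<in> nbrs G w \<and> v \<in> nbrs G w)" using w nbrs_sym unfolding D by auto
      then have "nbrs G w \<inter> A \<subseteq> {u} \<or> nbrs G w \<inter> A \<subseteq> {v}" unfolding A_def by auto
      then have "sum y (nbrs G w \<inter> A) \<le> y u \<or> sum y (nbrs G w \<inter> A) \<le> y v"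
        using sum_mono2[of "{u}" "nbrs G w \<inter> A" y] sum_mono2[of "{v}" "nbrs G w \<inter> A" y] y0 by fastforce
      then show "sum y (nbrs G w \<inter> A) \<le> y u + y v - 998 / 1000" using uv(4,5) by linarith
    qed
    also have "(\<Sum>w\<in>R. y w * (y u + y v - 998 / 1000)) = (\<Sum>w\<in>R. y w * (y u + y v)) - sum y R * (998 / 1000)"
      by (simp only: right_diff_distrib sum_subtractf sum_distrib_right)
    also have "(\<Sum>w\<in>D. y w * (y u + y v)) + ((\<Sum>w\<in>R. y w * (y u + y v)) - sum y R * (998 / 1000))
        = block G' y W A - sum y R * (998 / 1000)"
      unfolding bW unfolding WDR(1) using fin WDR(2) by (subst sum.union_disjoint) auto
    finally show ?thesis by simp
  qed
  have "sum y R \<ge> 0" using y0 by (simp add: sum_nonneg)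
  moreover have "(\<Sum>w\<in>R. y w * (2 / 10)) = sum y R * (2 / 10)" by (simp only: sum_distrib_right)
  moreover have "block G' y R D \<ge> 0" "block G' y R R \<ge> 0" using y0 by (auto intro: block_nonneg)
  moreover have "(if (u, v) \<in> parcs G' \<and> (u, v) \<notin> parcs G then y u * y v else 0) \<ge> 0" using y0 by simp
  ultimately show ?thesis
    unfolding expand[OF pair_graph_axioms refl] expand[OF G'(1,2)]
    using bWA bRR bRD bD bA by linarith
qed

end

text \<open>Edges among common neighbours of the hubs survive, because they carry the path
  structure; a vertex outside becomes a path with a single vertex. The flag \<open>s\<close> stands
  for the edge between the hubs, present for long cycles and absent for triangles.\<close>

definition hub_graph :: "'a pair_pre_digraph \<Rightarrow> 'a \<Rightarrow> 'a \<Rightarrow> bool \<Rightarrow> 'a pair_pre_digraph" where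
  "hub_graph G u v s = \<lparr> pverts = pverts G,
     parcs = {u, v} \<times> (pverts G - {u, v}) \<union> (pverts G - {u, v}) \<times> {u, v}
       \<union> arcs_in G (nbrs G u \<inter> nbrs G v) (nbrs G u \<inter> nbrs G v)
       \<union> (if s then {(u, v), (v, u)} else {}) \<rparr>"

lemma pair_graph_hub_graph:
  assumes "pair_graph G" "u \<in> pverts G" "v \<in> pverts G" "u \<noteq> v"
  shows "pair_graph (hub_graph G u v s)"
proof -
  interpret pair_graph G by fact
  have "(a, a) \<notin> parcs G" for a using pair_no_loops[of "(a, a)"] by auto
  then show ?thesis
    using assms(2-4) in_arcsD1 in_arcsD2 pair_finite_verts
    by (intro pair_graphI_simple)
       (auto simp: hub_graph_def arcs_in_def intro: parcs_sym split: if_splits)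
qed

context large_subsolution
begin

text \<open>
  Every supersolution of the hub graph forces equality throughout the comparison of quadratic
  forms, so no edge was moved.
\<close>

lemma hub_graph_eq:
  assumes uv: "u \<in> V" "v \<in> V" "u \<noteq> v" "y u \<ge> 998 / 1000" "y v \<ge> 998 / 1000"
    and small: "\<And>z. z \<in> V - {u, v} \<Longrightarrow> y z \<le> 1 / 10"
    and s: "(u, v) \<in> parcs G \<Longrightarrow> s"
    and z: "\<And>a. a \<in> V \<Longrightarrow> z a > 0"
      "\<And>a. a \<in> V \<Longrightarrow> sum z (nbrs (hub_graph G u v s) a) \<le> r * z a"
  shows "parcs G = parcs (hub_graph G u v s)" "sum z (nbrs (hub_graph G u v s) u) = r * z u"
proof -
  define D where "D = nbrs G u \<inter> nbrs G v"
  define R where "R = V - {u, v} - D"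
  define G' where "G' = hub_graph G u v s"
  have pg: "pair_graph G'" unfolding G'_def using pair_graph_hub_graph[OF pair_graph_axioms uv(1-3)] .
  interpret G': pair_graph G' by fact
  have pv: "pverts G' = V" unfolding G'_def hub_graph_def by simp
  have uvG': "(u, v) \<in> parcs G' \<longleftrightarrow> s"
  proof -
    have "u \<notin> nbrs G u" unfolding nbrs_def using pair_no_loops[of "(u, u)"] by auto
    then show ?thesis unfolding G'_def hub_graph_def arcs_in_def using uv(3) by auto
  qed
  have le: "qform G y + 3 / 10 * sum y R + (if (u, v) \<in> parcs G' \<and> (u, v) \<notin> parcs G then y u * y v else 0) \<le> qform G' y"
    by (rule replace_by_hub_edges[OF uv D_def R_def small pg pv])
      (use s in \<open>auto simp: G'_def hub_graph_def arcs_in_def D_def\<close>)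
  define Y where "Y = (\<Sum>a\<in>V. (y a)\<^sup>2)"
  have lo: "r * Y \<le> qform G y" unfolding Y_def using qform_ge[of y r] y01 sub by blast
  note sup = G'.qform_supersolution[of z r, unfolded pv, OF z(1) z(2)[folded G'_def]]
  have hi: "qform G' y \<le> r * Y" unfolding Y_def by (rule sup(1))
  have y0: "\<And>a. 0 \<le> y a" using y01 by simp
  have R0: "sum y R \<ge> 0" using y0 by (simp add: sum_nonneg)
  have U0: "y u * y v > 0" using uv by (intro mult_pos_pos) auto
  have eq: "qform G' y = r * (\<Sum>a\<in>V. (y a)\<^sup>2)" "sum y R = 0"
    using le lo hi R0 U0 unfolding Y_def by (auto split: if_splits)
  have flag: "(u, v) \<in> parcs G' \<Longrightarrow> (u, v) \<in> parcs G"
    using le lo hi R0 U0 by (auto split: if_splits)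
  \<comment> \<open>\<open>y\<close> is only known to be nonnegative. Proportionality to
    \<open>z\<close> along the arc from \<open>u\<close> to \<open>a\<close> makes it positive, and
    then \<open>sum y R = 0\<close> leaves no room for \<open>R\<close>.\<close>
  have pos: "y a > 0" if a: "a \<in> V - {u, v}" for a
  proof -
    have "(u, a) \<in> parcs G'" using a unfolding G'_def hub_graph_def by simp
    then have "y u * z a = y a * z u" using sup(2)[OF _ _ eq(1)] by simp
    moreover have "y u * z a > 0" using uv z a by (intro mult_pos_pos) auto
    ultimately have "y a \<noteq> 0" by auto
    then show ?thesis using y0[of a] by linarith
  qed
  have "R = {}"
  proof (rule ccontr)
    assume "R \<noteq> {}"
    moreover have "finite R" unfolding R_def using pair_finite_verts by auto
    ultimately have "sum y R > 0" using pos unfolding R_def by (intro sum_pos) auto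
    then show False using eq(2) by simp
  qed
  then have W: "V - {u, v} \<subseteq> D" unfolding R_def by auto
  show "sum z (nbrs (hub_graph G u v s) u) = r * z u"
    using sup(3)[OF _ _ eq(1) uv(1)] uv(4) unfolding G'_def by simp
  have uvD: "D \<subseteq> V - {u, v}"
    using pair_no_loops[of "(u, u)"] pair_no_loops[of "(v, v)"] nbrs_subset unfolding D_def nbrs_def by auto
  have "(a, b) \<in> parcs G \<longleftrightarrow> (a, b) \<in> parcs G'" for a b
  proof (cases "a \<in> V \<and> b \<in> V")
    case False
    then show ?thesis using in_arcsD1 in_arcsD2 G'.in_arcsD1 G'.in_arcsD2 pv by metis
  next
    case True
    have nl: "(c, c) \<notin> parcs G" "(c, c) \<notin> parcs G'" for c
      using pair_no_loops[of "(c, c)"] G'.pair_no_loops[of "(c, c)"] by auto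
    have uvs: "(u, v) \<in> parcs G \<longleftrightarrow> (u, v) \<in> parcs G'" using flag s uvG' by auto
    then have vus: "(v, u) \<in> parcs G \<longleftrightarrow> (v, u) \<in> parcs G'" using parcs_sym G'.parcs_sym by blast
    have hub: "(c, d) \<in> parcs G \<and> (c, d) \<in> parcs G' \<and> (d, c) \<in> parcs G \<and> (d, c) \<in> parcs G'"
      if "c \<in> {u, v}" "d \<in> V - {u, v}" for c d
    proof -
      have "(c, d) \<in> parcs G" using W that unfolding D_def nbrs_def by auto
      moreover have "(c, d) \<in> parcs G'" using that unfolding G'_def hub_graph_def by auto
      ultimately show ?thesis using parcs_sym G'.parcs_sym by blast
    qed
    show ?thesis
    proof (cases "a \<in> {u, v}")
      case a: True
      show ?thesis
      proof (cases "b \<in> {u, v}")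
        case b: True
        then show ?thesis using a nl uvs vus by auto
      next
        case False
        then show ?thesis using hub[OF a] True by auto
      qed
    next
      case a: False
      show ?thesis
      proof (cases "b \<in> {u, v}")
        case b: True
        then show ?thesis using hub[OF b, of a] True a by auto
      next
        case b: False
        have "a \<in> D" "b \<in> D" using W a b True by auto
        then show ?thesis using a b unfolding G'_def hub_graph_def arcs_in_def D_def by auto
      qed
    qed
  qed
  then show "parcs G = parcs (hub_graph G u v s)" unfolding G'_def by auto
qed

end

lemma planar_large_radius:
  assumes G: "planar_graph G" and big: "real (card (pverts G)) \<ge> 2 * 10 ^ 17"
    and rad: "\<rho> G \<ge> r" "r > 0" "r\<^sup>2 \<ge> 2 * real (card (pverts G)) - 4"
  obtains y u v where "large_subsolution G y r" "u \<in> pverts G" "v \<in> pverts G" "u \<noteq> v"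
    "y u \<ge> 998 / 1000" "y v \<ge> 998 / 1000" "\<And>z. z \<in> pverts G - {u, v} \<Longrightarrow> y z \<le> 1 / 10"
    "real (card (nbrs G u \<inter> nbrs G v)) \<ge> 9965 / 10000 * real (card (pverts G))"
proof -
  interpret pair_graph G using G unfolding planar_graph_def by blast
  have ne: "pverts G \<noteq> {}" using big by auto
  obtain x where x: "\<And>a. x a \<ge> 0" "\<exists>a\<in>pverts G. x a > 0"
    "\<And>a. a \<in> pverts G \<Longrightarrow> \<rho> G * x a \<le> sum x (nbrs G a)"
    using spectral_radius_subsolution[OF ne] by blast
  define M where "M = Max (x ` pverts G)"
  have M: "x a \<le> M" if "a \<in> pverts G" for a unfolding M_def using that pair_finite_verts by simp
  have "M \<in> x ` pverts G" unfolding M_def using ne pair_finite_verts by (intro Max_in) auto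
  then obtain m where m: "m \<in> pverts G" "x m = M" by auto
  have M0: "M > 0" using x(2) M by force
  define y where "y a = x a / M" for a
  have "large_subsolution G y r"
  proof unfold_locales
    show "y a \<ge> 0" for a using x M0 unfolding y_def by simp
    show "y a \<le> 1" if "a \<in> pverts G" for a using M[OF that] M0 unfolding y_def by simp
    show "\<exists>a\<in>pverts G. y a = 1" using m M0 unfolding y_def by (intro bexI[of _ m]) auto
    fix a assume a: "a \<in> pverts G"
    have "r * x a \<le> \<rho> G * x a" using rad(1) x(1) by (intro mult_right_mono) auto
    also have "\<dots> \<le> sum x (nbrs G a)" using x(3)[OF a] .
    finally have "r * x a / M \<le> sum x (nbrs G a) / M" using M0 by (simp add: divide_right_mono)
    then show "r * y a \<le> sum y (nbrs G a)" unfolding y_def by (simp add: sum_divide_distrib)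
  qed (use G big rad in auto)
  then interpret large_subsolution G y r .
  obtain u v where uv: "u \<in> V" "v \<in> V" "u \<noteq> v" "y u = 1" "y v \<ge> 998 / 1000"
    "real (card (nbrs G u \<inter> nbrs G v)) \<ge> 9965 / 10000 * N" using two_hubs by blast
  show ?thesis
    using that[OF large_subsolution_axioms uv(1-3)] uv(4-6) small_elsewhere[OF uv(1-3,6)]
    unfolding N_def by auto
qed

section \<open>Paths: resolvent and optimal partition into paths\<close>

definition path_weight :: "real \<Rightarrow> nat \<Rightarrow> nat \<Rightarrow> real" where
  "path_weight t m j = (1 - (t ^ j + t ^ (m + 1 - j)) / (1 + t ^ (m + 1))) / (t + 1 / t - 2)"

text \<open>
  The solution \<open>x\<close> of \<open>(t + 1/t) x\<^sub>j = 1 + x\<^sub>j\<^sub>-\<^sub>1 + x\<^sub>j\<^sub>+\<^sub>1\<close> on a path with \<open>m\<close> vertices. Positions run from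
  \<open>1\<close> to \<open>m\<close>, and \<open>x\<close> vanishes at the phantom positions \<open>0\<close> and \<open>m + 1\<close>.
\<close>

definition path_defect :: "real \<Rightarrow> nat \<Rightarrow> real" where
  "path_defect t m = (t - t ^ (m + 1)) / (1 + t ^ (m + 1))"

lemma denominator_pos: "0 < t \<Longrightarrow> t < 1 \<Longrightarrow> t + 1 / t - 2 > (0::real)"
proof -
  assume t: "0 < t" "t < 1"
  have "t + 1 / t - 2 = (1 - t)\<^sup>2 / t" using t by (simp add: field_simps power2_eq_square)
  then show ?thesis using t by simp
qed

lemma path_weight_ends:
  assumes "0 < t" "t < 1"
  shows "path_weight t m 0 = 0" "path_weight t m (m + 1) = 0"
proof -
  have "1 + t * t ^ m > 0" using assms by (simp add: add_pos_pos)
  then show "path_weight t m 0 = 0" "path_weight t m (m + 1) = 0"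
    unfolding path_weight_def by (simp_all add: add.commute)
qed

text \<open>Both \<open>t ^ j\<close> and \<open>t ^ (m + 1 - j)\<close> solve the homogeneous
  recurrence, and the constant \<open>1 / (t + 1 / t - 2)\<close> is a particular solution; the
  coefficient is fixed by the zeros at the phantom positions.\<close>

lemma path_weight_rec:
  assumes t: "0 < t" "t < 1" and j: "1 \<le> j" "j \<le> m"
  shows "(t + 1 / t) * path_weight t m j = 1 + path_weight t m (j - 1) + path_weight t m (j + 1)"
proof -
  define a where "a = t ^ (j - 1)"
  define b where "b = t ^ (m - j)"
  define d where "d = 1 + t ^ (m + 1)"
  define q where "q = t + 1 / t - 2"
  have d: "d \<noteq> 0" using t unfolding d_def by (smt (verit) zero_less_power)
  have q: "q \<noteq> 0" using denominator_pos[OF t] unfolding q_def by simp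
  have e: "t ^ j = t * a" "t ^ (j + 1) = t * t * a" "t ^ (j - 1) = a"
    using j unfolding a_def by (cases j; simp)+
  have f: "t ^ (m + 1 - j) = t * b" "t ^ (m + 1 - (j + 1)) = b" "t ^ (m + 1 - (j - 1)) = t * t * b"
  proof -
    have "m + 1 - j = Suc (m - j)" "m + 1 - (j + 1) = m - j" "m + 1 - (j - 1) = Suc (Suc (m - j))"
      using j by auto
    then show "t ^ (m + 1 - j) = t * b" "t ^ (m + 1 - (j + 1)) = b" "t ^ (m + 1 - (j - 1)) = t * t * b"
      unfolding b_def by simp_all
  qed
  have pw: "path_weight t m j = (1 - (t * a + t * b) / d) / q"
    "path_weight t m (j - 1) = (1 - (a + t * t * b) / d) / q"
    "path_weight t m (j + 1) = (1 - (t * t * a + b) / d) / q"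
    unfolding path_weight_def e f d_def q_def by simp_all
  have tt: "t + 1 / t = q + 2" unfolding q_def by simp
  have lin: "(a + t * t * b) + (t * t * a + b) = (q + 2) * (t * a + t * b)"
    using t unfolding q_def by (simp add: field_simps)
  have "q * ((q + 2) * path_weight t m j) = (q + 2) * (1 - (t * a + t * b) / d)"
    unfolding pw using q by simp
  also have "\<dots> = q + (1 - (a + t * t * b) / d) + (1 - (t * t * a + b) / d)"
  proof -
    have "(q + 2) * ((t * a + t * b) / d) = (a + t * t * b) / d + (t * t * a + b) / d"
      unfolding add_divide_distrib[symmetric] lin by simp
    then show ?thesis by (simp add: algebra_simps)
  qed
  also have "\<dots> = q * (1 + path_weight t m (j - 1) + path_weight t m (j + 1))"
    unfolding pw using q by (simp add: distrib_left)
  finally show ?thesis unfolding tt using q by simp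
qed

lemma path_weight_pos:
  assumes t: "0 < t" "t < 1" and j: "1 \<le> j" "j \<le> m"
  shows "path_weight t m j > 0"
proof -
  have p: "t ^ j < 1" "t ^ (m + 1 - j) < 1" using t j by (auto simp: power_Suc_less_one power_less_one_iff)
  have "t ^ j * t ^ (m + 1 - j) = t ^ (m + 1)" using j by (simp flip: power_add)
  moreover have "(1 - t ^ j) * (1 - t ^ (m + 1 - j)) > 0" using p by simp
  ultimately have "t ^ j + t ^ (m + 1 - j) < 1 + t ^ (m + 1)" by (simp add: algebra_simps)
  moreover have "1 + t ^ (m + 1) > 0" using t by (smt (verit) zero_less_power)
  ultimately have "1 - (t ^ j + t ^ (m + 1 - j)) / (1 + t ^ (m + 1)) > 0" by simp
  then show ?thesis unfolding path_weight_def using denominator_pos[OF t] by (rule divide_pos_pos)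
qed

text \<open>The constant solution alone would give \<open>m / (t + 1 / t - 2)\<close>. What the two
  ends of the path take away is a geometric sum from either end, collected in
  \<open>path_defect\<close>.\<close>

lemma path_weight_sum:
  assumes t: "0 < t" "t < 1"
  shows "(\<Sum>j=1..m. path_weight t m j) = (real m - 2 * path_defect t m / (1 - t)) / (t + 1 / t - 2)"
proof -
  have geo: "(\<Sum>j=1..m. t ^ j) = (t - t ^ (m + 1)) / (1 - t)"
  proof (induction m)
    case (Suc m)
    have "(\<Sum>j=1..Suc m. t ^ j) = (t - t ^ (m + 1)) / (1 - t) + t ^ (m + 1)" using Suc by simp
    also have "\<dots> = (t - t ^ (Suc m + 1)) / (1 - t)" using t by (simp add: field_simps)
    finally show ?case .
  qed simp
  have rev: "(\<Sum>j=1..m. t ^ (m + 1 - j)) = (\<Sum>j=1..m. t ^ j)"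
    by (rule sum.reindex_bij_witness[of _ "\<lambda>j. m + 1 - j" "\<lambda>j. m + 1 - j"]) auto
  have "(\<Sum>j=1..m. path_weight t m j) =
      (real m - (\<Sum>j=1..m. t ^ j + t ^ (m + 1 - j)) / (1 + t ^ (m + 1))) / (t + 1 / t - 2)"
    unfolding path_weight_def by (simp add: sum_divide_distrib[symmetric] sum_subtractf)
  also have "(\<Sum>j=1..m. t ^ j + t ^ (m + 1 - j)) = 2 * ((t - t ^ (m + 1)) / (1 - t))"
    unfolding sum.distrib rev geo by simp
  finally show ?thesis unfolding path_defect_def by (simp add: field_simps)
qed

text \<open>Drop the neighbour terms in the recurrence. This crude bound serves to locate the root
  of the hub equation.\<close>

lemma path_weight_sum_ge:
  assumes t: "0 < t" "t < 1"
  shows "(\<Sum>j=1..m. path_weight t m j) \<ge> real m / (t + 1 / t)"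
proof -
  have nn: "path_weight t m j \<ge> 0" if "j \<le> m + 1" for j
    using path_weight_pos[OF t, of j m] path_weight_ends[OF t, of m] that
    by (cases "j = 0 \<or> j = m + 1") (auto intro: less_imp_le)
  have "1 / (t + 1 / t) \<le> path_weight t m j" if "j \<in> {1..m}" for j
  proof -
    have "1 \<le> (t + 1 / t) * path_weight t m j"
      using path_weight_rec[OF t, of j m] nn[of "j - 1"] nn[of "j + 1"] that by auto
    moreover have "t + 1 / t > 0" using t by (simp add: add_pos_pos)
    ultimately show ?thesis by (simp add: divide_le_eq mult.commute)
  qed
  then have "(\<Sum>j=1..m. 1 / (t + 1 / t)) \<le> (\<Sum>j=1..m. path_weight t m j)" by (intro sum_mono) auto
  then show ?thesis by simp
qed

section \<open>Concavity of the defect\<close>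

lemma path_defect_0: "path_defect t 0 = 0"
  unfolding path_defect_def by simp

lemma path_defect_alt:
  assumes "0 < t" shows "path_defect t m = (1 + t) / (1 + t ^ (m + 1)) - 1"
proof -
  have "1 + t ^ (m + 1) \<noteq> 0" using assms by (smt (verit) zero_less_power)
  then show ?thesis unfolding path_defect_def by (simp add: field_simps)
qed

text \<open>The increments are \<open>(1 - t\<^sup>2) y / ((1 + y) (1 + t y))\<close> with \<open>y = t\<^sup>m\<^sup>+\<^sup>1\<close>, hence decreasing in \<open>m\<close>.\<close>

lemma path_defect_concave:
  assumes t: "0 < t" "t < 1"
  shows "path_defect t (m + 2) - path_defect t (m + 1) < path_defect t (m + 1) - path_defect t m"
proof -
  define y where "y = t ^ (m + 1)"
  have y: "0 < y" "y < 1"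
    using t power_Suc_less_one[OF t, of m] unfolding y_def Suc_eq_plus1[symmetric] by simp_all
  have pos: "1 + y > 0" "1 + t * y > 0" "1 + t * (t * y) > 0" using t y by (auto intro: add_pos_pos)
  have y2: "t ^ (m + 2) = t * y" "t ^ (m + 3) = t * (t * y)" unfolding y_def by (simp_all add: numeral_eq_Suc)
  have d1: "path_defect t (m + 1) - path_defect t m = (1 + t) * (1 - t) * y / ((1 + y) * (1 + t * y))"
    unfolding path_defect_alt[OF t(1)] using pos y2 y_def
    by (simp add: numeral_eq_Suc field_simps)
  have d2: "path_defect t (m + 2) - path_defect t (m + 1) = (1 + t) * (1 - t) * (t * y) / ((1 + t * y) * (1 + t * (t * y)))"
    unfolding path_defect_alt[OF t(1)] using pos y2 y_def
    by (simp add: numeral_eq_Suc field_simps)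
  have "t * y / (1 + t * (t * y)) < y / (1 + y)"
  proof -
    have "t * y * (1 + y) < y * (1 + t * (t * y))"
    proof -
      have "t * y * y \<le> 1 * (1 * y)" using t y by (intro mult_mono) (auto simp: mult_le_one)
      have "y * (1 + t * (t * y)) - t * y * (1 + y) = y * (1 - t) * (1 - t * y)" by (simp add: algebra_simps)
      moreover have "t * y < 1" using mult_strict_mono[of t 1 y 1] t y by simp
      ultimately show ?thesis using t y by (smt (verit) mult_pos_pos)
    qed
    then show ?thesis using pos by (simp add: divide_less_eq pos_less_divide_eq mult.commute)
  qed
  then have "(1 + t) * (1 - t) / (1 + t * y) * (t * y / (1 + t * (t * y))) < (1 + t) * (1 - t) / (1 + t * y) * (y / (1 + y))"
    using t pos by (intro mult_strict_left_mono divide_pos_pos mult_pos_pos) auto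
  then show ?thesis unfolding d1 d2 by (simp add: mult_ac)
qed

lemma path_defect_increments:
  assumes t: "0 < t" "t < 1" and "m < k"
  shows "path_defect t (k + 1) - path_defect t k < path_defect t (m + 1) - path_defect t m"
  using \<open>m < k\<close>
proof (induction k)
  case (Suc k)
  then show ?case using path_defect_concave[OF t, of k] by (cases "m = k") auto
qed simp

lemma path_defect_exchange:
  assumes t: "0 < t" "t < 1" and ab: "1 \<le> b" "b \<le> a"
  shows "path_defect t (a + 1) + path_defect t (b - 1) < path_defect t a + path_defect t b"
  using path_defect_increments[OF t, of "b - 1" a] ab by (cases b) auto

text \<open>Concavity and the value 0 at 0 make \<open>path_defect t m / m\<close> nonincreasing;
  the inequality is multiplied out so as to include \<open>m = 0\<close>.\<close>

lemma path_defect_ratio: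
  assumes t: "0 < t" "t < 1" and mk: "m \<le> k"
  shows "real m * path_defect t k \<le> real k * path_defect t m"
proof -
  have inc: "path_defect t m \<ge> real m * (path_defect t (m + 1) - path_defect t m)" for m
  proof (induction m)
    case 0 then show ?case by (simp add: path_defect_0)
  next
    case (Suc m)
    have "real (Suc m) * (path_defect t (Suc m + 1) - path_defect t (Suc m)) \<le>
        real (Suc m) * (path_defect t (m + 1) - path_defect t m)"
      using path_defect_concave[OF t, of m] by (intro mult_left_mono) auto
    then show ?case using Suc by (simp add: algebra_simps)
  qed
  show ?thesis using mk
  proof (induction rule: dec_induct)
    case base then show ?case by simp
  next
    case (step k)
    have "real k * path_defect t (k + 1) \<le> real (k + 1) * path_defect t k"
      using inc[of k] by (simp add: algebra_simps)
    then have "real m * (real k * path_defect t (k + 1)) \<le> real m * (real (k + 1) * path_defect t k)"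
      by (intro mult_left_mono) auto
    also have "\<dots> \<le> real (k + 1) * (real k * path_defect t m)"
      using step by (simp add: mult.left_commute[of "real m"] mult_left_mono del: of_nat_add)
    finally have le: "real k * (real m * path_defect t (k + 1)) \<le> real k * (real (k + 1) * path_defect t m)"
      by (simp add: mult_ac)
    show ?case
    proof (cases "k = 0")
      case True
      then show ?thesis using step by (simp add: path_defect_0)
    next
      case False
      then show ?thesis using le by simp
    qed
  qed
qed

lemma path_defect_bounds:
  assumes t: "0 < t" "t < 1"
  shows "0 \<le> path_defect t m" "path_defect t m \<le> t" "path_defect t m \<ge> t - 2 * t ^ (m + 1)"
proof -
  define y where "y = t ^ (m + 1)"
  have y: "0 < y" "y \<le> t" using t power_decreasing[of 1 "m + 1" t] unfolding y_def by auto
  have eq: "path_defect t m = (t - y) / (1 + y)" unfolding path_defect_def y_def by simp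
  show "0 \<le> path_defect t m" unfolding eq using y by simp
  show "path_defect t m \<le> t" unfolding eq using y t by (simp add: divide_le_eq algebra_simps)
  have "(t - 2 * y) * (1 + y) \<le> t - y"
  proof -
    have "t * y \<le> 1 * y" using t y by (intro mult_right_mono) auto
    then have "t - y + (t * y - y) - 2 * y * y \<le> t - y" using y by (smt (verit) mult_pos_pos)
    then show ?thesis by (simp add: algebra_simps)
  qed
  then show "path_defect t m \<ge> t - 2 * t ^ (m + 1)" unfolding eq y_def[symmetric] using y by (simp add: le_divide_eq)
qed

text \<open>To be read with \<open>N = n - 2\<close> and \<open>q = l - 3\<close>. A cycle through
  both hubs can use two paths, so the sum of the two largest parts is what absence of
  \<open>C_l\<close> bounds; \<open>a\<close> is a largest part.\<close>

definition admissible :: "nat \<Rightarrow> nat \<Rightarrow> nat multiset \<Rightarrow> bool" where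
  "admissible N q M \<longleftrightarrow> sum_mset M = N \<and> 0 \<notin># M \<and>
     (\<exists>a M1. M = add_mset a M1 \<and> M1 \<noteq> {#} \<and> (\<forall>b\<in>#M1. b \<le> a \<and> a + b \<le> q))"

text \<open>The path lengths of \<open>H(q - q div 2, q div 2)\<close> on \<open>N\<close> vertices.
  Subtracting 1 before the division and adding it to the remainder keeps the last part between 1 and
  \<open>q div 2\<close>.\<close>

definition balanced_parts :: "nat \<Rightarrow> nat \<Rightarrow> nat multiset" where
  "balanced_parts N q = add_mset (q - q div 2) (add_mset ((N - 1 - (q - q div 2)) mod (q div 2) + 1)
     (replicate_mset ((N - 1 - (q - q div 2)) div (q div 2)) (q div 2)))"

lemma sum_mset_balanced:
  assumes "q \<ge> 2" "N \<ge> q + 1"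
  shows "sum_mset (balanced_parts N q) = N"
proof -
  define K where "K = q div 2"
  have "(N - 1 - (q - K)) div K * K + (N - 1 - (q - K)) mod K = N - 1 - (q - K)" by simp
  moreover have "N - 1 - (q - K) + 1 + (q - K) = N" using assms by simp
  ultimately show ?thesis
    unfolding balanced_parts_def K_def[symmetric] by (simp add: sum_mset_replicate_mset mult.commute)
qed

definition total_defect :: "real \<Rightarrow> nat multiset \<Rightarrow> real" where
  "total_defect t M = sum_mset (image_mset (path_defect t) M)"

lemma finite_admissible: "finite {M. admissible N q M}"
proof (rule finite_subset)
  show "{M. admissible N q M} \<subseteq> mset ` {xs. set xs \<subseteq> {..N} \<and> length xs \<le> N}"
  proof
    fix M assume "M \<in> {M. admissible N q M}"
    then have M: "sum_mset M = N" "0 \<notin># M" unfolding admissible_def by auto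
    obtain xs where xs: "mset xs = M" using ex_mset by blast
    have sl: "sum_list xs = N" using M(1) xs by (simp flip: sum_mset_sum_list)
    have "0 \<notin> set xs" using M(2) xs by auto
    then have "length xs \<le> sum_list xs"
      by (induction xs) (auto simp: Suc_le_eq)
    moreover have "x \<le> N" if "x \<in> set xs" for x using member_le_sum_list[OF that] sl by simp
    ultimately show "M \<in> mset ` {xs. set xs \<subseteq> {..N} \<and> length xs \<le> N}" using xs sl by auto
  qed
  show "finite (mset ` {xs. set xs \<subseteq> {..N} \<and> length xs \<le> N})"
    by (intro finite_imageI finite_lists_length_le) auto
qed


text \<open>A part that shrinks to 0 disappears; since \<open>path_defect t 0 = 0\<close>, this does
  not disturb the total defect.\<close>

definition move_unit :: "nat \<Rightarrow> nat \<Rightarrow> nat multiset \<Rightarrow> nat multiset" where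
  "move_unit x y M = add_mset (x + 1) (M + (if y = 1 then {#} else {#y - 1#}))"

lemma total_defect_add: "total_defect t (add_mset x M) = path_defect t x + total_defect t M"
  "total_defect t (M + M') = total_defect t M + total_defect t M'"
  unfolding total_defect_def by simp_all

lemma move_unit:
  assumes "1 \<le> y" "y \<le> x"
  shows "sum_mset (move_unit x y M) = sum_mset (add_mset x (add_mset y M))"
    and "0 \<notin># M \<Longrightarrow> 0 \<notin># move_unit x y M"
    and "0 < t \<Longrightarrow> t < 1 \<Longrightarrow> total_defect t (move_unit x y M) < total_defect t (add_mset x (add_mset y M))"
proof -
  show "sum_mset (move_unit x y M) = sum_mset (add_mset x (add_mset y M))"
    "0 \<notin># M \<Longrightarrow> 0 \<notin># move_unit x y M"
    using assms unfolding move_unit_def by auto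
  assume t: "0 < t" "t < 1"
  have "total_defect t (move_unit x y M) = path_defect t (x + 1) + path_defect t (y - 1) + total_defect t M"
    unfolding move_unit_def total_defect_add by (auto simp: total_defect_def path_defect_0)
  then show "total_defect t (move_unit x y M) < total_defect t (add_mset x (add_mset y M))"
    unfolding total_defect_add using path_defect_exchange[OF t assms] by simp
qed

lemma total_defect_nonneg: "0 < t \<Longrightarrow> t < 1 \<Longrightarrow> total_defect t M \<ge> 0"
  by (induction M) (auto simp: total_defect_add path_defect_bounds(1), simp add: total_defect_def)

lemma balanced_admissible:
  assumes q: "q \<ge> 2" and N: "N \<ge> q + 1"
  shows "admissible N q (balanced_parts N q)"
proof -
  define K where "K = q div 2"
  define M1 where "M1 = add_mset ((N - 1 - (q - K)) mod K + 1) (replicate_mset ((N - 1 - (q - K)) div K) K)"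
  have K: "K \<ge> 1" "2 * K \<le> q" using q unfolding K_def by auto
  have B: "balanced_parts N q = add_mset (q - K) M1" unfolding balanced_parts_def M1_def K_def ..
  have "(N - 1 - (q - K)) mod K + 1 \<le> K" using K(1) by (simp add: Suc_leI)
  then have "b \<le> K" if "b \<in># M1" for b using that unfolding M1_def by (auto split: if_splits)
  then have "\<forall>b\<in>#M1. b \<le> q - K \<and> (q - K) + b \<le> q" using K(2) by fastforce
  moreover have "M1 \<noteq> {#}" unfolding M1_def by simp
  moreover have "0 \<notin># balanced_parts N q" unfolding B M1_def using K by auto
  ultimately show ?thesis unfolding admissible_def using sum_mset_balanced[OF q N] B by blast
qed

text \<open>An exchange lengthens the longer of two parts, so it cannot raise the second largest
  part \<open>k\<close> towards \<open>K = q div 2\<close> at the expense of the largest. The case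
  \<open>k < K\<close> is excluded globally: too many short paths pay for their ends, and here
  \<open>N > 8 * K^2\<close> enters. Once a part of size \<open>K\<close> is present next to
  \<open>a\<close>, exchanges settle the rest.\<close>

lemma minimizer_balanced:
  assumes t: "0 < t" "t \<le> 1 / 8" and q: "q \<ge> 2" and N: "N \<ge> q + 1" "N > 8 * (q div 2)\<^sup>2"
    and M: "admissible N q M" and min: "\<And>M'. admissible N q M' \<Longrightarrow> total_defect t M \<le> total_defect t M'"
  shows "M = balanced_parts N q"
proof -
  define K where "K = q div 2"
  have K: "K \<ge> 1" "2 * K \<le> q" "q \<le> 2 * K + 1" using q unfolding K_def by auto
  have t1: "t < 1" using t by simp
  note g = path_defect_bounds[OF t(1) t1]
  obtain a M1 where a: "M = add_mset a M1" "M1 \<noteq> {#}" "\<And>b. b \<in># M1 \<Longrightarrow> b \<le> a \<and> a + b \<le> q"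
    and M0: "sum_mset M = N" "0 \<notin># M" using M unfolding admissible_def by blast
  define k where "k = Max (set_mset M1)"
  have k: "k \<in># M1" "\<And>b. b \<in># M1 \<Longrightarrow> b \<le> k" using a(2) unfolding k_def by auto
  have kK: "k \<le> K" using a(3)[OF k(1)] K by linarith
  have k1: "k \<ge> 1" using M0(2) k(1) a(1) by (cases k) auto
  have "k = K"
  proof (rule ccontr)
    assume "k \<noteq> K"
    then have kl: "k \<le> K - 1" "K \<ge> 2" using kK k1 by auto
    define G1 where "G1 = path_defect t (K - 1)"
    \<comment> \<open>A part of size at most \<open>K - 1\<close> pays per vertex at least as much
      as a path with \<open>K - 1\<close> vertices.\<close>
    have each: "real b * G1 \<le> real (K - 1) * path_defect t b" if "b \<in># M1" for b
      unfolding G1_def using path_defect_ratio[OF t(1) t1, of b "K - 1"] k(2)[OF that] kl by simp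
    have "real (sum_mset M1) * G1 \<le> real (K - 1) * total_defect t M1"
      using each unfolding total_defect_def
      by (induction M1) (auto simp: algebra_simps add_mono)
    moreover have "sum_mset M1 = N - a" "a \<le> 2 * K" using M0(1) a(1) a(3)[OF k(1)] k1 K by auto
    then have "real N - 2 * K \<le> real (sum_mset M1)" by linarith
    ultimately have lower: "(real N - 2 * K) * G1 \<le> real (K - 1) * total_defect t M1"
      using g(1)[of "K - 1"] unfolding G1_def by (meson mult_right_mono order_trans)
    define \<alpha> where "\<alpha> = (N - 1 - (q - K)) div K"
    have \<alpha>: "\<alpha> * K \<le> N" unfolding \<alpha>_def using div_times_less_eq_dividend[of "N - 1 - (q - K)" K] by linarith
    have rm: "total_defect t (replicate_mset n x) = real n * path_defect t x" for n x
      unfolding total_defect_def by simp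
    have "total_defect t (balanced_parts N q) \<le> 2 * t + real \<alpha> * path_defect t K"
      unfolding balanced_parts_def K_def[symmetric] total_defect_add rm \<alpha>_def[symmetric]
      using g(2)[of "q - K"] g(2)[of "(N - 1 - (q - K)) mod K + 1"] by simp
    moreover have "total_defect t M1 \<le> total_defect t M" unfolding a(1) total_defect_add using g(1) by simp
    ultimately have up: "total_defect t M1 \<le> 2 * t + real \<alpha> * path_defect t K"
      using min[OF balanced_admissible[OF q N(1)]] by linarith
    have "real K * ((real N - 2 * K) * G1) \<le> real K * (real (K - 1) * (2 * t + real \<alpha> * path_defect t K))"
    proof (rule mult_left_mono)
      have "real (K - 1) * total_defect t M1 \<le> real (K - 1) * (2 * t + real \<alpha> * path_defect t K)"
        using up by (intro mult_left_mono) auto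
      then show "(real N - 2 * K) * G1 \<le> real (K - 1) * (2 * t + real \<alpha> * path_defect t K)"
        using lower by linarith
    qed simp
    also have "\<dots> = real (K - 1) * (2 * t * K + real (\<alpha> * K) * path_defect t K)" by (simp add: algebra_simps)
    also have "\<dots> \<le> real (K - 1) * (2 * t * K + real N * t)"
    proof (intro mult_left_mono add_left_mono)
      show "real (\<alpha> * K) * path_defect t K \<le> real N * t"
        using \<alpha> g(1,2) by (intro mult_mono) (auto simp del: of_nat_mult)
    qed auto
    finally have main: "real K * ((real N - 2 * K) * G1) \<le> (real K - 1) * (2 * t * K + real N * t)"
      using kl by (simp add: of_nat_diff)
    \<comment> \<open>With this, \<open>K * G1\<close> falls short of \<open>K * t\<close> by at
      most \<open>t / 2\<close>, where \<open>t\<close> is the limit of the defect for long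
      paths.\<close>
    have pow: "real K * t ^ (K - 1) \<le> 1 / 4"
    proof -
      have "K \<le> 2 ^ (K - 1)" using kl(2) by (induction K rule: dec_induct) (auto simp: numeral_eq_Suc power_eq_if)
      then have "real K \<le> 2 ^ (K - 1)" by (metis of_nat_le_iff of_nat_numeral of_nat_power)
      then have "real K * t ^ (K - 1) \<le> 2 ^ (K - 1) * t ^ (K - 1)" using t by (intro mult_right_mono) auto
      also have "\<dots> = (2 * t) ^ (K - 1)" by (simp add: power_mult_distrib)
      also have "\<dots> \<le> (1 / 4) ^ (K - 1)" using t by (intro power_mono) auto
      also have "\<dots> \<le> (1 / 4) ^ 1" using kl(2) by (intro power_decreasing) auto
      finally show ?thesis by simp
    qed
    have G1lo: "real K * G1 \<ge> real K * t - t / 2"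
    proof -
      have "G1 \<ge> t - 2 * t ^ K" using g(3)[of "K - 1"] kl(2) unfolding G1_def by simp
      then have "real K * G1 \<ge> real K * (t - 2 * t ^ K)" by (intro mult_left_mono) auto
      moreover have "t ^ K = t * t ^ (K - 1)" using kl(2) by (cases K) auto
      then have "real K * t ^ K = t * (real K * t ^ (K - 1))" by simp
      then have "real K * t ^ K \<le> t * (1 / 4)" using pow t by (metis less_imp_le mult_left_mono)
      ultimately show ?thesis by (simp add: algebra_simps)
    qed
    have N2: "real N - 2 * K \<ge> 0" "real N > 8 * (real K)\<^sup>2"
    proof -
      show "real N > 8 * (real K)\<^sup>2" using N(2) unfolding K_def[symmetric]
        by (metis of_nat_less_iff of_nat_mult of_nat_numeral of_nat_power)
      show "real N - 2 * K \<ge> 0" using N(1) K by linarith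
    qed
    have "(real N - 2 * K) * (real K * t - t / 2) \<le> (real N - 2 * K) * (real K * G1)"
      using G1lo N2 by (intro mult_left_mono) auto
    then have "(real N - 2 * K) * (real K * t - t / 2) \<le> (real K - 1) * (2 * t * K + real N * t)"
      using main by (simp add: mult_ac)
    then have "t * ((real N - 2 * K) * (real K - 1 / 2)) \<le> t * ((real K - 1) * (2 * K + real N))"
      by (simp add: algebra_simps)
    then have "(real N - 2 * K) * (real K - 1 / 2) \<le> (real K - 1) * (2 * K + real N)"
      using t(1) by simp
    then have "real N / 2 \<le> 4 * (real K)\<^sup>2 - real K" by (simp add: algebra_simps power2_eq_square)
    then show False using N2 kl by linarith
  qed
  have M1: "b \<le> K" "b \<ge> 1" if "b \<in># M1" for b
    using k(2)[OF that] \<open>k = K\<close> M0(2) a(1) that by (auto simp: Suc_le_eq intro: gr0I)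
  have noimp: False if "admissible N q M'" "total_defect t M' < total_defect t M" for M'
    using min[OF that(1)] that(2) by simp
  obtain M2 where M2: "M1 = add_mset K M2" using k(1) \<open>k = K\<close> by (metis multi_member_split)
  have aK: "a + K \<le> q" "K \<le> a" using a(3)[OF k(1)] \<open>k = K\<close> by auto
  \<comment> \<open>Otherwise a vertex of a third part could move to the largest part without
    violating the bound on \<open>a + K\<close>.\<close>
  have "a = q - K"
  proof (rule ccontr)
    assume "a \<noteq> q - K"
    then have al: "a + 1 + K \<le> q" using aK by linarith
    have "M2 \<noteq> {#}" using M0(1) N(1) aK(1) unfolding a(1) M2 by auto
    then obtain b M3 where b: "M2 = add_mset b M3" by (metis multiset_cases)
    have b1: "1 \<le> b" "b \<le> a" using M1[of b] M2 b aK by auto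
    define M' where "M' = move_unit a b (add_mset K M3)"
    have Meq: "M = add_mset a (add_mset b (add_mset K M3))" unfolding a(1) M2 b by simp
    have "admissible N q M'" unfolding admissible_def
    proof (intro conjI exI)
      show "sum_mset M' = N" "0 \<notin># M'"
        using move_unit(1,2)[OF b1, of "add_mset K M3"] M0 Meq unfolding M'_def by auto
      show "M' = add_mset (a + 1) (add_mset K M3 + (if b = 1 then {#} else {#b - 1#}))"
        unfolding M'_def move_unit_def ..
      have "x \<le> K" if "x \<in># add_mset K M3 + (if b = 1 then {#} else {#b - 1#})" for x
      proof -
        have "b \<le> K" "\<And>z. z \<in># M3 \<Longrightarrow> z \<le> K" using M1(1) unfolding M2 b by auto
        then show ?thesis using that by (auto split: if_splits)
      qed
      then show "\<forall>x\<in>#add_mset K M3 + (if b = 1 then {#} else {#b - 1#}). x \<le> a + 1 \<and> a + 1 + x \<le> q"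
        using al aK by force
    qed auto
    then show False using noimp move_unit(3)[OF b1 t(1) t1, of "add_mset K M3"] Meq M'_def by auto
  qed
  \<comment> \<open>The same for two parts other than \<open>a\<close>: the larger of them must
    already be \<open>K\<close>, so all of them but a smallest one are.\<close>
  have full: "x = K" if xy: "M1 = add_mset x (add_mset y M3)" "y \<le> x" for x y M3
  proof (rule ccontr)
    assume "x \<noteq> K"
    then have x: "x < K" "1 \<le> y" using M1(1)[of x] M1(2)[of y] xy by auto
    define M' where "M' = move_unit x y (add_mset a M3)"
    have Meq: "M = add_mset x (add_mset y (add_mset a M3))" unfolding a(1) xy by simp
    have "admissible N q M'" unfolding admissible_def
    proof (intro conjI exI)
      show "sum_mset M' = N" "0 \<notin># M'"
        using move_unit(1,2)[OF x(2) xy(2), of "add_mset a M3"] M0 Meq unfolding M'_def by auto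
      show "M' = add_mset a (add_mset (x + 1) (M3 + (if y = 1 then {#} else {#y - 1#})))"
        unfolding M'_def move_unit_def by simp
      have "z \<le> K" if "z \<in># add_mset (x + 1) (M3 + (if y = 1 then {#} else {#y - 1#}))" for z
      proof -
        have "y \<le> K" "\<And>z. z \<in># M3 \<Longrightarrow> z \<le> K" using M1(1) unfolding xy(1) by auto
        then show ?thesis using that x by (auto split: if_splits)
      qed
      then show "\<forall>z\<in>#add_mset (x + 1) (M3 + (if y = 1 then {#} else {#y - 1#})). z \<le> a \<and> a + z \<le> q"
        using aK by force
    qed auto
    then show False using noimp move_unit(3)[OF x(2) xy(2) t(1) t1, of "add_mset a M3"] Meq M'_def by auto
  qed
  define b where "b = Min (set_mset M1)"
  have b: "b \<in># M1" "\<And>x. x \<in># M1 \<Longrightarrow> b \<le> x" using a(2) unfolding b_def by auto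
  obtain M4 where M4: "M1 = add_mset b M4" using b(1) by (metis multi_member_split)
  have "x = K" if x: "x \<in># M4" for x
  proof -
    obtain M5 where M5: "M4 = add_mset x M5" using x by (metis multi_member_split)
    have "M1 = add_mset x (add_mset b M5)" unfolding M4 M5 by simp
    then show ?thesis using full[of x b M5] b(2)[of x] by auto
  qed
  then have rep: "M4 = replicate_mset (size M4) K"
    by (induction M4) auto
  define j where "j = size M4"
  have "N = (q - K) + b + j * K"
    using M0(1) \<open>a = q - K\<close> rep unfolding a(1) M4 j_def by (metis (no_types, lifting) sum_mset.add_mset
        sum_mset_replicate_mset add.assoc mult.commute of_nat_id)
  moreover have bK: "1 \<le> b" "b \<le> K" using M1 b(1) by auto
  \<comment> \<open>Division with remainder: \<open>b - 1\<close> is the remainder because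
    \<open>b\<close> lies between 1 and \<open>K\<close>.\<close>
  ultimately have eq: "N - 1 - (q - K) = (b - 1) + j * K" by linarith
  have "b - 1 < K" using bK by linarith
  then have "(N - 1 - (q - K)) mod K = b - 1" "(N - 1 - (q - K)) div K = j"
    unfolding eq by simp_all
  then show ?thesis unfolding balanced_parts_def K_def[symmetric] a(1) M4 \<open>a = q - K\<close>
    using rep bK unfolding j_def by simp
qed

theorem optimal_partition:
  assumes t: "0 < t" "t \<le> 1 / 8" and q: "q \<ge> 2" and N: "N \<ge> q + 1" "N > 8 * (q div 2)\<^sup>2"
    and M: "admissible N q M"
  shows "total_defect t (balanced_parts N q) \<le> total_defect t M"
    and "total_defect t (balanced_parts N q) = total_defect t M \<Longrightarrow> M = balanced_parts N q"
proof -
  define M0 where "M0 = arg_min_on (total_defect t) {M. admissible N q M}"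
  have ne: "{M. admissible N q M} \<noteq> {}" using M by auto
  have "M0 \<in> {M. admissible N q M}" unfolding M0_def using arg_min_if_finite(1)[OF finite_admissible ne] .
  moreover have min: "total_defect t M0 \<le> total_defect t M'" if "admissible N q M'" for M'
    unfolding M0_def using arg_min_least[OF finite_admissible ne, of M'] that by simp
  ultimately have M0: "M0 = balanced_parts N q"
    using minimizer_balanced[OF t q N, of M0] by auto
  show "total_defect t (balanced_parts N q) \<le> total_defect t M" using min[OF M] M0 by simp
  show "M = balanced_parts N q" if "total_defect t (balanced_parts N q) = total_defect t M"
    using minimizer_balanced[OF t q N M] min M0 that by simp
qed

section \<open>Linear forests as lists of lists\<close>

definition succ_in :: "'a list \<Rightarrow> 'a \<Rightarrow> 'a \<Rightarrow> bool" where
  "succ_in xs a b \<longleftrightarrow> (\<exists>i. Suc i < length xs \<and> xs ! i = a \<and> xs ! Suc i = b)"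

definition linked :: "'a list list \<Rightarrow> 'a \<Rightarrow> 'a \<Rightarrow> bool" where
  "linked xss a b \<longleftrightarrow> (\<exists>xs\<in>set xss. succ_in xs a b \<or> succ_in xs b a)"

text \<open>A list is a path in one of its two directions, and the nonempty lists are the
  components. Path lengths, segments of paths and positions along the forest then become list
  operations.\<close>

definition path_forest :: "('a \<Rightarrow> 'a \<Rightarrow> bool) \<Rightarrow> 'a set \<Rightarrow> 'a list list \<Rightarrow> bool" where
  "path_forest R W xss \<longleftrightarrow> distinct (concat xss) \<and> [] \<notin> set xss \<and> set (concat xss) = W \<and>
     (\<forall>a\<in>W. \<forall>b\<in>W. R a b \<longleftrightarrow> linked xss a b)"

lemma linked_sym: "linked xss a b \<longleftrightarrow> linked xss b a"
  unfolding linked_def by auto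

lemma succ_in_set: "succ_in xs a b \<Longrightarrow> a \<in> set xs \<and> b \<in> set xs"
  unfolding succ_in_def by (auto simp: Suc_lessD)

lemma succ_in_Cons: "succ_in (x # xs) a b \<longleftrightarrow> xs \<noteq> [] \<and> a = x \<and> b = hd xs \<or> succ_in xs a b"
proof
  assume "succ_in (x # xs) a b"
  then obtain i where i: "Suc i < length (x # xs)" "(x # xs) ! i = a" "(x # xs) ! Suc i = b"
    unfolding succ_in_def by blast
  show "xs \<noteq> [] \<and> a = x \<and> b = hd xs \<or> succ_in xs a b"
    using i unfolding succ_in_def by (cases i) (auto simp: hd_conv_nth)
next
  assume "xs \<noteq> [] \<and> a = x \<and> b = hd xs \<or> succ_in xs a b"
  then show "succ_in (x # xs) a b"
  proof
    assume "xs \<noteq> [] \<and> a = x \<and> b = hd xs"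
    then show ?thesis unfolding succ_in_def by (intro exI[of _ 0]) (auto simp: hd_conv_nth)
  next
    assume "succ_in xs a b"
    then obtain i where "Suc i < length xs" "xs ! i = a" "xs ! Suc i = b" unfolding succ_in_def by blast
    then show ?thesis unfolding succ_in_def by (intro exI[of _ "Suc i"]) auto
  qed
qed

lemma succ_in_snoc: "succ_in (xs @ [x]) a b \<longleftrightarrow> xs \<noteq> [] \<and> a = last xs \<and> b = x \<or> succ_in xs a b"
proof (induction xs)
  case Nil then show ?case by (simp add: succ_in_def)
next
  case (Cons y xs)
  then show ?case by (cases xs) (auto simp: succ_in_Cons succ_in_def[of "[]"])
qed

lemma linked_append: "linked (xss @ yss) a b \<longleftrightarrow> linked xss a b \<or> linked yss a b"
  unfolding linked_def by auto

lemma linked_Cons: "linked (xs # xss) a b \<longleftrightarrow> succ_in xs a b \<or> succ_in xs b a \<or> linked xss a b"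
  unfolding linked_def by auto

lemma linked_in: "linked xss a b \<Longrightarrow> a \<in> set (concat xss) \<and> b \<in> set (concat xss)"
  unfolding linked_def using succ_in_set by fastforce

lemma linked_same_list:
  assumes "distinct (concat xss)" "linked xss a b" "xs \<in> set xss" "a \<in> set xs"
  shows "succ_in xs a b \<or> succ_in xs b a"
proof -
  obtain ys where ys: "ys \<in> set xss" "succ_in ys a b \<or> succ_in ys b a" using assms(2) unfolding linked_def by blast
  then have "a \<in> set ys" using succ_in_set by fast
  then have "xs = ys" using assms ys(1)
    by (metis IntI distinct_concat_iff empty_iff)
  then show ?thesis using ys by simp
qed

lemma linked_nth:
  assumes "distinct (concat xss)" "xs \<in> set xss" "i < length xs"
  shows "linked xss (xs ! i) b \<longleftrightarrow> 0 < i \<and> b = xs ! (i - 1) \<or> Suc i < length xs \<and> b = xs ! Suc i"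
proof
  have dx: "distinct xs" using assms by (simp add: distinct_concat_iff)
  assume "linked xss (xs ! i) b"
  then have "succ_in xs (xs ! i) b \<or> succ_in xs b (xs ! i)" using linked_same_list[OF assms(1)] assms by auto
  then show "0 < i \<and> b = xs ! (i - 1) \<or> Suc i < length xs \<and> b = xs ! Suc i"
  proof
    assume "succ_in xs (xs ! i) b"
    then obtain k where "Suc k < length xs" "xs ! k = xs ! i" "xs ! Suc k = b" unfolding succ_in_def by blast
    then show ?thesis using dx assms(3) by (auto simp: nth_eq_iff_index_eq)
  next
    assume "succ_in xs b (xs ! i)"
    then obtain k where "Suc k < length xs" "xs ! k = b" "xs ! Suc k = xs ! i" unfolding succ_in_def by blast
    then show ?thesis using dx assms(3) by (auto simp: nth_eq_iff_index_eq)
  qed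
next
  assume "0 < i \<and> b = xs ! (i - 1) \<or> Suc i < length xs \<and> b = xs ! Suc i"
  then have "succ_in xs b (xs ! i) \<or> succ_in xs (xs ! i) b"
  proof
    assume "0 < i \<and> b = xs ! (i - 1)"
    then have "succ_in xs b (xs ! i)" using assms(3) unfolding succ_in_def by (intro exI[of _ "i - 1"]) simp
    then show ?thesis ..
  next
    assume "Suc i < length xs \<and> b = xs ! Suc i"
    then have "succ_in xs (xs ! i) b" unfolding succ_in_def by blast
    then show ?thesis ..
  qed
  then show "linked xss (xs ! i) b" using assms(2) unfolding linked_def by blast
qed

text \<open>Induction by deleting a vertex \<open>a\<close> of degree at most 1, which becomes a
  list of its own or is attached to an end of its neighbour's list. The assumption on subsets
  excludes cycles, the degree bound excludes branching.\<close>

lemma path_forest_exists: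
  assumes "finite W" and sym: "\<And>a b. R a b \<Longrightarrow> R b a" and irr: "\<And>a. \<not> R a a"
    and deg: "\<And>a. a \<in> W \<Longrightarrow> card {b\<in>W. R a b} \<le> 2"
    and core: "\<And>S. S \<subseteq> W \<Longrightarrow> S \<noteq> {} \<Longrightarrow> \<exists>a\<in>S. card {b\<in>S. R a b} \<le> 1"
  shows "\<exists>xss. path_forest R W xss"
  using assms(1) deg core
proof (induction W rule: finite_psubset_induct)
  case (psubset W)
  show ?case
  proof (cases "W = {}")
    case True
    then show ?thesis by (intro exI[of _ "[]"]) (simp add: path_forest_def)
  next
    case False
    obtain a where a: "a \<in> W" "card {b\<in>W. R a b} \<le> 1" using psubset.prems(2)[OF subset_refl False] by blast
    define W' where "W' = W - {a}"
    have W': "W' \<subset> W" "W = insert a W'" "a \<notin> W'" using a unfolding W'_def by auto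
    have "\<exists>xss. path_forest R W' xss"
    proof (rule psubset.IH[OF W'(1)])
      fix c assume c: "c \<in> W'"
      have "card {b\<in>W'. R c b} \<le> card {b\<in>W. R c b}"
        using psubset.hyps W'(1) by (intro card_mono) auto
      then show "card {b\<in>W'. R c b} \<le> 2" using psubset.prems(1)[of c] c W' by force
    next
      fix S assume "S \<subseteq> W'" "S \<noteq> {}"
      then show "\<exists>a\<in>S. card {b\<in>S. R a b} \<le> 1" using psubset.prems(2)[of S] W'(1) by blast
    qed
    then obtain xss where xss: "distinct (concat xss)" "[] \<notin> set xss" "set (concat xss) = W'"
      "\<And>c d. c \<in> W' \<Longrightarrow> d \<in> W' \<Longrightarrow> R c d \<longleftrightarrow> linked xss c d" unfolding path_forest_def by auto
    have fin: "finite {b\<in>W. R a b}" using psubset.hyps by simp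
    show ?thesis
    proof (cases "{b\<in>W. R a b} = {}")
      case True
      have "path_forest R W ([a] # xss)"
        unfolding path_forest_def
      proof (intro conjI ballI)
        show "distinct (concat ([a] # xss))" "[] \<notin> set ([a] # xss)" "set (concat ([a] # xss)) = W"
          using xss(1-3) W' by auto
        fix c d assume cd: "c \<in> W" "d \<in> W"
        have l: "linked ([a] # xss) c d \<longleftrightarrow> linked xss c d" by (simp add: linked_Cons succ_in_def)
        show "R c d \<longleftrightarrow> linked ([a] # xss) c d"
        proof (cases "c = a \<or> d = a")
          case True
          then have "\<not> R c d" using \<open>{b\<in>W. R a b} = {}\<close> cd sym by blast
          moreover have "\<not> linked xss c d" using True linked_in[of xss c d] xss(3) W'(3) by auto
          ultimately show ?thesis using l by simp
        next
          case False
          then show ?thesis using l xss(4) cd W' by auto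
        qed
      qed
      then show ?thesis by blast
    next
      case False
      then have "card {b\<in>W. R a b} \<noteq> 0" using fin by simp
      then have "card {b\<in>W. R a b} = 1" using a(2) by linarith
      then obtain b where b: "{b\<in>W. R a b} = {b}" by (rule card_1_singletonE)
      then have "b \<in> {b\<in>W. R a b}" by simp
      then have ab: "R a b" "b \<in> W'" using irr[of a] W' by auto
      obtain xs where xs: "xs \<in> set xss" "b \<in> set xs" using ab(2) xss(3) by auto
      obtain i where i: "i < length xs" "xs ! i = b" using xs(2) by (auto simp: in_set_conv_nth)
      have dx: "distinct xs" using xss(1) xs(1) by (simp add: distinct_concat_iff)
      have xsW: "set xs \<subseteq> W'" using xs(1) xss(3) by auto
      \<comment> \<open>An inner vertex of a list already has two neighbours, and \<open>a\<close>
        would be a third.\<close>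
      have "i = 0 \<or> Suc i = length xs"
      proof (rule ccontr)
        assume "\<not> ?thesis"
        then have ii: "0 < i" "Suc i < length xs" using i by auto
        have "R b (xs ! (i - 1))" "R b (xs ! Suc i)"
          using linked_nth[OF xss(1) xs(1) i(1)] ii i xss(4) ab(2) xsW by (auto simp: nth_mem subsetD)
        moreover have "xs ! (i - 1) \<noteq> xs ! Suc i" using dx ii by (simp add: nth_eq_iff_index_eq)
        moreover have "xs ! (i - 1) \<in> W'" "xs ! Suc i \<in> W'" using xsW ii by (auto simp: subsetD)
        moreover from calculation(4,5) have "xs ! (i - 1) \<noteq> a" "xs ! Suc i \<noteq> a" using W'(3) by blast+
        with calculation(3) have "card {xs ! (i - 1), xs ! Suc i, a} = 3" by simp
        moreover have "card {xs ! (i - 1), xs ! Suc i, a} \<le> card {c\<in>W. R b c}"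
          using calculation psubset.hyps ab sym W' by (intro card_mono) auto
        ultimately show False using psubset.prems(1)[of b] ab(2) W' by auto
      qed
      moreover have ne: "xs \<noteq> []" using xs(2) by auto
      ultimately have "b = hd xs \<or> b = last xs"
        using i hd_conv_nth[OF ne] last_conv_nth[OF ne] by (metis diff_Suc_1)
      moreover obtain yss zss where split: "xss = yss @ xs # zss" using xs(1) split_list by metis
      have ax: "a \<notin> set (concat xss)" using xss(3) W'(3) by simp
      have main: "path_forest R W (yss @ xs' # zss)"
        if xs': "set xs' = insert a (set xs)" "distinct xs'"
          "\<And>c d. succ_in xs' c d \<or> succ_in xs' d c \<longleftrightarrow> (c = a \<and> d = b \<or> c = b \<and> d = a) \<or> succ_in xs c d \<or> succ_in xs d c" for xs'
        unfolding path_forest_def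
      proof (intro conjI ballI)
        show "distinct (concat (yss @ xs' # zss))"
          using xss(1) ax xs' unfolding split by auto
        show "[] \<notin> set (yss @ xs' # zss)" using xss(2) xs'(1) unfolding split by auto
        show "set (concat (yss @ xs' # zss)) = W" using xss(3) xs'(1) W' unfolding split by auto
        fix c d assume cd: "c \<in> W" "d \<in> W"
        have l: "linked (yss @ xs' # zss) c d \<longleftrightarrow> (c = a \<and> d = b \<or> c = b \<and> d = a) \<or> linked xss c d"
          unfolding split linked_append linked_Cons using xs'(3)[of c d] by blast
        show "R c d \<longleftrightarrow> linked (yss @ xs' # zss) c d"
        proof (cases "c = a \<or> d = a")
          case True
          have "R a x \<longleftrightarrow> x = b" if "x \<in> W" for x using b that by auto
          then have "R c d \<longleftrightarrow> (c = a \<and> d = b \<or> c = b \<and> d = a)" using True cd sym irr by metis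
          moreover have "\<not> linked xss c d" using True linked_in[of xss c d] ax by auto
          ultimately show ?thesis using l by simp
        next
          case False
          then show ?thesis using l xss(4) cd W' by auto
        qed
      qed
      have axs: "a \<notin> set xs" using xsW W'(3) by auto
      show ?thesis
      proof (cases "b = hd xs")
        case True
        have "path_forest R W (yss @ (a # xs) # zss)"
          by (rule main) (use axs dx ne True in \<open>auto simp: succ_in_Cons\<close>)
        then show ?thesis by blast
      next
        case False
        then have "b = last xs" using calculation by simp
        then have "path_forest R W (yss @ (xs @ [a]) # zss)"
          by (intro main) (use axs dx ne in \<open>auto simp: succ_in_snoc\<close>)
        then show ?thesis by blast
      qed
    qed
  qed
qed

section \<open>Joins of linear forests with two hubs\<close>

text \<open>One predicate for \<open>K_2 + H\<close>, for K_{2,m} (\<open>s\<close> false and all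
  lists of length 1), for hub graphs and for an unknown extremal graph, whose hubs and lists use its
  own vertex type. The flag \<open>s\<close> tells whether the hubs are adjacent.\<close>

definition joined :: "bool \<Rightarrow> 'a pair_pre_digraph \<Rightarrow> 'a \<Rightarrow> 'a \<Rightarrow> 'a list list \<Rightarrow> bool" where
  "joined s G u v xss \<longleftrightarrow> u \<noteq> v \<and> u \<notin> set (concat xss) \<and> v \<notin> set (concat xss) \<and>
     distinct (concat xss) \<and> [] \<notin> set xss \<and> pverts G = {u, v} \<union> set (concat xss) \<and>
     parcs G = {u, v} \<times> set (concat xss) \<union> set (concat xss) \<times> {u, v} \<union>
       {(a, b). linked xss a b} \<union> (if s then {(u, v), (v, u)} else {})"

lemma joined_mset:
  assumes "joined s G u v xss" "mset xss = mset yss"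
  shows "joined s G u v yss"
proof -
  have s: "set xss = set yss" using assms(2) mset_eq_setD by blast
  have "mset (concat zss) = \<Sum>\<^sub># (image_mset mset (mset zss))" for zss :: "'a list list"
    by (induction zss) auto
  then have "mset (concat xss) = mset (concat yss)" using assms(2) by simp
  then have "distinct (concat yss) \<longleftrightarrow> distinct (concat xss)" using mset_eq_imp_distinct_iff by metis
  moreover have "linked yss = linked xss" unfolding linked_def using s by simp
  ultimately show ?thesis using assms(1) s unfolding joined_def by simp
qed

lemma pair_graph_iso:
  fixes h :: "'a \<Rightarrow> 'b"
  assumes "pair_graph G" "inj_on h (pverts G)" "pverts H = h ` pverts G"
    "parcs H = (\<lambda>(a, b). (h a, h b)) ` parcs G"
  shows "digraph_iso (with_proj G) (with_proj H)"
proof -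
  interpret pair_graph G by fact
  define f where "f = \<lparr> iso_verts = h, iso_arcs = (\<lambda>(a, b). (h a, h b)), iso_head = snd, iso_tail = fst \<rparr>"
  have "pre_digraph.digraph_isomorphism (with_proj G) f"
    unfolding pre_digraph.digraph_isomorphism_def
  proof (intro conjI ballI)
    show "wf_digraph (with_proj G)" by (rule wf_digraph)
    show "inj_on (iso_verts f) (verts (with_proj G))" using assms(2) unfolding f_def by simp
    show "inj_on (iso_arcs f) (arcs (with_proj G))"
      using assms(2) in_arcsD1 in_arcsD2 unfolding f_def by (auto simp: inj_on_def)
  qed (auto simp: f_def)
  moreover have "with_proj H = app_iso f (with_proj G)"
    using assms(3,4) unfolding app_iso_def f_def with_proj_def by simp
  ultimately show ?thesis unfolding digraph_iso_def by blast
qed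

lemma pair_graph_joined:
  assumes "joined s G u v xss" shows "pair_graph G"
proof (rule pair_graphI_simple)
  show "finite (pverts G)" using assms unfolding joined_def by simp
  have ls: "a \<in> set (concat xss) \<and> b \<in> set (concat xss)" if "linked xss a b" for a b using linked_in[OF that] .
  define W where "W = set (concat xss)"
  have "pverts G = {u, v} \<union> W" and pG: "parcs G = {u, v} \<times> W \<union> W \<times> {u, v} \<union>
       {(a, b). linked xss a b} \<union> (if s then {(u, v), (v, u)} else {})"
    using assms unfolding joined_def W_def by auto
  moreover have "(if s then {(u, v), (v, u)} else {}) \<subseteq> {u, v} \<times> {u, v}" by auto
  moreover have "{(a, b). linked xss a b} \<subseteq> W \<times> W" using ls unfolding W_def by auto
  ultimately show "parcs G \<subseteq> pverts G \<times> pverts G"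
    unfolding pG by (intro Un_least) (blast, blast, (rule subset_trans, assumption, blast)+)
  show "(b, a) \<in> parcs G" if "(a, b) \<in> parcs G" for a b
    using that linked_sym[of xss a b] unfolding pG by (auto split: if_splits)
  show "(a, a) \<notin> parcs G" for a
  proof
    assume "(a, a) \<in> parcs G"
    moreover have "u \<notin> W" "v \<notin> W" "u \<noteq> v" using assms unfolding joined_def W_def by auto
    ultimately have "linked xss a a" unfolding pG by (auto split: if_splits)
    then obtain xs i where "xs \<in> set xss" "Suc i < length xs" "xs ! i = a" "xs ! Suc i = a"
      unfolding linked_def succ_in_def by auto
    moreover have "distinct (concat xss)" using assms unfolding joined_def by simp
    ultimately show False by (metis Suc_lessD distinct_concat_iff n_not_Suc_n nth_eq_iff_index_eq)
  qed
qed

lemma map_exists: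
  assumes "distinct xs" "length xs = length ys"
  shows "\<exists>f. map f xs = ys"
proof (intro exI nth_equalityI)
  show "length (map (the \<circ> map_of (zip xs ys)) xs) = length ys" using assms by simp
  fix i assume "i < length (map (the \<circ> map_of (zip xs ys)) xs)"
  then show "map (the \<circ> map_of (zip xs ys)) xs ! i = ys ! i"
    using assms map_of_zip_nth[OF assms(2,1), of i] by simp
qed

text \<open>Sort the lists of both graphs by length; reading the two concatenations in parallel then
  matches each path with a path of the same length.\<close>

lemma joined_iso:
  assumes G: "joined s G u v xss" and H: "joined s H u' v' yss"
    and len: "mset (map length xss) = mset (map length yss)"
  shows "digraph_iso (with_proj G) (with_proj H)"
proof -
  define as where "as = sort_key length xss"
  define bs where "bs = sort_key length yss"
  have G': "joined s G u v as" using joined_mset[OF G] unfolding as_def by simp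
  have H': "joined s H u' v' bs" using joined_mset[OF H] unfolding bs_def by simp
  have "mset (map length as) = mset (map length bs)" using len unfolding as_def bs_def by simp
  moreover have "sorted (map length as)" "sorted (map length bs)" unfolding as_def bs_def by simp_all
  ultimately have lens: "map length as = map length bs"
    by (metis properties_for_sort)
  have dist: "distinct (concat as)" "distinct (concat bs)" using G' H' unfolding joined_def by auto
  have "length (concat as) = length (concat bs)" using lens by (simp add: length_concat)
  then obtain f where f: "map f (concat as) = concat bs" using map_exists[OF dist(1)] by blast
  have ll: "length as = length bs" using lens by (metis length_map)
  have "map (map f) as = bs"
  proof (rule concat_injective)
    show "concat (map (map f) as) = concat bs" using f by (simp add: map_concat)
    show "length (map (map f) as) = length bs" using ll by simp
    show "\<forall>(x, y)\<in>set (zip (map (map f) as) bs). length x = length y"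
      using lens ll by (auto simp: set_zip) (metis nth_map)
  qed
  then have bs: "bs = map (map f) as" by simp
  have inj: "inj_on f (set (concat as))" using dist(2) f by (metis distinct_map)
  define h where "h = f(u := u', v := v')"
  have uv: "u \<noteq> v" "u \<notin> set (concat as)" "v \<notin> set (concat as)" "pverts G = {u, v} \<union> set (concat as)"
    using G' unfolding joined_def by auto
  have uv': "u' \<noteq> v'" "u' \<notin> set (concat bs)" "v' \<notin> set (concat bs)" "pverts H = {u', v'} \<union> set (concat bs)"
    using H' unfolding joined_def by auto
  have hf: "h a = f a" if "a \<in> set (concat as)" for a using that uv unfolding h_def by auto
  have huv: "h u = u'" "h v = v'" using uv unfolding h_def by auto
  have im: "f ` set (concat as) = set (concat bs)" using f by (metis set_map)
  have imh: "h ` set (concat as) = set (concat bs)" using im hf by (metis image_cong)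
  have lk: "linked bs (f a) (f b) \<longleftrightarrow> linked as a b" if "a \<in> set (concat as)" "b \<in> set (concat as)" for a b
  proof -
    have "succ_in (map f xs) (f a) (f b) \<longleftrightarrow> succ_in xs a b"
      if xs: "xs \<in> set as" and ab: "a \<in> set (concat as)" "b \<in> set (concat as)" for xs a b
    proof -
      have mem: "xs ! i \<in> set (concat as)" if "i < length xs" for i using xs nth_mem[OF that] by auto
      show ?thesis unfolding succ_in_def
        using inj_on_eq_iff[OF inj mem ab(1)] inj_on_eq_iff[OF inj mem ab(2)] by (auto simp: Suc_lessD)
    qed
    then show ?thesis using that unfolding linked_def bs by auto
  qed
  show ?thesis
  proof (rule pair_graph_iso[of G h H])
    show "pair_graph G" using pair_graph_joined[OF G] .
    show "inj_on h (pverts G)"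
      unfolding uv(4)
    proof (rule inj_onI)
      fix a b assume ab: "a \<in> {u, v} \<union> set (concat as)" "b \<in> {u, v} \<union> set (concat as)" "h a = h b"
      have hb: "h c \<in> set (concat bs)" if "c \<in> set (concat as)" for c using imh that by blast
      have nu: "h c \<noteq> h u" "h c \<noteq> h v" if "c \<in> set (concat as)" for c
        using hb[OF that] uv'(2,3) unfolding huv by blast+
      have "h u \<noteq> h v" using uv'(1) unfolding huv .
      show "a = b"
      proof (cases "a \<in> set (concat as) \<and> b \<in> set (concat as)")
        case True
        then show ?thesis using ab(3) hf inj by (metis inj_onD)
      next
        case False
        then show ?thesis using ab nu \<open>h u \<noteq> h v\<close> by (metis Un_iff empty_iff insert_iff)
      qed
    qed
    show "pverts H = h ` pverts G" unfolding uv(4) uv'(4) using imh huv by auto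
    have pG: "parcs G = {u, v} \<times> set (concat as) \<union> set (concat as) \<times> {u, v} \<union>
       {(a, b). linked as a b} \<union> (if s then {(u, v), (v, u)} else {})"
      and pH: "parcs H = {u', v'} \<times> set (concat bs) \<union> set (concat bs) \<times> {u', v'} \<union>
       {(a, b). linked bs a b} \<union> (if s then {(u', v'), (v', u')} else {})"
      using G' H' unfolding joined_def by auto
    define hh where "hh = (\<lambda>(a, b). (h a, h b))"
    have "hh ` ({u, v} \<times> set (concat as)) = {u', v'} \<times> set (concat bs)"
      unfolding hh_def imh[symmetric] using huv by (auto simp del: set_concat)
    moreover have "hh ` (set (concat as) \<times> {u, v}) = set (concat bs) \<times> {u', v'}"
      unfolding hh_def imh[symmetric] using huv by (auto simp del: set_concat)
    moreover have "hh ` (if s then {(u, v), (v, u)} else {}) = (if s then {(u', v'), (v', u')} else {})"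
      unfolding hh_def using huv by auto
    moreover have "hh ` {(a, b). linked as a b} = {(a, b). linked bs a b}"
    proof (intro equalityI subsetI)
      fix x assume "x \<in> hh ` {(a, b). linked as a b}"
      then obtain a b where ab: "linked as a b" "x = (h a, h b)" unfolding hh_def by auto
      then show "x \<in> {(a, b). linked bs a b}" using linked_in[OF ab(1)] lk[of a b] hf by auto
    next
      fix x assume "x \<in> {(a, b). linked bs a b}"
      then obtain c d where cd: "x = (c, d)" "linked bs c d" by auto
      then obtain a b where ab: "a \<in> set (concat as)" "b \<in> set (concat as)" "c = f a" "d = f b"
        using linked_in[OF cd(2)] im by (metis imageE)
      then have "linked as a b" using lk[of a b] cd(2) by simp
      then have "hh (a, b) \<in> hh ` {(a, b). linked as a b}" by blast
      moreover have "x = hh (a, b)" unfolding cd hh_def using ab hf by simp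
      ultimately show "x \<in> hh ` {(a, b). linked as a b}" by simp
    qed
    ultimately show "parcs H = (\<lambda>(a, b). (h a, h b)) ` parcs G"
      unfolding pG pH hh_def[symmetric] image_Un by simp
  qed
qed

section \<open>The eigenvector of a join with two hubs\<close>

lemma position_function_exists:
  assumes "distinct (concat xss)"
  shows "\<exists>z. \<forall>xs\<in>set xss. \<forall>i<length xs. z (xs ! i) = h xs i"
proof -
  define P where "P a x \<longleftrightarrow> (\<exists>xs\<in>set xss. \<exists>i<length xs. a = xs ! i \<and> x = h xs i)" for a x
  have uniq: "x = y" if "P a x" "P a y" for a x y
  proof -
    obtain xs i where 1: "xs \<in> set xss" "i < length xs" "a = xs ! i" "x = h xs i" using \<open>P a x\<close> P_def by auto
    obtain ys k where 2: "ys \<in> set xss" "k < length ys" "a = ys ! k" "y = h ys k" using \<open>P a y\<close> P_def by auto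
    have "a \<in> set xs" "a \<in> set ys" using 1(2,3) 2(2,3) nth_mem by metis+
    then have "xs = ys" using 1 2 assms by (metis IntI distinct_concat_iff empty_iff)
    moreover have "distinct xs" using 1 assms by (simp add: distinct_concat_iff)
    ultimately show ?thesis using 1 2 by (simp add: nth_eq_iff_index_eq)
  qed
  have "(THE x. P (xs ! i) x) = h xs i" if "xs \<in> set xss" "i < length xs" for xs i
    by (rule the_equality) (use that uniq P_def in blast)+
  then show ?thesis by (intro exI[of _ "\<lambda>a. THE x. P a x"]) auto
qed

definition forest_weight :: "real \<Rightarrow> nat multiset \<Rightarrow> real" where
  "forest_weight t M = (\<Sum>m\<in>#M. \<Sum>j=1..m. path_weight t m j)"

lemma forest_weight_defect:
  assumes "0 < t" "t < 1"
  shows "forest_weight t M = (real (sum_mset M) - 2 * total_defect t M / (1 - t)) / (t + 1 / t - 2)"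
  unfolding forest_weight_def path_weight_sum[OF assms] total_defect_def
  by (induction M) (simp_all add: add_divide_distrib diff_divide_distrib algebra_simps)

lemma forest_weight_ge:
  assumes "0 < t" "t < 1"
  shows "forest_weight t M \<ge> real (sum_mset M) / (t + 1 / t)"
proof (induction M)
  case empty then show ?case by (simp add: forest_weight_def)
next
  case (add m M)
  then show ?case using path_weight_sum_ge[OF assms, of m] by (simp add: forest_weight_def add_divide_distrib)
qed

text \<open>The Perron vector of the join, up to the equation at the hubs.\<close>

lemma joined_eigenvector:
  assumes G: "joined True G u v xss" and t: "0 < t" "t < 1"
  obtains z where "\<And>a. a \<in> pverts G \<Longrightarrow> z a > 0"
    "\<And>a. a \<in> set (concat xss) \<Longrightarrow> sum z (nbrs G a) = (t + 1 / t) * z a"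
    "z u = 1" "z v = 1"
    "sum z (nbrs G u) = 1 + 2 * forest_weight t (mset (map length xss))"
    "sum z (nbrs G v) = 1 + 2 * forest_weight t (mset (map length xss))"
proof -
  have D: "distinct (concat xss)" "u \<noteq> v" "u \<notin> set (concat xss)" "v \<notin> set (concat xss)"
    "pverts G = {u, v} \<union> set (concat xss)"
    and pG: "parcs G = {u, v} \<times> set (concat xss) \<union> set (concat xss) \<times> {u, v} \<union>
       {(a, b). linked xss a b} \<union> {(u, v), (v, u)}"
    using G unfolding joined_def by auto
  \<comment> \<open>The factor 2 is needed because a path vertex receives 1 from each of the two
    hubs, whereas \<open>path_weight\<close> solves the recurrence with inhomogeneity 1.\<close>
  obtain z0 where z0: "\<forall>xs\<in>set xss. \<forall>i<length xs. z0 (xs ! i) = 2 * path_weight t (length xs) (i + 1)"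
    using position_function_exists[OF D(1), of "\<lambda>xs i. 2 * path_weight t (length xs) (i + 1)"] by blast
  define z where "z = z0(u := 1, v := 1)"
  have zuv: "z u = 1" "z v = 1" unfolding z_def by auto
  have zx: "z (xs ! i) = 2 * path_weight t (length xs) (i + 1)" if "xs \<in> set xss" "i < length xs" for xs i
  proof -
    have "xs ! i \<in> set (concat xss)" using that(1) nth_mem[OF that(2)] unfolding set_concat by blast
    then show ?thesis using z0 that D unfolding z_def by auto
  qed
  have ex: "\<exists>xs\<in>set xss. \<exists>i<length xs. a = xs ! i" if "a \<in> set (concat xss)" for a
    using that by (auto simp: in_set_conv_nth)
  have pos: "z a > 0" if "a \<in> pverts G" for a
  proof (cases "a \<in> {u, v}")
    case True then show ?thesis using zuv by auto
  next
    case False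
    then have "a \<in> set (concat xss)" using that D(5) by blast
    then obtain xs i where "xs \<in> set xss" "i < length xs" "a = xs ! i" using ex by blast
    then show ?thesis using zx path_weight_pos[OF t, of "i + 1" "length xs"] by simp
  qed
  have total: "sum z (set (concat xss)) = 2 * forest_weight t (mset (map length xss))"
  proof -
    have "sum z (set (concat xss)) = sum_list (map z (concat xss))"
      using D(1) by (simp add: sum_list_distinct_conv_sum_set del: set_concat)
    also have "\<dots> = sum_list (map (\<lambda>xs. sum_list (map z xs)) xss)"
      by (induction xss) auto
    also have "\<dots> = sum_list (map (\<lambda>xs. 2 * (\<Sum>j=1..length xs. path_weight t (length xs) j)) xss)"
    proof (rule arg_cong[where f = sum_list], rule map_cong[OF refl])
      fix xs assume xs: "xs \<in> set xss"
      have "sum_list (map z xs) = (\<Sum>i<length xs. 2 * path_weight t (length xs) (i + 1))"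
        using zx[OF xs] by (simp add: sum_list_sum_nth atLeast0LessThan)
      also have "\<dots> = 2 * (\<Sum>j=1..length xs. path_weight t (length xs) j)"
        unfolding sum_distrib_left
        by (rule sum.reindex_bij_witness[of _ "\<lambda>j. j - 1" "\<lambda>i. i + 1"]) auto
      finally show "sum_list (map z xs) = 2 * (\<Sum>j=1..length xs. path_weight t (length xs) j)" .
    qed
    also have "\<dots> = 2 * forest_weight t (mset (map length xss))"
      unfolding forest_weight_def by (induction xss) (auto simp: algebra_simps)
    finally show ?thesis .
  qed
  have lin: "linked xss a b \<Longrightarrow> a \<in> set (concat xss) \<and> b \<in> set (concat xss)" for a b by (rule linked_in)
  have nu: "nbrs G u = insert v (set (concat xss))" "nbrs G v = insert u (set (concat xss))"
    unfolding nbrs_def pG using D(2-4) lin by blast+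
  have hubs: "sum z (nbrs G u) = 1 + 2 * forest_weight t (mset (map length xss))"
    "sum z (nbrs G v) = 1 + 2 * forest_weight t (mset (map length xss))"
    unfolding nu using D(3,4) total zuv by (simp_all del: set_concat)
  have "sum z (nbrs G a) = (t + 1 / t) * z a" if a: "a \<in> set (concat xss)" for a
  proof -
    obtain xs i where xs: "xs \<in> set xss" "i < length xs" "a = xs ! i" using ex[OF a] by blast
    have dx: "distinct xs" using D(1) xs(1) by (simp add: distinct_concat_iff)
    define A where "A = (if 0 < i then {xs ! (i - 1)} else {})"
    define B where "B = (if Suc i < length xs then {xs ! Suc i} else {})"
    have auv: "a \<notin> {u, v}" using a D(3,4) by blast
    have "nbrs G a = {u, v} \<union> {b. linked xss a b}"
      unfolding nbrs_def pG using a auv by blast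
    also have "{b. linked xss a b} = A \<union> B"
      unfolding xs(3) A_def B_def using linked_nth[OF D(1) xs(1,2)] by auto
    finally have nb: "nbrs G a = {u, v} \<union> (A \<union> B)" .
    have "A \<union> B \<subseteq> set xs" unfolding A_def B_def using xs(2) by (auto intro!: nth_mem)
    then have "A \<union> B \<subseteq> set (concat xss)" using xs(1) by auto
    then have dis: "{u, v} \<inter> (A \<union> B) = {}" using D(3,4) by blast
    have dAB: "A \<inter> B = {}" unfolding A_def B_def using dx xs(2) by (auto simp: nth_eq_iff_index_eq)
    have "sum z (nbrs G a) = sum z {u, v} + (sum z A + sum z B)"
      unfolding nb using dis dAB by (subst sum.union_disjoint, simp, simp add: A_def B_def, simp)
        (subst sum.union_disjoint, auto simp: A_def B_def)
    also have "sum z {u, v} = 2" using zuv D(2) by simp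
    also have "sum z A = 2 * path_weight t (length xs) i"
    proof (cases "0 < i")
      case True then show ?thesis unfolding A_def using zx[OF xs(1), of "i - 1"] xs(2) by simp
    next
      case False then show ?thesis unfolding A_def using path_weight_ends(1)[OF t] by simp
    qed
    also have "sum z B = 2 * path_weight t (length xs) (i + 2)"
    proof (cases "Suc i < length xs")
      case True then show ?thesis unfolding B_def using zx[OF xs(1), of "Suc i"] by simp
    next
      case False
      then have "length xs = i + 1" using xs(2) by simp
      then show ?thesis unfolding B_def using path_weight_ends(2)[OF t, of "i + 1"] by simp
    qed
    finally have "sum z (nbrs G a) = 2 * (1 + path_weight t (length xs) i + path_weight t (length xs) (i + 2))" by simp
    also have "\<dots> = (t + 1 / t) * z a"
      using path_weight_rec[OF t, of "i + 1" "length xs"] zx[OF xs(1,2)] xs(2,3) by (simp add: algebra_simps)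
    finally show ?thesis .
  qed
  then show ?thesis using that pos zuv hubs by blast
qed

section \<open>Cycles\<close>

lemma contains_cycle_iff:
  assumes l: "l \<ge> 3" and G: "pair_graph G"
  shows "contains_graph G (cycle_graph l) \<longleftrightarrow>
    (\<exists>c. length c = l \<and> distinct c \<and> (\<forall>i<l. (c ! i, c ! (Suc i mod l)) \<in> parcs G))"
proof
  assume "contains_graph G (cycle_graph l)"
  then obtain K :: "'a pair_pre_digraph" and f where K: "subgraph (with_proj K) (with_proj G)"
    "pre_digraph.digraph_isomorphism (with_proj (cycle_graph l)) f"
    "with_proj K = app_iso f (with_proj (cycle_graph l))"
    unfolding contains_graph_def digraph_iso_def by blast
  define c where "c = map (iso_verts f) [0..<l]"
  have "inj_on (iso_verts f) {..<l}"
    using K(2) unfolding pre_digraph.digraph_isomorphism_def by (simp add: cycle_graph_def)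
  then have "distinct c" unfolding c_def by (simp add: distinct_map atLeast0LessThan)
  moreover have "(c ! i, c ! (Suc i mod l)) \<in> parcs G" if i: "i < l" for i
  proof -
    define e where "e = (i, Suc i mod l)"
    have e: "e \<in> parcs (cycle_graph l)" unfolding e_def cycle_graph_def using i l by auto
    then have ek: "iso_arcs f e \<in> arcs (with_proj K)" unfolding K(3) by simp
    have "fst (iso_arcs f e) = iso_tail f (iso_arcs f e)" "snd (iso_arcs f e) = iso_head f (iso_arcs f e)"
      using arg_cong[OF K(3), of tail] arg_cong[OF K(3), of head] by auto
    moreover have "iso_tail f (iso_arcs f e) = iso_verts f i" "iso_head f (iso_arcs f e) = iso_verts f (Suc i mod l)"
      using K(2) e unfolding pre_digraph.digraph_isomorphism_def by (auto simp: e_def)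
    ultimately have "iso_arcs f e = (c ! i, c ! (Suc i mod l))"
      using i l unfolding c_def by (simp add: prod_eq_iff)
    then show ?thesis using ek K(1) unfolding subgraph_def by auto
  qed
  ultimately show "\<exists>c. length c = l \<and> distinct c \<and> (\<forall>i<l. (c ! i, c ! (Suc i mod l)) \<in> parcs G)"
    unfolding c_def by (intro exI[of _ c]) (auto simp: c_def)
next
  assume "\<exists>c. length c = l \<and> distinct c \<and> (\<forall>i<l. (c ! i, c ! (Suc i mod l)) \<in> parcs G)"
  then obtain c where c: "length c = l" "distinct c" "\<And>i. i < l \<Longrightarrow> (c ! i, c ! (Suc i mod l)) \<in> parcs G" by blast
  interpret pair_graph G by fact
  define K where "K = \<lparr> pverts = (!) c ` {..<l}, parcs = (\<lambda>(a, b). (c ! a, c ! b)) ` parcs (cycle_graph l) \<rparr>"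
  have arcs: "(c ! a, c ! b) \<in> parcs G" if "(a, b) \<in> parcs (cycle_graph l)" for a b
    using that c(3)[of a] parcs_sym[OF c(3)[of b]] unfolding cycle_graph_def by auto
  have vert: "c ! i \<in> pverts G" if "i < l" for i using c(3)[OF that] in_arcsD1 by auto
  have "digraph_iso (with_proj (cycle_graph l)) (with_proj K)"
  proof (rule pair_graph_iso[OF pair_graph_cycle_graph[OF l]])
    show "inj_on ((!) c) (pverts (cycle_graph l))"
      using c(1,2) by (auto simp: cycle_graph_def inj_on_def nth_eq_iff_index_eq)
  qed (auto simp: K_def cycle_graph_def)
  moreover have "subgraph (with_proj K) (with_proj G)"
  proof -
    have wK: "wf_digraph (with_proj K)"
      by unfold_locales (auto simp: K_def cycle_graph_def)
    have "pverts K \<subseteq> pverts G" "parcs K \<subseteq> parcs G" using vert arcs unfolding K_def by auto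
    then show ?thesis using wK wf_digraph unfolding subgraph_def compatible_def by auto
  qed
  ultimately show "contains_graph G (cycle_graph l)" unfolding contains_graph_def by blast
qed

lemma cycle_list_iff:
  assumes "c \<noteq> []"
  shows "(\<forall>i<length c. R (c ! i) (c ! (Suc i mod length c))) \<longleftrightarrow> successively R c \<and> R (last c) (hd c)"
proof -
  define n where "n = length c - 1"
  have n: "length c = Suc n" using assms n_def by (cases c) auto
  have ends: "last c = c ! n" "hd c = c ! 0" using assms n by (auto simp: last_conv_nth hd_conv_nth)
  have m: "Suc i mod Suc n = Suc i" if "i < n" for i using that by simp
  have "(\<forall>i<Suc n. R (c ! i) (c ! (Suc i mod Suc n))) \<longleftrightarrow> (\<forall>i<n. R (c ! i) (c ! Suc i)) \<and> R (c ! n) (c ! 0)"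
    unfolding All_less_Suc using m by (metis mod_self)
  then show ?thesis unfolding successively_conv_nth ends n by simp
qed

lemma walk_in_list:
  assumes D: "distinct (concat xss)" and p: "successively (linked xss) p" "set p \<subseteq> set (concat xss)" and ne: "xss \<noteq> []"
  shows "\<exists>xs\<in>set xss. set p \<subseteq> set xs"
  using p
proof (induction p)
  case Nil
  then show ?case using ne by (cases xss) auto
next
  case (Cons a p)
  show ?case
  proof (cases "p = []")
    case True
    then show ?thesis using Cons.prems(2) by auto
  next
    case False
    then have "linked xss a (hd p)" "successively (linked xss) p" using Cons.prems(1) by (auto simp: successively_Cons)
    then obtain xs where xs: "xs \<in> set xss" "set p \<subseteq> set xs" using Cons by auto
    have "hd p \<in> set xs" using xs(2) False by auto
    then have "a \<in> set xs"
      using linked_same_list[OF D _ xs(1), of "hd p" a] \<open>linked xss a (hd p)\<close> linked_sym[of xss a] succ_in_set by fast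
    then show ?thesis using xs by auto
  qed
qed

lemma joined_arc_inside:
  assumes "joined s G u v xss" "(a, b) \<in> parcs G" "a \<in> set (concat xss)" "b \<in> set (concat xss)"
  shows "linked xss a b"
proof -
  define W where "W = set (concat xss)"
  have pG: "parcs G = {u, v} \<times> W \<union> W \<times> {u, v} \<union>
       {(a, b). linked xss a b} \<union> (if s then {(u, v), (v, u)} else {})" and "u \<notin> W" "v \<notin> W"
    using assms(1) unfolding joined_def W_def by auto
  then show ?thesis using assms(2-4) unfolding W_def[symmetric] by (auto split: if_splits)
qed

text \<open>Removing the two hubs leaves at most two pieces of a cycle, each inside one path.\<close>

lemma joined_cycle_length:
  assumes G: "joined s G u v xss" and ne: "xss \<noteq> []"
    and c: "distinct c" "successively (\<lambda>a b. (a, b) \<in> parcs G) c" "(last c, hd c) \<in> parcs G" "set c \<subseteq> pverts G"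
    and len: "\<And>xs. xs \<in> set xss \<Longrightarrow> length xs \<le> q"
      "\<And>xs ys. xs \<in> set xss \<Longrightarrow> ys \<in> set xss \<Longrightarrow> xs \<noteq> ys \<Longrightarrow> length xs + length ys \<le> q"
  shows "length c \<le> q + 2"
proof -
  define W where "W = set (concat xss)"
  define R where "R = (\<lambda>a b. (a, b) \<in> parcs G)"
  have D: "distinct (concat xss)" and pv: "pverts G = {u, v} \<union> W"
    using G unfolding joined_def W_def by auto
  have walk: "\<exists>xs\<in>set xss. set p \<subseteq> set xs" if p: "successively R p" "set p \<subseteq> W" for p
  proof (rule walk_in_list[OF D _ _ ne])
    show "successively (linked xss) p"
      using p(1) by (rule successively_mono)
        (use p(2) joined_arc_inside[OF G] in \<open>unfold R_def W_def, blast\<close>)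
  qed (use p(2) W_def in simp)
  have c': "successively R c" "R (last c) (hd c)" using c unfolding R_def by auto
  \<comment> \<open>Rotating the cycle so that it starts behind the removed vertex keeps the rest a
    single walk; the other hub then cuts this walk at most once.\<close>
  have cyc: "successively R (r @ p)" if "c = p @ x # r" for p x r
  proof -
    have "successively R p" "successively R r" using c'(1) that by (auto simp: successively_append_iff successively_Cons)
    moreover have "R (last r) (hd p)" if "r \<noteq> []" "p \<noteq> []" using c'(2) that \<open>c = p @ x # r\<close> by simp
    ultimately show ?thesis by (auto simp: successively_append_iff)
  qed
  have "\<exists>xs\<in>set xss. \<exists>ys\<in>set xss. set c \<subseteq> {u, v} \<union> (set xs \<union> set ys)"
  proof -
    have one: "\<exists>xs\<in>set xss. \<exists>ys\<in>set xss. set w \<subseteq> {v} \<union> (set xs \<union> set ys)"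
      if w: "successively R w" "set w \<subseteq> {v} \<union> W" "distinct w" for w
    proof (cases "v \<in> set w")
      case True
      then obtain a b where ab: "w = a @ v # b" using split_list by metis
      then have "successively R a" "successively R b" using w(1) by (auto simp: successively_append_iff successively_Cons)
      moreover have "set a \<subseteq> W" "set b \<subseteq> W" using w(2,3) ab by auto
      ultimately obtain xs ys where "xs \<in> set xss" "set a \<subseteq> set xs" "ys \<in> set xss" "set b \<subseteq> set ys"
        using walk by meson
      then show ?thesis using ab by (intro bexI[of _ xs] bexI[of _ ys]) auto
    next
      case False
      then have "set w \<subseteq> W" using w(2) by auto
      then show ?thesis using walk[OF w(1)] by auto
    qed
    show ?thesis
    proof (cases "u \<in> set c")
      case True
      then obtain p r where pr: "c = p @ u # r" using split_list by metis
      have "set (r @ p) \<subseteq> {v} \<union> W" "distinct (r @ p)" using c(1,4) pr pv by auto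
      then obtain xs ys where "xs \<in> set xss" "ys \<in> set xss" "set (r @ p) \<subseteq> {v} \<union> (set xs \<union> set ys)"
        using one[OF cyc[OF pr]] by blast
      then show ?thesis using pr by (intro bexI[of _ xs] bexI[of _ ys]) auto
    next
      case False
      then have "set c \<subseteq> {v} \<union> W" using c(4) pv by auto
      then show ?thesis using one[OF c'(1) _ c(1)] by blast
    qed
  qed
  then obtain xs ys where xy: "xs \<in> set xss" "ys \<in> set xss" "set c \<subseteq> {u, v} \<union> (set xs \<union> set ys)" by blast
  have "length c = card (set c)" using c(1) distinct_card by metis
  also have "\<dots> \<le> card ({u, v} \<union> (set xs \<union> set ys))" using xy(3) by (intro card_mono) auto
  also have "\<dots> \<le> card {u, v} + card (set xs \<union> set ys)" by (rule card_Un_le)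
  also have "card {u, v} \<le> 2" by (cases "u = v") auto
  also have "card (set xs \<union> set ys) \<le> q"
  proof (cases "xs = ys")
    case True
    then show ?thesis using len(1)[OF xy(1)] card_length[of xs] by simp
  next
    case False
    then show ?thesis
      using len(2)[OF xy(1,2)] card_Un_le[of "set xs" "set ys"] card_length[of xs] card_length[of ys] by linarith
  qed
  finally show ?thesis by simp
qed

lemma joined_cycle_free:
  assumes G: "joined s G u v xss" and ne: "xss \<noteq> []" and l: "3 \<le> l" "q + 3 \<le> l"
    and len: "\<And>xs. xs \<in> set xss \<Longrightarrow> length xs \<le> q"
      "\<And>xs ys. xs \<in> set xss \<Longrightarrow> ys \<in> set xss \<Longrightarrow> xs \<noteq> ys \<Longrightarrow> length xs + length ys \<le> q"
  shows "\<not> contains_graph G (cycle_graph l)"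
proof
  interpret pair_graph G using pair_graph_joined[OF G] .
  assume "contains_graph G (cycle_graph l)"
  then obtain c where c: "length c = l" "distinct c" "\<And>i. i < l \<Longrightarrow> (c ! i, c ! (Suc i mod l)) \<in> parcs G"
    using contains_cycle_iff[OF l(1) pair_graph_axioms] by blast
  have "c \<noteq> []" using c(1) l by auto
  then have s: "successively (\<lambda>a b. (a, b) \<in> parcs G) c" "(last c, hd c) \<in> parcs G"
    using cycle_list_iff[of c "\<lambda>a b. (a, b) \<in> parcs G"] c(1,3) by auto
  have "set c \<subseteq> pverts G"
  proof
    fix x assume "x \<in> set c"
    then obtain i where "i < l" "x = c ! i" using c(1) by (metis in_set_conv_nth)
    then show "x \<in> pverts G" using in_arcsD1[OF c(3)[of i]] by simp
  qed
  then have "length c \<le> q + 2" using joined_cycle_length[OF G ne c(2) s] len by blast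
  then show False using c(1) l by simp
qed

lemma (in pair_graph) hub_cycle:
  assumes nc: "\<not> contains_graph G (cycle_graph l)" and l: "l \<ge> 3"
    and uv: "u \<noteq> v" and p: "p \<noteq> []" "p' \<noteq> []" "distinct (p @ p')" "length p + length p' + 2 = l"
    and walk: "successively (\<lambda>a b. (a, b) \<in> parcs G) p" "successively (\<lambda>a b. (a, b) \<in> parcs G) p'"
    and hub: "set (p @ p') \<subseteq> nbrs G u \<inter> nbrs G v"
  shows False
proof -
  have nl: "(a, a) \<notin> parcs G" for a using pair_no_loops[of "(a, a)"] by auto
  define c where "c = u # p @ v # p'"
  have "u \<notin> set (p @ p')" "v \<notin> set (p @ p')" using hub nl unfolding nbrs_def by blast+
  then have "distinct c" using uv p(3) unfolding c_def by auto
  have adj: "(u, a) \<in> parcs G" "(a, u) \<in> parcs G" "(v, a) \<in> parcs G" "(a, v) \<in> parcs G"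
    if "a \<in> set (p @ p')" for a
    using hub that parcs_sym unfolding nbrs_def by blast+
  have "successively (\<lambda>a b. (a, b) \<in> parcs G) c"
    unfolding c_def using walk p(1,2) adj by (auto simp: successively_append_iff successively_Cons)
  moreover have "(last c, hd c) \<in> parcs G" unfolding c_def using p(2) adj by simp
  moreover have "length c = l" unfolding c_def using p(4) by simp
  ultimately have "contains_graph G (cycle_graph l)"
    using contains_cycle_iff[OF l pair_graph_axioms] cycle_list_iff[of c "\<lambda>a b. (a, b) \<in> parcs G"] \<open>distinct c\<close>
    by (metis c_def list.discI)
  then show False using nc by simp
qed

text \<open>Violating a bound leaves room for two segments with \<open>l - 2\<close> vertices in
  total, which the hubs close to a cycle of length \<open>l\<close>. Both segments may be
  consecutive pieces of one path, since the cycle passes from one to the other through a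
  hub.\<close>

lemma (in pair_graph) hub_paths_short:
  assumes nc: "\<not> contains_graph G (cycle_graph l)" and l: "l \<ge> 5" and uv: "u \<noteq> v"
    and pf: "path_forest (\<lambda>a b. (a, b) \<in> parcs G) D xss" and D: "D \<subseteq> nbrs G u \<inter> nbrs G v"
  shows "xs \<in> set xss \<Longrightarrow> length xs \<le> l - 3"
    and "xs \<in> set xss \<Longrightarrow> ys \<in> set xss \<Longrightarrow> xs \<noteq> ys \<Longrightarrow> length xs + length ys \<le> l - 3"
proof -
  have dx: "distinct (concat xss)" "[] \<notin> set xss" "set (concat xss) = D"
    "\<And>a b. a \<in> D \<Longrightarrow> b \<in> D \<Longrightarrow> (a, b) \<in> parcs G \<longleftrightarrow> linked xss a b"
    using pf unfolding path_forest_def by auto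
  have walk: "successively (\<lambda>a b. (a, b) \<in> parcs G) xs" if xs: "xs \<in> set xss" for xs
    unfolding successively_conv_nth
  proof (intro allI impI)
    fix i assume i: "Suc i < length xs"
    have "xs ! i \<in> set xs" "xs ! Suc i \<in> set xs" using i by auto
    then have "xs ! i \<in> D" "xs ! Suc i \<in> D" using xs dx(3) by auto
    moreover have "linked xss (xs ! i) (xs ! Suc i)" using xs i unfolding linked_def succ_in_def by blast
    ultimately show "(xs ! i, xs ! Suc i) \<in> parcs G" using dx(4) by simp
  qed
  have sub: "set xs \<subseteq> nbrs G u \<inter> nbrs G v" if "xs \<in> set xss" for xs using that dx(3) D by auto
  have part: "successively (\<lambda>a b. (a, b) \<in> parcs G) (take k xs)" "successively (\<lambda>a b. (a, b) \<in> parcs G) (drop k xs)"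
    if "xs \<in> set xss" for xs k
    using walk[OF that] successively_append_iff[of _ "take k xs" "drop k xs"] by auto
  have part2: "successively (\<lambda>a b. (a, b) \<in> parcs G) (take m (drop k xs))" if "xs \<in> set xss" for xs k m
  proof -
    have "successively (\<lambda>a b. (a, b) \<in> parcs G) (take m (drop k xs) @ drop m (drop k xs))"
      using part(2)[OF that, of k] by (simp only: append_take_drop_id)
    then show ?thesis by (simp only: successively_append_iff)
  qed
  have l3: "l \<ge> 3" using l by simp
  show "length xs \<le> l - 3" if xs: "xs \<in> set xss"
  proof (rule ccontr)
    assume "\<not> ?thesis"
    then have len: "length xs \<ge> l - 2" by simp
    have "distinct xs" using dx(1) xs by (simp add: distinct_concat_iff)
    then have dd: "distinct (take (1 + (l - 3)) xs)" by simp
    show False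
    proof (rule hub_cycle[OF nc l3 uv, of "take 1 xs" "take (l - 3) (drop 1 xs)"])
      have eq: "take 1 xs @ take (l - 3) (drop 1 xs) = take (1 + (l - 3)) xs" by (rule take_add[symmetric])
      show "distinct (take 1 xs @ take (l - 3) (drop 1 xs))" unfolding eq by (rule dd)
      show "set (take 1 xs @ take (l - 3) (drop 1 xs)) \<subseteq> nbrs G u \<inter> nbrs G v"
        unfolding eq using sub[OF xs] set_take_subset[of _ xs] by fast
    qed (use len l xs part part2 in auto)
  qed
  show "length xs + length ys \<le> l - 3" if xy: "xs \<in> set xss" "ys \<in> set xss" "xs \<noteq> ys"
  proof (rule ccontr)
    assume "\<not> ?thesis"
    then have len: "length xs + length ys \<ge> l - 2" by simp
    have ne: "length xs \<ge> 1" "length ys \<ge> 1" using dx(2) xy by (auto simp: Suc_le_eq)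
    \<comment> \<open>At most \<open>l - 3\<close>, so that at least one vertex is left for the
      segment of \<open>ys\<close>.\<close>
    define k where "k = min (length xs) (l - 3)"
    have k: "1 \<le> k" "k \<le> length xs" "1 \<le> l - 2 - k" "l - 2 - k \<le> length ys"
      using ne len l unfolding k_def by auto
    have "set xs \<inter> set ys = {}" "distinct xs" "distinct ys" using dx(1) xy by (auto simp: distinct_concat_iff)
    then have d: "distinct (take k xs @ take (l - 2 - k) ys)"
      using set_take_subset[of k xs] set_take_subset[of "l - 2 - k" ys] by auto
    show False
    proof (rule hub_cycle[OF nc l3 uv _ _ d])
      show "set (take k xs @ take (l - 2 - k) ys) \<subseteq> nbrs G u \<inter> nbrs G v"
        using sub[OF xy(1)] sub[OF xy(2)] set_take_subset[of k xs] set_take_subset[of "l - 2 - k" ys] by auto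
    qed (use k l part xy in auto)
  qed
qed

section \<open>Planarity of the join\<close>

lemma closed_segment_ReIm:
  assumes "z \<in> closed_segment a b"
  obtains t where "0 \<le> t" "t \<le> 1" "Re z = (1 - t) * Re a + t * Re b" "Im z = (1 - t) * Im a + t * Im b"
  using assms unfolding in_segment by auto

text \<open>Straight-line drawing with the hubs at 0 and 1 and all path vertices on the vertical
  line with real part 1/2, path after path. Linked vertices are consecutive there, so path edges are
  unit segments of this line, and the edges to the hubs form a fan on either side of it.\<close>

lemma joined_planar:
  assumes G: "joined s G u v xss"
  shows "planar_graph G"
proof -
  define W where "W = set (concat xss)"
  have D: "distinct (concat xss)" "u \<noteq> v" "u \<notin> W" "v \<notin> W" and pv: "pverts G = {u, v} \<union> W"
    and pG: "parcs G = {u, v} \<times> W \<union> W \<times> {u, v} \<union>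
       {(a, b). linked xss a b} \<union> (if s then {(u, v), (v, u)} else {})"
    using G unfolding joined_def W_def by auto
  obtain f :: "'a \<Rightarrow> nat" where f: "map f (concat xss) = [0..<length (concat xss)]"
    using map_exists[OF D(1), of "[0..<length (concat xss)]"] by auto
  have injf: "inj_on f W" unfolding W_def using f by (metis distinct_map distinct_upt)
  have fsucc: "f b = Suc (f a)" if ab: "succ_in xs a b" "xs \<in> set xss" for xs a b
  proof -
    obtain ps qs where pq: "xss = ps @ xs # qs" using ab(2) split_list by metis
    obtain i where i: "Suc i < length xs" "xs ! i = a" "xs ! Suc i = b" using ab(1) unfolding succ_in_def by blast
    define k where "k = length (concat ps) + i"
    have c: "concat xss ! k = a" "concat xss ! Suc k = b" "Suc k < length (concat xss)"
      unfolding k_def pq using i by (auto simp: nth_append)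
    have "f (concat xss ! j) = j" if "j < length (concat xss)" for j
      using f that by (metis nth_map nth_upt add_0 length_map diff_zero)
    then show ?thesis using c by (metis Suc_lessD)
  qed
  \<comment> \<open>The shift by 1 keeps the column of path vertices above the segment between the
    hubs.\<close>
  define h where "h a = real (f a) + 1" for a
  define p where "p a = (if a = u then 0 else if a = v then 1 else Complex (1 / 2) (h a))" for a
  have p: "p u = 0" "p v = 1" "\<And>w. w \<in> W \<Longrightarrow> p w = Complex (1 / 2) (h w)"
    using D(2-4) unfolding p_def by auto
  have h1: "h a \<ge> 1" for a unfolding h_def by simp
  have hinj: "a = b" if "h a = h b" "a \<in> W" "b \<in> W" for a b
    using that injf unfolding h_def by (auto dest: inj_onD)
  have hint: "h a = h b \<or> h a = h b + 1" if "h b \<le> h a" "h a \<le> h b + 1" for a b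
    using that unfolding h_def by auto
  have pinj: "inj_on p (pverts G)"
  proof (rule inj_onI)
    fix a b assume ab: "a \<in> pverts G" "b \<in> pverts G" "p a = p b"
    then have e: "Re (p a) = Re (p b)" "Im (p a) = Im (p b)" by simp_all
    have uv: "Re (p u) = 0" "Re (p v) = 1" using p by simp_all
    have w: "Re (p w) = 1 / 2" "Im (p w) = h w" if "w \<in> W" for w using p(3)[OF that] by simp_all
    consider "a = u" | "a = v" | "a \<in> W" using ab(1) pv by blast
    then show "a = b"
    proof cases
      case 1
      then show ?thesis using e(1) uv w(1)[of b] ab(2) pv by auto
    next
      case 2
      then show ?thesis using e(1) uv w(1)[of b] ab(2) pv by auto
    next
      case 3
      then have "b \<in> W" using e(1) uv w(1)[of a] ab(2) pv by auto
      then show ?thesis using 3 e(2) w(2) hinj by simp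
    qed
  qed
  \<comment> \<open>Each edge has one of four oriented normal forms, so the crossing test becomes a
    table of four by four cases.\<close>
  define nf where "nf a b \<longleftrightarrow> a = u \<and> b = v \<or> a = u \<and> b \<in> W \<or> a = v \<and> b \<in> W \<or>
     a \<in> W \<and> b \<in> W \<and> f b = Suc (f a)" for a b
  have norm: "\<exists>c d. nf c d \<and> {a, b} = {c, d}" if ab: "(a, b) \<in> parcs G" for a b
  proof -
    have "a \<in> {u, v} \<and> b \<in> W \<or> a \<in> W \<and> b \<in> {u, v} \<or> linked xss a b \<or> a = u \<and> b = v \<or> a = v \<and> b = u"
      using ab unfolding pG by (auto split: if_splits)
    moreover have "a \<in> W \<and> b \<in> W \<and> (f b = Suc (f a) \<or> f a = Suc (f b))" if lk: "linked xss a b"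
      using linked_in[OF lk] fsucc lk unfolding linked_def W_def by blast
    ultimately have "nf a b \<or> nf b a" unfolding nf_def by blast
    then show ?thesis
    proof
      assume "nf b a"
      moreover have "{a, b} = {b, a}" by blast
      ultimately show ?thesis by blast
    qed blast
  qed
  have segUV: "Im z = 0 \<and> 0 \<le> Re z \<and> Re z \<le> 1" if "z \<in> closed_segment (p u) (p v)" for z
    using that unfolding p by (rule closed_segment_ReIm) auto
  have segUW: "0 \<le> Re z \<and> Re z \<le> 1 / 2 \<and> Im z = 2 * h w * Re z"
    if "z \<in> closed_segment (p u) (p w)" "w \<in> W" for z w
    using that(1) unfolding p(1) p(3)[OF that(2)] by (rule closed_segment_ReIm) auto
  have segVW: "1 / 2 \<le> Re z \<and> Re z \<le> 1 \<and> Im z = 2 * h w * (1 - Re z)"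
    if z: "z \<in> closed_segment (p v) (p w)" and w: "w \<in> W" for z w
  proof -
    obtain t where t: "0 \<le> t" "t \<le> 1" "Re z = 1 - t / 2" "Im z = t * h w"
      using z unfolding p(2) p(3)[OF w] by (rule closed_segment_ReIm) (auto simp: field_simps)
    then have "t = 2 * (1 - Re z)" by simp
    then show ?thesis using t by simp
  qed
  have segWW: "Re z = 1 / 2 \<and> h w \<le> Im z \<and> Im z \<le> h w + 1"
    if "z \<in> closed_segment (p w) (p w')" "w \<in> W" "w' \<in> W" "f w' = Suc (f w)" for z w w'
  proof -
    have hw: "h w' = h w + 1" using that(4) unfolding h_def by simp
    show ?thesis using that(1) unfolding p(3)[OF that(2)] p(3)[OF that(3)] hw
      by (rule closed_segment_ReIm) (auto simp: field_simps)
  qed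
  have vert: "x \<in> {a, b}" if ab: "nf a b" and z: "p x \<in> closed_segment (p a) (p b)" and x: "x \<in> pverts G" for a b x
  proof -
    consider "a = u" "b = v" | "a = u" "b \<in> W" | "a = v" "b \<in> W" | "a \<in> W" "b \<in> W" "f b = Suc (f a)"
      using ab unfolding nf_def by blast
    then show ?thesis
    proof cases
      case 1
      then have "Im (p x) = 0" using segUV z by blast
      then show ?thesis using 1 x p h1[of x] unfolding pv by auto
    next
      case 2
      then have s: "Re (p x) \<le> 1 / 2" "Im (p x) = 2 * h b * Re (p x)" using segUW z by blast+
      show ?thesis
      proof (cases "x \<in> W")
        case True
        then have "h x = h b" using s p by simp
        then show ?thesis using hinj True 2 by auto
      next
        case False
        then show ?thesis using 2 x s p unfolding pv by auto
      qed
    next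
      case 3
      then have s: "1 / 2 \<le> Re (p x)" "Im (p x) = 2 * h b * (1 - Re (p x))" using segVW z by blast+
      show ?thesis
      proof (cases "x \<in> W")
        case True
        then have "h x = h b" using s p by simp
        then show ?thesis using hinj True 3 by auto
      next
        case False
        then show ?thesis using 3 x s p unfolding pv by auto
      qed
    next
      case 4
      then have s: "Re (p x) = 1 / 2" "h a \<le> Im (p x)" "Im (p x) \<le> h a + 1" using segWW z by blast+
      have xW: "x \<in> W" using s(1) x p unfolding pv by auto
      have "h b = h a + 1" using 4(3) unfolding h_def by simp
      then have "h x = h a \<or> h x = h b" using hint[of a x] s xW p by simp
      then show ?thesis using hinj xW 4 by blast
    qed
  qed
  have cross: "z \<in> p ` ({a, b} \<inter> {c, d})"
    if ab: "nf a b" and cd: "nf c d" and ne: "{a, b} \<noteq> {c, d}"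
      and z: "z \<in> closed_segment (p a) (p b)" "z \<in> closed_segment (p c) (p d)" for a b c d z
  proof -
    have at: "z = p x \<Longrightarrow> x \<in> pverts G \<Longrightarrow> z \<in> p ` ({a, b} \<inter> {c, d})" for x
      using vert[OF ab, of x] vert[OF cd, of x] z by blast
    have atW: "z = p w" if "Re z = 1 / 2" "Im z = h w" "w \<in> W" for w
      using that(1,2) unfolding p(3)[OF that(3)] by (intro complex_eqI) simp_all
    have at0: "z = p u" if "Re z = 0" "Im z = 0" using that p(1) by (simp add: complex_eq_iff)
    have at1: "z = p v" if "Re z = 1" "Im z = 0" using that p(2) by (simp add: complex_eq_iff)
    have pvW: "w \<in> pverts G" if "w \<in> W" for w using that pv by auto
    have pvu: "u \<in> pverts G" "v \<in> pverts G" using pv by auto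
    consider "a = u" "b = v" | "a = u" "b \<in> W" | "a = v" "b \<in> W" | "a \<in> W" "b \<in> W" "f b = Suc (f a)"
      using ab unfolding nf_def by blast
    then show ?thesis
    proof cases
      case 1
      then have s: "Im z = 0" using segUV z(1) by blast
      consider "c = u" "d = v" | "c = u" "d \<in> W" | "c = v" "d \<in> W" | "c \<in> W" "d \<in> W" "f d = Suc (f c)"
        using cd unfolding nf_def by blast
      then show ?thesis
      proof cases
        case 2
        then have "Im z = 2 * h d * Re z" using segUW z(2) by blast
        then have "Re z = 0" using s h1[of d] by auto
        then show ?thesis using at[OF at0] s pvu by blast
      next
        case 3
        then have "Im z = 2 * h d * (1 - Re z)" using segVW z(2) by blast
        then have "Re z = 1" using s h1[of d] by auto
        then show ?thesis using at[OF at1] s pvu by blast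
      next
        case 4
        then have "h c \<le> Im z" using segWW z(2) by blast
        then show ?thesis using s h1[of c] by linarith
      qed (use ne 1 in blast)
    next
      case ab2: 2
      then have s: "0 \<le> Re z" "Re z \<le> 1 / 2" "Im z = 2 * h b * Re z" using segUW z(1) by blast+
      consider "c = u" "d = v" | "c = u" "d \<in> W" | "c = v" "d \<in> W" | "c \<in> W" "d \<in> W" "f d = Suc (f c)"
        using cd unfolding nf_def by blast
      then show ?thesis
      proof cases
        case 1
        then have "Im z = 0" using segUV z(2) by blast
        then have "Re z = 0" using s h1[of b] by auto
        then show ?thesis using at[OF at0] \<open>Im z = 0\<close> pvu by blast
      next
        case 2
        then have "Im z = 2 * h d * Re z" using segUW z(2) by blast
        moreover have "h b \<noteq> h d" using hinj ab2 2 ne by blast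
        ultimately have "Re z = 0" using s(3) by auto
        then show ?thesis using at[OF at0] s(3) pvu by simp
      next
        case 3
        then have "1 / 2 \<le> Re z" using segVW z(2) by blast
        then have "Re z = 1 / 2" using s by linarith
        then show ?thesis using at[OF atW[of b]] s(3) ab2 pvW by simp
      next
        case 4
        then have "Re z = 1 / 2" using segWW z(2) by blast
        then show ?thesis using at[OF atW[of b]] s(3) ab2 pvW by simp
      qed
    next
      case ab3: 3
      then have s: "1 / 2 \<le> Re z" "Re z \<le> 1" "Im z = 2 * h b * (1 - Re z)" using segVW z(1) by blast+
      consider "c = u" "d = v" | "c = u" "d \<in> W" | "c = v" "d \<in> W" | "c \<in> W" "d \<in> W" "f d = Suc (f c)"
        using cd unfolding nf_def by blast
      then show ?thesis
      proof cases
        case 1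
        then have "Im z = 0" using segUV z(2) by blast
        then have "Re z = 1" using s h1[of b] by auto
        then show ?thesis using at[OF at1] \<open>Im z = 0\<close> pvu by blast
      next
        case 2
        then have "Re z \<le> 1 / 2" using segUW z(2) by blast
        then have "Re z = 1 / 2" using s by linarith
        then show ?thesis using at[OF atW[of b]] s(3) ab3 pvW by simp
      next
        case 3
        then have "Im z = 2 * h d * (1 - Re z)" using segVW z(2) by blast
        moreover have "h b \<noteq> h d" using hinj ab3 3 ne by blast
        ultimately have "Re z = 1" using s(3) by auto
        then show ?thesis using at[OF at1] s(3) pvu by simp
      next
        case 4
        then have "Re z = 1 / 2" using segWW z(2) by blast
        then show ?thesis using at[OF atW[of b]] s(3) ab3 pvW by simp
      qed
    next
      case ab4: 4
      then have s: "Re z = 1 / 2" "h a \<le> Im z" "Im z \<le> h a + 1" using segWW z(1) by blast+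
      have hb: "h b = h a + 1" using ab4(3) unfolding h_def by simp
      consider "c = u" "d = v" | "c = u" "d \<in> W" | "c = v" "d \<in> W" | "c \<in> W" "d \<in> W" "f d = Suc (f c)"
        using cd unfolding nf_def by blast
      then show ?thesis
      proof cases
        case 1
        then have "Im z = 0" using segUV z(2) by blast
        then show ?thesis using s h1[of a] by linarith
      next
        case 2
        then have "Im z = 2 * h d * Re z" using segUW z(2) by blast
        then show ?thesis using at[OF atW[of d]] s(1) 2 pvW by simp
      next
        case 3
        then have "Im z = 2 * h d * (1 - Re z)" using segVW z(2) by blast
        then show ?thesis using at[OF atW[of d]] s(1) 3 pvW by simp
      next
        case 4
        then have s': "h c \<le> Im z" "Im z \<le> h c + 1" using segWW z(2) by blast+
        have "f a \<noteq> f c"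
        proof
          assume ac: "f a = f c"
          then have "f b = f d" using ab4(3) 4(3) by simp
          then have "b = d" using inj_onD[OF injf] ab4(2) 4(2) by blast
          moreover have "a = c" using inj_onD[OF injf ac] ab4(1) 4(1) by blast
          ultimately show False using ne by simp
        qed
        then have "h a + 1 \<le> h c \<or> h c + 1 \<le> h a" unfolding h_def by linarith
        then have "Im z = h b \<or> Im z = h a" using s s' hb by linarith
        then show ?thesis
        proof
          assume "Im z = h b"
          then show ?thesis using at[OF atW[of b]] s(1) ab4 pvW by simp
        next
          assume "Im z = h a"
          then show ?thesis using at[OF atW[of a]] s(1) ab4 pvW by simp
        qed
      qed
    qed
  qed
  \<comment> \<open>\<open>\<gamma>\<close> is indexed by unordered edges, so a direction has to be
    chosen for the straight segment.\<close>
  define rep where "rep e = (SOME x. e = {fst x, snd x})" for e :: "'a set"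
  define \<gamma> where "\<gamma> e = linepath (p (fst (rep e))) (p (snd (rep e)))" for e
  have rep: "{fst (rep {a, b}), snd (rep {a, b})} = {a, b}" for a b
    unfolding rep_def by (rule someI2[of _ "(a, b)"]) auto
  have \<gamma>: "\<gamma> {a, b} = linepath (p a) (p b) \<or> \<gamma> {a, b} = linepath (p b) (p a)" for a b
    using rep[of a b] unfolding \<gamma>_def by (auto simp: doubleton_eq_iff)
  have im: "path_image (\<gamma> {a, b}) = closed_segment (p a) (p b)" for a b
    using \<gamma>[of a b] by (auto simp: closed_segment_commute)
  have "plane_drawing G p \<gamma>"
    unfolding plane_drawing_def
  proof (intro conjI ballI)
    show "inj_on p (pverts G)" by (rule pinj)
    interpret pair_graph G using pair_graph_joined[OF G] .
    show "case e of (a, b) \<Rightarrow> Path_Connected.arc (\<gamma> {a, b}) \<and>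
        {pathstart (\<gamma> {a, b}), pathfinish (\<gamma> {a, b})} = {p a, p b} \<and>
        path_image (\<gamma> {a, b}) \<inter> p ` pverts G = {p a, p b}" if e: "e \<in> parcs G" for e
    proof -
      obtain a b where ab: "e = (a, b)" "(a, b) \<in> parcs G" using e by (cases e) auto
      have abV: "a \<in> pverts G" "b \<in> pverts G" using ab(2) in_arcsD1 in_arcsD2 by auto
      have "a \<noteq> b" using pair_no_loops[OF ab(2)] by simp
      then have "p a \<noteq> p b" using pinj abV by (auto dest: inj_onD)
      then have "Path_Connected.arc (\<gamma> {a, b})" using \<gamma>[of a b] by (metis arc_linepath)
      moreover have "{pathstart (\<gamma> {a, b}), pathfinish (\<gamma> {a, b})} = {p a, p b}"
        using \<gamma>[of a b] by auto
      moreover have "path_image (\<gamma> {a, b}) \<inter> p ` pverts G = {p a, p b}"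
      proof
        obtain c d where cd: "nf c d" "{a, b} = {c, d}" using norm[OF ab(2)] by blast
        have "x \<in> {a, b}" if "x \<in> pverts G" "p x \<in> path_image (\<gamma> {a, b})" for x
          using vert[OF cd(1), of x] that im[of c d] unfolding cd(2) by simp
        then show "path_image (\<gamma> {a, b}) \<inter> p ` pverts G \<subseteq> {p a, p b}" by blast
        show "{p a, p b} \<subseteq> path_image (\<gamma> {a, b}) \<inter> p ` pverts G" unfolding im using abV by auto
      qed
      ultimately show ?thesis unfolding ab(1) by simp
    qed
    show "case e of (a, b) \<Rightarrow> \<forall>(x, y)\<in>parcs G. {a, b} \<noteq> {x, y} \<longrightarrow>
        path_image (\<gamma> {a, b}) \<inter> path_image (\<gamma> {x, y}) \<subseteq> p ` ({a, b} \<inter> {x, y})" if e: "e \<in> parcs G" for e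
    proof -
      obtain a b where ab: "e = (a, b)" "(a, b) \<in> parcs G" using e by (cases e) auto
      have "path_image (\<gamma> {a, b}) \<inter> path_image (\<gamma> {x, y}) \<subseteq> p ` ({a, b} \<inter> {x, y})"
        if xy: "(x, y) \<in> parcs G" "{a, b} \<noteq> {x, y}" for x y
      proof -
        obtain c d where cd: "nf c d" "{a, b} = {c, d}" using norm[OF ab(2)] by blast
        obtain c' d' where cd': "nf c' d'" "{x, y} = {c', d'}" using norm[OF xy(1)] by blast
        show ?thesis using cross[OF cd(1) cd'(1)] xy(2) unfolding cd(2) cd'(2) im by blast
      qed
      then show ?thesis unfolding ab(1) by blast
    qed
  qed
  then show ?thesis unfolding planar_graph_def using pair_graph_joined[OF G] by blast
qed

section \<open>Spectral radius of the join\<close>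

lemma joined_spectral_radius:
  assumes G: "joined True G u v xss" and t: "0 < t" "t < 1"
    and eq: "t + 1 / t = 1 + 2 * forest_weight t (mset (map length xss))"
  shows "\<rho> G = t + 1 / t"
proof -
  interpret pair_graph G using pair_graph_joined[OF G] .
  have pv: "pverts G = {u, v} \<union> set (concat xss)" using G unfolding joined_def by simp
  obtain z where z: "\<And>a. a \<in> pverts G \<Longrightarrow> z a > 0"
    "\<And>a. a \<in> set (concat xss) \<Longrightarrow> sum z (nbrs G a) = (t + 1 / t) * z a"
    "z u = 1" "z v = 1"
    "sum z (nbrs G u) = 1 + 2 * forest_weight t (mset (map length xss))"
    "sum z (nbrs G v) = 1 + 2 * forest_weight t (mset (map length xss))"
    using joined_eigenvector[OF G t] by blast
  show ?thesis
  proof (rule spectral_radius_eq_positive_eigenvalue[of z])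
    fix a assume "a \<in> pverts G"
    then consider "a = u" | "a = v" | "a \<in> set (concat xss)" unfolding pv by blast
    then show "sum z (nbrs G a) = (t + 1 / t) * z a" using z(2-6) eq by cases auto
  qed (use z(1) pv in auto)
qed

lemma continuous_on_path_weight:
  assumes "A \<subseteq> {0<..<1}" shows "continuous_on A (\<lambda>t. path_weight t m j)"
proof -
  have "1 + t ^ (m + 1) \<noteq> 0 \<and> t \<noteq> 0 \<and> t + 1 / t - 2 \<noteq> 0" if "t \<in> A" for t
  proof -
    have "0 < t" "t < 1" using that assms by auto
    then show ?thesis using denominator_pos[of t] zero_less_power[of t "m + 1"] by linarith
  qed
  then show ?thesis unfolding path_weight_def by (intro continuous_intros) auto
qed

lemma continuous_on_forest_weight:
  assumes "A \<subseteq> {0<..<1}" shows "continuous_on A (\<lambda>t. forest_weight t M)"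
proof (induction M)
  case empty then show ?case by (simp add: forest_weight_def)
next
  case (add m M)
  have "continuous_on A (\<lambda>t. (\<Sum>j=1..m. path_weight t m j) + forest_weight t M)"
    by (intro continuous_intros continuous_on_path_weight assms add)
  then show ?case by (simp add: forest_weight_def)
qed

text \<open>Intermediate value theorem between \<open>1 / (4 * N)\<close> and
  \<open>1 / sqrt (2 * N)\<close>. At the left end the forest weighs at most 1 while
  \<open>1 / t\<close> is large; at the right end \<open>forest_weight_ge\<close> leaves
  \<open>1 - 1/2 - 1/2 = 0\<close>. The right end also yields \<open>(t + 1 / t)^2 >= 2 * N\<close>,
  the lower bound on the rate in \<open>large_subsolution\<close>.\<close>

lemma hub_equation_solution:
  assumes M: "sum_mset M = N" and N: "N \<ge> 2"
  obtains t where "0 < t" "t \<le> 1 / sqrt (2 * real N)" "t + 1 / t = 1 + 2 * forest_weight t M"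
proof -
  define s where "s = sqrt (2 * real N)"
  have s2: "s\<^sup>2 = 2 * real N" unfolding s_def by simp
  have s: "s \<ge> 2"
  proof -
    have "sqrt 4 \<le> s" unfolding s_def using N by (intro real_sqrt_le_mono) simp
    then show ?thesis by simp
  qed
  define \<Phi> where "\<Phi> t = 1 + 2 * forest_weight t M - (t + 1 / t)" for t
  define t1 where "t1 = 1 / (4 * real N)"
  have t1: "0 < t1" "t1 < 1" "t1 \<le> 1 / 8" using N unfolding t1_def by (auto simp: field_simps)
  have "s * 2 \<le> s\<^sup>2" using s by (simp add: power2_eq_square)
  then have "s \<le> 4 * real N" using s2 s by linarith
  then have le: "t1 \<le> 1 / s" unfolding t1_def using s by (intro divide_left_mono) auto
  have s01: "0 < 1 / s" "1 / s < 1" using s by auto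
  have sub: "{t1..1 / s} \<subseteq> {0<..<1}"
    using t1(1) s01(2) by (meson atLeastAtMost_iff greaterThanLessThan_iff le_less_trans less_le_trans subsetI)
  then have "\<forall>t\<in>{t1..1 / s}. t \<noteq> 0" by auto
  then have cont: "continuous_on {t1..1 / s} \<Phi>"
    unfolding \<Phi>_def by (intro continuous_intros continuous_on_forest_weight sub) auto
  have "\<Phi> t1 \<le> 0"
  proof -
    have d: "t1 + 1 / t1 - 2 > 0" "t1 + 1 / t1 - 2 \<ge> 4 * real N - 2"
      using denominator_pos[OF t1(1,2)] t1(1) unfolding t1_def by auto
    have "2 * total_defect t1 M / (1 - t1) \<ge> 0" using total_defect_nonneg[OF t1(1,2)] t1 by simp
    then have "forest_weight t1 M \<le> real N / (t1 + 1 / t1 - 2)"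
      unfolding forest_weight_defect[OF t1(1,2)] M using d(1) by (intro divide_right_mono) auto
    also have "\<dots> \<le> 1"
    proof -
      have "real N \<le> 4 * real N - 2" using N by simp
      then show ?thesis using d by (simp add: divide_le_eq)
    qed
    finally have "1 + 2 * forest_weight t1 M \<le> 3" by simp
    moreover have "1 / t1 = 4 * real N" unfolding t1_def by simp
    then have "t1 + 1 / t1 \<ge> 8" using t1(1) N by simp
    ultimately show ?thesis unfolding \<Phi>_def by linarith
  qed
  moreover have "0 \<le> \<Phi> (1 / s)"
  proof -
    have pos: "1 / s + s > 0" using s by (simp add: add_pos_pos)
    have "forest_weight (1 / s) M \<ge> real N / (1 / s + s)"
      using forest_weight_ge[OF s01, of M] M by simp
    moreover have "2 * (real N / (1 / s + s)) = s - 1 / (1 / s + s)"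
    proof -
      have "s * (1 / s + s) - 1 = s\<^sup>2" using s by (simp add: field_simps power2_eq_square)
      then have "(s * (1 / s + s) - 1) / (1 / s + s) = 2 * real N / (1 / s + s)" using s2 by simp
      then show ?thesis using pos by (simp add: diff_divide_distrib)
    qed
    moreover have "1 / (1 / s + s) \<le> 1 / 2"
    proof (rule divide_left_mono)
      have "0 < 1 / s" using s by simp
      then show "2 \<le> 1 / s + s" using s by linarith
    qed (use pos in auto)
    moreover have "1 / s \<le> 1 / 2" using s by simp
    ultimately show ?thesis unfolding \<Phi>_def by simp
  qed
  ultimately obtain t where "t1 \<le> t" "t \<le> 1 / s" "\<Phi> t = 0" using IVT'[of \<Phi> t1 0 "1 / s", OF _ _ le cont] by blast
  then show ?thesis using that[of t] t1(1) unfolding \<Phi>_def s_def by auto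
qed

section \<open>Structure of the extremal graphs\<close>

text \<open>Degrees inside \<open>D\<close> are at most 2 by K_{3,3}, so only cycles have to be
  excluded. A set \<open>S\<close> of minimum degree 2 that misses some \<open>w\<close> in
  \<open>D\<close> gives the forbidden double wheel. For \<open>S = D\<close> there is no such
  \<open>w\<close>. Deleting one vertex \<open>a0\<close> then leaves a linear forest of short
  paths, hence of at least three, and their first vertices would all be neighbours of
  \<open>a0\<close>.\<close>

lemma (in pair_graph) hub_paths_of_core_free:
  assumes planar: "planar_graph G" and uv: "u \<in> pverts G" "v \<in> pverts G" "u \<noteq> v"
    and D: "D = nbrs G u \<inter> nbrs G v" and nc: "\<not> contains_graph G (cycle_graph l)" and l: "l \<ge> 5"
    and big: "card D > 2 * l"
  shows "\<exists>xss. path_forest (\<lambda>a b. (a, b) \<in> parcs G) D xss"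
proof -
  define R where "R = (\<lambda>a b. (a, b) \<in> parcs G)"
  have nl: "(a, a) \<notin> parcs G" for a using pair_no_loops[of "(a, a)"] by auto
  have uvD: "u \<notin> D" "v \<notin> D" using nl unfolding D nbrs_def by auto
  have DV: "D \<subseteq> pverts G" using nbrs_subset unfolding D by auto
  have finD: "finite D" using finite_subset[OF DV pair_finite_verts] .
  have R: "\<And>a b. R a b \<Longrightarrow> R b a" "\<And>a. \<not> R a a" unfolding R_def using parcs_sym nl by auto
  have deg: "card {b\<in>D. R a b} \<le> 2" if a: "a \<in> D" for a
  proof -
    have "{b\<in>D. R a b} = nbrs G a \<inter> (nbrs G u \<inter> nbrs G v)" unfolding R_def nbrs_def D by auto
    then show ?thesis using planar_common_nbrs[OF planar uv(3), of a] uv(1,2) a uvD DV by auto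
  qed
  have proper: "\<exists>a\<in>S. card {b\<in>S. R a b} \<le> 1" if S: "S \<subseteq> D" "S \<noteq> {}" "w \<in> D" "w \<notin> S" for S w
  proof (rule ccontr)
    assume neg: "\<not> ?thesis"
    show False
    proof (rule planar_no_double_wheel[OF planar, of S u v w])
      show "S \<subseteq> pverts G" "S \<noteq> {}" using S DV by auto
      show "u \<in> pverts G - S" "v \<in> pverts G - S" "w \<in> pverts G - S" "u \<noteq> v" "u \<noteq> w" "v \<noteq> w"
        using S uv uvD DV by auto
      show "(u, w) \<in> parcs G" "(v, w) \<in> parcs G" using S(3) unfolding D nbrs_def by auto
      show "(u, s) \<in> parcs G \<and> (v, s) \<in> parcs G" if "s \<in> S" for s using that S(1) unfolding D nbrs_def by auto
      show "2 \<le> card {t\<in>S. (s, t) \<in> parcs G}" if "s \<in> S" for s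
        using neg that unfolding R_def by (auto simp: not_le)
    qed
  qed
  have whole: "\<exists>a\<in>D. card {b\<in>D. R a b} \<le> 1"
  proof (rule ccontr)
    assume neg: "\<not> ?thesis"
    obtain a0 where a0: "a0 \<in> D" using big by (metis card.empty ex_in_conv not_less_zero)
    define D' where "D' = D - {a0}"
    have "\<exists>xss. path_forest R D' xss"
    proof (rule path_forest_exists[OF _ R])
      show "finite D'" using finD D'_def by simp
      show "card {b\<in>D'. R a b} \<le> 2" if "a \<in> D'" for a
      proof -
        have "card {b\<in>D'. R a b} \<le> card {b\<in>D. R a b}" using finD D'_def by (intro card_mono) auto
        then show ?thesis using deg[of a] that D'_def by auto
      qed
      show "\<exists>a\<in>S. card {b\<in>S. R a b} \<le> 1" if "S \<subseteq> D'" "S \<noteq> {}" for S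
        using proper[of S a0] that a0 unfolding D'_def by blast
    qed
    then obtain xss where xss: "path_forest R D' xss" by blast
    have dx: "distinct (concat xss)" "[] \<notin> set xss" "set (concat xss) = D'"
      "\<And>a b. a \<in> D' \<Longrightarrow> b \<in> D' \<Longrightarrow> R a b \<longleftrightarrow> linked xss a b"
      using xss unfolding path_forest_def by auto
    have short: "length xs \<le> l - 3" if "xs \<in> set xss" for xs
      by (rule hub_paths_short(1)[OF nc l uv(3) xss[unfolded R_def] _ that]) (auto simp: D'_def D)
    have "length (concat xss) = card D'" using dx(1,3) distinct_card by metis
    also have "\<dots> = card D - 1" using a0 finD unfolding D'_def by simp
    finally have lc: "length (concat xss) = card D - 1" .
    have "length xss \<ge> 3"
    proof (rule ccontr)
      assume "\<not> ?thesis"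
      then have "length xss \<le> 2" by simp
      moreover have "length (concat xss) \<le> length xss * (l - 3)"
        using short by (induction xss) (auto intro!: add_mono)
      ultimately have "length (concat xss) \<le> 2 * (l - 3)" by (meson le_trans mult_le_mono1)
      also have "\<dots> < 2 * l" using l by simp
      finally show False using lc big by linarith
    qed
    then obtain x1 x2 x3 rest where x: "xss = x1 # x2 # x3 # rest"
      by (metis (no_types, lifting) Suc_le_length_iff numeral_3_eq_3)
    \<comment> \<open>The first vertex of a list has at most one neighbour in \<open>D'\<close>, so
      its second neighbour in \<open>D\<close> must be \<open>a0\<close>.\<close>
    have adj: "R a0 (hd xs)" if xs: "xs \<in> set xss" for xs
    proof -
      have ne: "xs \<noteq> []" using dx(2) xs by auto
      have h: "hd xs = xs ! 0" "0 < length xs" using ne hd_conv_nth by auto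
      have hD: "hd xs \<in> D'" using xs ne dx(3) by (metis UN_I hd_in_set set_concat)
      have "\<not> card {b\<in>D. R (hd xs) b} \<le> 1" using neg hD D'_def by blast
      moreover have "{b\<in>D. R (hd xs) b} \<subseteq> {xs ! Suc 0}" if "\<not> R (hd xs) a0"
      proof
        fix b assume b: "b \<in> {b\<in>D. R (hd xs) b}"
        then have "b \<in> D'" using that D'_def by auto
        then have "linked xss (xs ! 0) b" using dx(4)[OF hD] b h(1) by simp
        then show "b \<in> {xs ! Suc 0}" using linked_nth[OF dx(1) xs h(2)] by simp
      qed
      then have "card {b\<in>D. R (hd xs) b} \<le> 1" if "\<not> R (hd xs) a0"
        using that card_mono[of "{xs ! Suc 0}" "{b\<in>D. R (hd xs) b}"] by simp
      ultimately show ?thesis using R(1) by blast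
    qed
    have ne: "x1 \<noteq> []" "x2 \<noteq> []" "x3 \<noteq> []" using dx(2) x by auto
    have "set x1 \<inter> set x2 = {}" "set x1 \<inter> set x3 = {}" "set x2 \<inter> set x3 = {}" using dx(1) x by auto
    then have "hd x1 \<noteq> hd x2" "hd x1 \<noteq> hd x3" "hd x2 \<noteq> hd x3" using ne by (metis IntI empty_iff hd_in_set)+
    then have "card {hd x1, hd x2, hd x3} = 3" by simp
    moreover have "{hd x1, hd x2, hd x3} \<subseteq> {b\<in>D. R a0 b}"
    proof -
      have "hd xs \<in> D" if "xs \<in> set xss" for xs
        using that dx(2,3) D'_def by (metis Diff_iff UN_I hd_in_set set_concat)
      then show ?thesis using adj x by simp
    qed
    moreover have "finite {b\<in>D. R a0 b}" using finD by simp
    ultimately have "3 \<le> card {b\<in>D. R a0 b}" using card_mono[of "{b\<in>D. R a0 b}" "{hd x1, hd x2, hd x3}"] by linarith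
    then show False using deg[OF a0] by simp
  qed
  have "\<exists>xss. path_forest R D xss"
  proof (rule path_forest_exists[OF finD R deg])
    fix S assume S: "S \<subseteq> D" "S \<noteq> {}"
    show "\<exists>a\<in>S. card {b\<in>S. R a b} \<le> 1"
    proof (cases "S = D")
      case True then show ?thesis using whole by simp
    next
      case False
      then obtain w where "w \<in> D" "w \<notin> S" using S by blast
      then show ?thesis using proper S by blast
    qed
  qed
  then show ?thesis unfolding R_def .
qed

lemma sum_list_length_concat: "sum_list (map length xss) = length (concat xss)"
  by (simp add: length_concat)

lemma hub_graph_joined:
  assumes G: "pair_graph G" and uv: "u \<in> pverts G" "v \<in> pverts G" "u \<noteq> v"
    and D: "D = nbrs G u \<inter> nbrs G v"
    and pf: "path_forest (\<lambda>a b. (a, b) \<in> parcs G) D xss"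
    and rs: "distinct rs" "set rs = pverts G - {u, v} - D"
  shows "joined s (hub_graph G u v s) u v (xss @ map (\<lambda>a. [a]) rs)"
proof -
  interpret pair_graph G by fact
  have nl: "(a, a) \<notin> parcs G" for a using pair_no_loops[of "(a, a)"] by auto
  have uvD: "u \<notin> D" "v \<notin> D" using nl unfolding D nbrs_def by auto
  have DV: "D \<subseteq> pverts G" using nbrs_subset unfolding D by auto
  have dx: "distinct (concat xss)" "[] \<notin> set xss" "set (concat xss) = D"
    "\<And>a b. a \<in> D \<Longrightarrow> b \<in> D \<Longrightarrow> (a, b) \<in> parcs G \<longleftrightarrow> linked xss a b"
    using pf unfolding path_forest_def by auto
  have cr: "concat (map (\<lambda>a. [a]) rs) = rs" by (induction rs) auto
  have sc: "set (concat (xss @ map (\<lambda>a. [a]) rs)) = pverts G - {u, v}"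
    unfolding concat_append cr set_append dx(3) rs(2) using DV uvD by blast
  have "linked (xss @ map (\<lambda>a. [a]) rs) a b \<longleftrightarrow> linked xss a b" for a b
    unfolding linked_append by (auto simp: linked_def succ_in_def)
  moreover have "{(a, b). linked xss a b} = arcs_in G D D"
    using linked_in[of xss] dx(3,4) unfolding arcs_in_def by blast
  ultimately have lk: "{(a, b). linked (xss @ map (\<lambda>a. [a]) rs) a b} = arcs_in G D D" by simp
  show ?thesis
    unfolding joined_def sc lk hub_graph_def D[symmetric]
  proof (intro conjI)
    show "distinct (concat (xss @ map (\<lambda>a. [a]) rs))"
      unfolding concat_append cr distinct_append dx(3) rs(2) using dx(1) rs(1) by auto
    show "[] \<notin> set (xss @ map (\<lambda>a. [a]) rs)" using dx(2) by auto
  qed (use uv in auto)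
qed

text \<open>\<open>t\<close> belongs to the balanced graph. The vector built with this
  \<open>t\<close> on the hub graph of \<open>G\<close> satisfies the path equations exactly and the
  hub equations as inequalities, because the forest weight is at most the balanced one. Tightness at
  \<open>u\<close> then becomes equality of the total defects, hence of the partitions.\<close>

lemma extremal_structure:
  assumes G: "planar_graph G" "card (pverts G) = n" "\<not> contains_graph G (cycle_graph l)"
    and l: "l \<ge> 5" and n: "real n \<ge> 2 * 10 ^ 17" "n \<ge> 4 * l" "n - 2 > 8 * ((l - 3) div 2)\<^sup>2"
    and t: "0 < t" "t \<le> 1 / sqrt (2 * real (n - 2))"
      "t + 1 / t = 1 + 2 * forest_weight t (balanced_parts (n - 2) (l - 3))"
    and rad: "t + 1 / t \<le> \<rho> G"
  shows "\<exists>u v xss. joined True G u v xss \<and> mset (map length xss) = balanced_parts (n - 2) (l - 3)"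
proof -
  define r where "r = t + 1 / t"
  define q where "q = l - 3"
  define N where "N = n - 2"
  have N: "N \<ge> q + 1" "N > 8 * (q div 2)\<^sup>2" "q \<ge> 2" "real N = real n - 2" "N \<ge> 100"
    using n l unfolding N_def q_def by auto
  have sq: "sqrt (2 * real N) \<ge> 8"
  proof -
    have "sqrt 64 \<le> sqrt (2 * real N)" using N(5) by (intro real_sqrt_le_mono) simp
    then show ?thesis by simp
  qed
  have "1 / sqrt (2 * real N) \<le> 1 / 8" using sq N(5) by (intro divide_left_mono) auto
  then have t8: "t \<le> 1 / 8" using t(2) unfolding N_def by linarith
  have t1: "t < 1" using t8 by simp
  have r: "r > 0" "r\<^sup>2 \<ge> 2 * real (card (pverts G)) - 4"
  proof -
    show "r > 0" unfolding r_def using t(1) by (simp add: add_pos_pos)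
    have "sqrt (2 * real N) \<le> 1 / t"
    proof -
      have S: "sqrt (2 * real N) > 0" using sq by linarith
      have "t * sqrt (2 * real N) \<le> 1"
        using t(2) pos_le_divide_eq[OF S, of t 1] unfolding N_def by simp
      then show ?thesis using pos_le_divide_eq[OF t(1), of "sqrt (2 * real N)" 1] by (simp add: mult.commute)
    qed
    then have "sqrt (2 * real N) \<le> r" unfolding r_def using t(1) by simp
    then have "(sqrt (2 * real N))\<^sup>2 \<le> r\<^sup>2" using sq by (intro power_mono) auto
    then show "r\<^sup>2 \<ge> 2 * real (card (pverts G)) - 4" using N(4) G(2) by simp
  qed
  have big: "real (card (pverts G)) \<ge> 2 * 10 ^ 17" using G(2) n(1) by simp
  obtain y u v where y: "large_subsolution G y r" "u \<in> pverts G" "v \<in> pverts G" "u \<noteq> v"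
    "y u \<ge> 998 / 1000" "y v \<ge> 998 / 1000" "\<And>z. z \<in> pverts G - {u, v} \<Longrightarrow> y z \<le> 1 / 10"
    "real (card (nbrs G u \<inter> nbrs G v)) \<ge> 9965 / 10000 * real (card (pverts G))"
    using planar_large_radius[OF G(1) big _ r] rad unfolding r_def by blast
  note Ndef = N_def
  interpret large_subsolution G y r by fact
  define D where "D = nbrs G u \<inter> nbrs G v"
  have nl: "(a, a) \<notin> parcs G" for a using pair_no_loops[of "(a, a)"] by auto
  have uvD: "u \<notin> D" "v \<notin> D" using nl unfolding D_def nbrs_def by auto
  have DV: "D \<subseteq> pverts G" using nbrs_subset unfolding D_def by auto
  have "real (card D) \<ge> 9965 / 10000 * real n" using y(8) G(2) unfolding D_def by simp
  moreover have "real n \<ge> 4 * real l" using n(2) by linarith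
  ultimately have "real (card D) > 2 * real l" using l by linarith
  then have cD: "card D > 2 * l" by linarith
  obtain xss where xss: "path_forest (\<lambda>a b. (a, b) \<in> parcs G) D xss"
    using hub_paths_of_core_free[OF G(1) y(2-4) D_def G(3) l cD] by blast
  have dx: "distinct (concat xss)" "[] \<notin> set xss" "set (concat xss) = D"
    using xss unfolding path_forest_def by auto
  note short = hub_paths_short[OF G(3) l y(4) xss, folded q_def]
  have short1: "length xs \<le> q" if "xs \<in> set xss" for xs using short(1)[OF _ that] D_def by simp
  have short2: "length xs + length ys \<le> q" if "xs \<in> set xss" "ys \<in> set xss" "xs \<noteq> ys" for xs ys
    using short(2)[OF _ that] D_def by simp
  have "finite (pverts G - {u, v} - D)" using pair_finite_verts by auto
  then obtain rs where rs: "set rs = pverts G - {u, v} - D" "distinct rs"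
    using finite_distinct_list by blast
  define yss where "yss = xss @ map (\<lambda>a. [a]) rs"
  define M where "M = mset (map length yss)"
  have J: "joined True (hub_graph G u v True) u v yss"
    unfolding yss_def using hub_graph_joined[OF pair_graph_axioms y(2-4) D_def xss rs(2,1)] .
  have cy: "set (concat yss) = pverts G - {u, v}"
  proof -
    have "pverts G = {u, v} \<union> set (concat yss)" "u \<notin> set (concat yss)" "v \<notin> set (concat yss)"
      using J unfolding joined_def hub_graph_def by auto
    then show ?thesis by blast
  qed
  have dy: "distinct (concat yss)" "[] \<notin> set yss" using J unfolding joined_def by auto
  have M_N: "sum_mset M = N"
  proof -
    have "sum_mset M = length (concat yss)" unfolding M_def sum_mset_sum_list by (rule sum_list_length_concat)
    also have "\<dots> = card (pverts G - {u, v})" using dy(1) cy distinct_card by metis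
    also have "\<dots> = N" using y(2-4) pair_finite_verts G(2) unfolding Ndef by (simp add: card_Diff_subset)
    finally show ?thesis .
  qed
  have adm: "admissible N q M"
  proof -
    define m where "m = Max (length ` set xss)"
    have xne: "set xss \<noteq> {}" using dx(3) cD by auto
    have "m \<in> length ` set xss" unfolding m_def using xne by (intro Max_in) auto
    then obtain A where A: "A \<in> set xss" "length A = m" by auto
    have Amax: "length B \<le> length A" if "B \<in> set xss" for B
      unfolding A(2) m_def using that by (intro Max_ge) auto
    have A1: "length A \<ge> 1" using dx(2) A(1) by (cases A) auto
    \<comment> \<open>A single path has at most \<open>q\<close> vertices and cannot cover
      \<open>D\<close>. The second path also ensures that the singletons outside \<open>D\<close>
      respect the bound: \<open>length A + 1 <= length A + length C <= q\<close>.\<close>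
    have "\<exists>C\<in>set xss. C \<noteq> A"
    proof (rule ccontr)
      assume "\<not> ?thesis"
      then have "D \<subseteq> set A" using dx(3) by auto
      then have "card D \<le> length A" by (meson card_length card_mono finite_set le_trans)
      then show False using short1[OF A(1)] cD unfolding q_def by linarith
    qed
    then obtain C where C: "C \<in> set xss" "C \<noteq> A" by blast
    have C1: "length C \<ge> 1" using dx(2) C(1) by (cases C) auto
    have AC: "length A + length C \<le> q" using short2 A(1) C by metis
    have "A \<in> set yss" using A(1) unfolding yss_def by simp
    then obtain ps qs where pq: "yss = ps @ A # qs" using split_list by metis
    have notA: "A \<notin> set (ps @ qs)"
    proof
      assume "A \<in> set (ps @ qs)"
      moreover obtain x where "x \<in> set A" using A1 by (cases A) auto
      ultimately have "x \<in> set A" "x \<in> set (concat ps) \<union> set (concat qs)" by auto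
      then show False using dy(1) unfolding pq by auto
    qed
    define M1 where "M1 = mset (map length (ps @ qs))"
    have "M = add_mset (length A) M1" unfolding M_def M1_def pq by simp
    moreover have "C \<in> set (ps @ qs)" using C unfolding yss_def[symmetric]
      using pq yss_def by (metis Un_iff insert_iff list.simps(15) set_append)
    then have "M1 \<noteq> {#}" unfolding M1_def by auto
    moreover have "\<forall>b\<in>#M1. b \<le> length A \<and> length A + b \<le> q"
    proof
      fix b assume "b \<in># M1"
      then obtain B where B: "B \<in> set (ps @ qs)" "b = length B" unfolding M1_def by auto
      then have "B \<in> set yss" "B \<noteq> A" using pq notA by auto
      then consider "B \<in> set xss" | "length B = 1" unfolding yss_def by auto
      then show "b \<le> length A \<and> length A + b \<le> q"
      proof cases
        case 1
        then show ?thesis using Amax short2[OF A(1) 1] \<open>B \<noteq> A\<close> B(2) by auto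
      next
        case 2
        then show ?thesis using A1 AC C1 B(2) by auto
      qed
    qed
    moreover have "0 \<notin># M" unfolding M_def using dy(2) by auto
    ultimately show ?thesis unfolding admissible_def using M_N by blast
  qed
  note opt = optimal_partition[OF t(1) t8 N(3,1,2) adm]
  have dpos: "t + 1 / t - 2 > 0" using denominator_pos[OF t(1) t1] .
  have fwM: "forest_weight t M = (real N - 2 * total_defect t M / (1 - t)) / (t + 1 / t - 2)"
    unfolding forest_weight_defect[OF t(1) t1] M_N ..
  have fwB: "forest_weight t (balanced_parts N q) = (real N - 2 * total_defect t (balanced_parts N q) / (1 - t)) / (t + 1 / t - 2)"
    unfolding forest_weight_defect[OF t(1) t1] sum_mset_balanced[OF N(3,1)] ..
  have fw_le: "forest_weight t M \<le> forest_weight t (balanced_parts N q)"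
    unfolding fwM fwB using opt(1) dpos t1 by (intro divide_right_mono diff_left_mono) auto
  have req: "r = 1 + 2 * forest_weight t (balanced_parts N q)" using t(3) unfolding r_def Ndef q_def .
  obtain z where z: "\<And>a. a \<in> pverts (hub_graph G u v True) \<Longrightarrow> z a > 0"
    "\<And>a. a \<in> set (concat yss) \<Longrightarrow> sum z (nbrs (hub_graph G u v True) a) = (t + 1 / t) * z a"
    "z u = 1" "z v = 1"
    "sum z (nbrs (hub_graph G u v True) u) = 1 + 2 * forest_weight t M"
    "sum z (nbrs (hub_graph G u v True) v) = 1 + 2 * forest_weight t M"
    using joined_eigenvector[OF J t(1) t1] unfolding M_def by blast
  have pvh: "pverts (hub_graph G u v True) = pverts G" unfolding hub_graph_def by simp
  have sup: "sum z (nbrs (hub_graph G u v True) a) \<le> r * z a" if a: "a \<in> pverts G" for a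
  proof -
    consider "a = u" | "a = v" | "a \<in> set (concat yss)" using a cy by blast
    then show ?thesis
    proof cases
      case 3 then show ?thesis using z(2) unfolding r_def by simp
    qed (use z(3-6) req fw_le in auto)
  qed
  note he = hub_graph_eq[OF y(2-7) TrueI z(1)[unfolded pvh] sup]
  have "joined True G u v yss" using J he(1) unfolding joined_def pvh by simp
  moreover have "forest_weight t M = forest_weight t (balanced_parts N q)"
    using he(2) z(3,5) req by simp
  then have "total_defect t (balanced_parts N q) = total_defect t M"
    unfolding fwM fwB using dpos t1 by simp
  then have "M = balanced_parts N q" by (rule opt(2))
  ultimately show ?thesis unfolding M_def Ndef q_def by blast
qed


section \<open>The two cases of the theorem\<close>

lemma nat_lists_exist:
  "\<exists>xss :: nat list list. map length xss = ns \<and> distinct (concat xss) \<and> set (concat xss) \<subseteq> {k..}"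
proof (induction ns arbitrary: k)
  case Nil
  then show ?case by (intro exI[of _ "[]"]) simp
next
  case (Cons m ns)
  obtain xss :: "nat list list" where xss: "map length xss = ns" "distinct (concat xss)" "set (concat xss) \<subseteq> {k + m..}"
    using Cons[of "k + m"] by blast
  have "set [k..<k + m] \<inter> set (concat xss) = {}" using xss(3) by fastforce
  moreover have "set (concat xss) \<subseteq> {k..}" using xss(3) by fastforce
  ultimately show ?case using xss
    by (intro exI[of _ "[k..<k + m] # xss"]) auto
qed

text \<open>\<open>spex_planar\<close> is a maximum over graphs on \<open>nat\<close>, while the
  graph of the theorem lives on a sum type; a copy on \<open>nat\<close> is what attains the
  maximum.\<close>

lemma nat_joined_exists:
  assumes "0 \<notin> set ns"
  obtains G :: "nat pair_pre_digraph" and u v xss where "joined s G u v xss" "map length xss = ns"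
proof -
  obtain xss :: "nat list list" where xss: "map length xss = ns" "distinct (concat xss)" "set (concat xss) \<subseteq> {2..}"
    using nat_lists_exist by blast
  define W where "W = set (concat xss)"
  define G where "G = \<lparr> pverts = {0, 1} \<union> W, parcs = {0, 1} \<times> W \<union> W \<times> {0, 1} \<union>
       {(a, b). linked xss a b} \<union> (if s then {(0, 1), (1, 0)} else {}) \<rparr>"
  have "0 \<notin> W" "1 \<notin> W" using xss(3) unfolding W_def by auto
  moreover have "[] \<notin> set xss" using assms xss(1) by force
  ultimately have "joined s G 0 1 xss" using xss(2) unfolding joined_def G_def W_def by simp
  then show ?thesis using that xss(1) by blast
qed

lemma joined_card:
  assumes "joined s G u v xss"
  shows "card (pverts G) = sum_list (map length xss) + 2"
proof -
  have "pverts G = insert u (insert v (set (concat xss)))" "u \<noteq> v" "u \<notin> set (concat xss)" "v \<notin> set (concat xss)"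
    "distinct (concat xss)"
    using assms unfolding joined_def by auto
  then have "card (pverts G) = length (concat xss) + 2" using distinct_card[of "concat xss"] by simp
  then show ?thesis unfolding sum_list_length_concat .
qed

lemma spex_planar_eqI:
  assumes ub: "\<And>G :: nat pair_pre_digraph. planar_free n F G \<Longrightarrow> \<rho> G \<le> t"
    and ex: "planar_free n F (G0 :: nat pair_pre_digraph)" "\<rho> G0 = t"
  shows "spex_planar n F = t"
  unfolding spex_planar_def
  by (rule Max_eqI[OF finite_spex_planar_values]) (use ub ex in auto)

text \<open>Every graph of value at least \<open>t\<close> has the described structure, and the
  structure forces the value \<open>t\<close>; so \<open>t\<close> is the maximum. The structure is
  assumed both for graphs on \<open>nat\<close>, over which the maximum runs, and for graphs on the
  arbitrary type in the uniqueness claim.\<close>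

lemma extremal_iff:
  fixes T :: "'b pair_pre_digraph" and F :: "'c pair_pre_digraph"
  assumes mem: "\<And>G u v xss. joined s (G :: nat pair_pre_digraph) u v xss \<Longrightarrow> mset (map length xss) = M \<Longrightarrow> planar_free n F G \<and> \<rho> G = t"
    and memT: "planar_free n F T" "\<rho> T = t" "joined s T u0 v0 xss0" "mset (map length xss0) = M"
    and str: "\<And>G :: nat pair_pre_digraph. planar_free n F G \<Longrightarrow> t \<le> \<rho> G \<Longrightarrow>
      \<exists>u v xss. joined s G u v xss \<and> mset (map length xss) = M"
    and str': "\<And>G :: 'a pair_pre_digraph. planar_free n F G \<Longrightarrow> t \<le> \<rho> G \<Longrightarrow>
      \<exists>u v xss. joined s G u v xss \<and> mset (map length xss) = M"
  shows "spex_extremal n F T \<and>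
    (\<forall>G :: 'a pair_pre_digraph. spex_extremal n F G \<longrightarrow> digraph_iso (with_proj G) (with_proj T))"
proof -
  have "0 \<notin> set (map length xss0)" using memT(3) unfolding joined_def by auto
  then obtain G0 :: "nat pair_pre_digraph" and u v xss where G0: "joined s G0 u v xss" "map length xss = map length xss0"
    by (rule nat_joined_exists)
  then have G0': "planar_free n F G0" "\<rho> G0 = t" using mem[OF G0(1)] memT(4) by simp_all
  have spex: "spex_planar n F = t"
  proof (rule spex_planar_eqI[OF _ G0'])
    fix G :: "nat pair_pre_digraph" assume G: "planar_free n F G"
    show "\<rho> G \<le> t"
    proof (rule ccontr)
      assume "\<not> ?thesis"
      moreover from this have "\<exists>u v xss. joined s G u v xss \<and> mset (map length xss) = M" using str[OF G] by simp
      ultimately show False using mem by fastforce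
    qed
  qed
  show ?thesis
  proof (intro conjI allI impI)
    show "spex_extremal n F T" using memT spex unfolding spex_extremal_def by simp
    fix G :: "'a pair_pre_digraph" assume G: "spex_extremal n F G"
    then have "planar_free n F G" "t \<le> \<rho> G" using spex unfolding spex_extremal_def by simp_all
    then obtain u v xss where "joined s G u v xss" "mset (map length xss) = M" using str' by blast
    then show "digraph_iso (with_proj G) (with_proj T)" using joined_iso[OF _ memT(3)] memT(4) by simp
  qed
qed

text \<open>Apart from one list of length \<open>q - K\<close> all lists have length at most
  \<open>K\<close>, so any two together have at most \<open>q\<close> vertices.\<close>

lemma joined_balanced_cycle_free:
  assumes G: "joined True G u v xss" and M: "mset (map length xss) = balanced_parts N q"
    and q: "q \<ge> 2" "l = q + 3"
  shows "\<not> contains_graph G (cycle_graph l)"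
proof -
  define K where "K = q div 2"
  have K: "K \<ge> 1" "2 * K \<le> q" using q unfolding K_def by auto
  define M1 where "M1 = add_mset ((N - 1 - (q - K)) mod K + 1) (replicate_mset ((N - 1 - (q - K)) div K) K)"
  have B: "balanced_parts N q = add_mset (q - K) M1" unfolding balanced_parts_def M1_def K_def ..
  have "(N - 1 - (q - K)) mod K + 1 \<le> K" using K(1) by (simp add: Suc_leI)
  then have M1: "b \<le> K" if "b \<in># M1" for b using that unfolding M1_def by (auto split: if_splits)
  have "q - K \<in># mset (map length xss)" unfolding M B by simp
  then obtain A where A: "A \<in> set xss" "length A = q - K" by auto
  then obtain ps qs where pq: "xss = ps @ A # qs" using split_list by metis
  have "mset (map length (ps @ qs)) = M1" using M A(2) unfolding B pq by simp
  then have small: "length x \<le> K" if "x \<in> set (ps @ qs)" for x using M1 that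
    by (metis image_eqI set_map set_mset_mset)
  show ?thesis
  proof (rule joined_cycle_free[OF G])
    show "xss \<noteq> []" using A(1) by auto
    show "3 \<le> l" "q + 3 \<le> l" using q by auto
    show "length xs \<le> q" if "xs \<in> set xss" for xs
      using that small[of xs] A(2) K unfolding pq by auto
    show "length xs + length ys \<le> q" if "xs \<in> set xss" "ys \<in> set xss" "xs \<noteq> ys" for xs ys
    proof (cases "xs = A")
      case True
      then have "length ys \<le> K" using that small[of ys] unfolding pq by auto
      then show ?thesis using True A(2) K by simp
    next
      case False
      then have xs: "length xs \<le> K" using that small[of xs] unfolding pq by auto
      show ?thesis
      proof (cases "ys = A")
        case True then show ?thesis using xs A(2) K by simp
      next
        case False
        then have "length ys \<le> K" using that small[of ys] unfolding pq by auto
        then show ?thesis using xs K by simp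
      qed
    qed
  qed
qed

section \<open>The graph of the theorem as a join with two hubs\<close>

lemma succ_in_map_upt:
  "{(a, b). succ_in (map f [0..<m]) a b \<or> succ_in (map f [0..<m]) b a} = (\<lambda>x. (f (fst x), f (snd x))) ` parcs (path_graph m)"
proof -
  have "succ_in (map f [0..<m]) a b \<longleftrightarrow> (\<exists>j. Suc j < m \<and> a = f j \<and> b = f (Suc j))" for a b
    unfolding succ_in_def by auto
  moreover have "parcs (path_graph m) = (\<lambda>j. (j, Suc j)) ` {j. Suc j < m} \<union> (\<lambda>j. (Suc j, j)) ` {j. Suc j < m}"
    unfolding path_graph_def by auto
  ultimately show ?thesis by (auto simp: image_Un image_image)
qed

lemma linked_UN: "{(a, b). linked xss a b} = (\<Union>xs\<in>set xss. {(a, b). succ_in xs a b \<or> succ_in xs b a})"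
  unfolding linked_def by auto

lemma parcs_disjoint_union:
  "parcs (disjoint_union G H) = (\<lambda>x. (Inl (fst x), Inl (snd x))) ` parcs G \<union> (\<lambda>x. (Inr (fst x), Inr (snd x))) ` parcs H"
  unfolding disjoint_union_def by force

lemma parcs_disjoint_copies:
  "parcs (disjoint_copies k G) = (\<Union>i<k. (\<lambda>x. ((i, fst x), (i, snd x))) ` parcs G)"
  unfolding disjoint_copies_def by force

lemma join_H_graph_joined:
  assumes q: "q \<ge> 2" and n: "n \<ge> q + 3"
  defines "n1 \<equiv> q - q div 2" and "n2 \<equiv> q div 2"
  shows "\<exists>u v xss. joined True (graph_join (complete_graph 2) (H_graph n n1 n2)) u v xss \<and>
    mset (map length xss) = balanced_parts (n - 2) q"
proof -
  define \<alpha> where "\<alpha> = H_alpha n n1 n2"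
  define \<beta> where "\<beta> = H_beta n n1 n2"
  define e1 where "e1 = (\<lambda>j. Inr (Inl j) :: nat + nat + nat \<times> nat + nat)"
  define e2 where "e2 = (\<lambda>i j. Inr (Inr (Inl (i, j))) :: nat + nat + nat \<times> nat + nat)"
  define e3 where "e3 = (\<lambda>j. Inr (Inr (Inr j)) :: nat + nat + nat \<times> nat + nat)"
  define xss where "xss = map e1 [0..<n1] # map (\<lambda>i. map (e2 i) [0..<n2]) [0..<\<alpha>] @ [map e3 [0..<\<beta>]]"
  define T where "T = graph_join (complete_graph 2) (H_graph n n1 n2)"
  have pos: "n1 > 0" "n2 > 0" "\<beta> > 0" using q unfolding n1_def n2_def \<beta>_def H_beta_def by auto
  have inj: "inj e1" "inj (e2 i)" "inj e3" for i
    unfolding e1_def e2_def e3_def by (auto intro!: injI)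
  have sc: "set (concat xss) = e1 ` {..<n1} \<union> (\<Union>i<\<alpha>. e2 i ` {..<n2}) \<union> e3 ` {..<\<beta>}"
    unfolding xss_def by (auto simp: atLeast0LessThan)
  have W: "set (concat xss) = Inr ` pverts (H_graph n n1 n2)"
    unfolding sc H_graph_def disjoint_union_def disjoint_copies_def path_graph_def \<alpha>_def \<beta>_def
      e1_def e2_def e3_def by (auto simp: image_iff)
  have dist: "distinct (concat xss)"
  proof -
    have "distinct (concat (map (\<lambda>i. map (e2 i) [0..<n2]) [0..<k]))" for k
      by (induction k) (auto simp: distinct_map e2_def inj_on_def)
    then show ?thesis unfolding xss_def using inj
      by (auto simp: distinct_map inj_on_subset[OF _ subset_UNIV] e1_def e2_def e3_def)
  qed
  have lk: "{(a, b). linked xss a b} = {(Inr a, Inr b) | a b. (a, b) \<in> parcs (H_graph n n1 n2)}"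
  proof -
    have "{(a, b). linked xss a b} = (\<lambda>x. (e1 (fst x), e1 (snd x))) ` parcs (path_graph n1) \<union>
        (\<Union>i<\<alpha>. (\<lambda>x. (e2 i (fst x), e2 i (snd x))) ` parcs (path_graph n2)) \<union>
        (\<lambda>x. (e3 (fst x), e3 (snd x))) ` parcs (path_graph \<beta>)"
      unfolding linked_UN xss_def by (simp add: succ_in_map_upt atLeast0LessThan Un_ac)
    also have "\<dots> = (\<lambda>x. (Inr (fst x), Inr (snd x))) ` parcs (H_graph n n1 n2)"
      unfolding H_graph_def parcs_disjoint_union parcs_disjoint_copies \<alpha>_def[symmetric] \<beta>_def[symmetric]
        e1_def e2_def e3_def
      by (simp add: image_Un image_UN image_image Un_assoc)
    also have "\<dots> = {(Inr a, Inr b) | a b. (a, b) \<in> parcs (H_graph n n1 n2)}" by force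
    finally show ?thesis .
  qed
  have "joined True T (Inl 0) (Inl 1) xss"
    unfolding joined_def
  proof (intro conjI)
    show "Inl 0 \<noteq> Inl (1::nat)" by simp
    show "Inl 0 \<notin> set (concat xss)" "Inl 1 \<notin> set (concat xss)" unfolding W by auto
    show "distinct (concat xss)" by (rule dist)
    show "[] \<notin> set xss" unfolding xss_def using pos by auto
    have two: "{..<2::nat} = {0, 1}" by auto
    show "pverts T = {Inl 0, Inl 1} \<union> set (concat xss)"
      unfolding T_def graph_join_def W complete_graph_def by (auto simp: two)
    have K2: "parcs (complete_graph 2) = {(0, 1), (1, 0)}" "pverts (complete_graph 2) = {0, 1}"
      unfolding complete_graph_def by (auto simp: two)
    show "parcs T = {Inl 0, Inl 1} \<times> set (concat xss) \<union> set (concat xss) \<times> {Inl 0, Inl 1} \<union>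
      {(a, b). linked xss a b} \<union> (if True then {(Inl 0, Inl 1), (Inl 1, Inl 0)} else {})"
      unfolding T_def graph_join_def disjoint_union_def W lk K2 pair_pre_digraph.simps
      by (simp add: K2) blast
  qed
  moreover have "mset (map length xss) = balanced_parts (n - 2) q"
  proof -
    have "mset (map length (map (\<lambda>i. map (e2 i) [0..<n2]) [0..<k])) = replicate_mset k n2" for k
      by (induction k) auto
    \<comment> \<open>The dividend in \<open>balanced_parts\<close> for \<open>n - 2\<close>
      vertices is the one in \<open>H_alpha\<close> and \<open>H_beta\<close>.\<close>
    moreover have "n - 2 - 1 - (q - q div 2) = n - 3 - n1" using n unfolding n1_def by simp
    ultimately show ?thesis
      unfolding xss_def balanced_parts_def \<alpha>_def \<beta>_def H_alpha_def H_beta_def n1_def n2_def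
      by (simp add: add.commute)
  qed
  ultimately show ?thesis unfolding T_def by blast
qed

theorem spex_long_cycle:
  assumes l: "l \<ge> 5" and n: "real n \<ge> 2 * 10 ^ 17" "n \<ge> 4 * l" "n - 2 > 8 * ((l - 3) div 2)\<^sup>2"
    and T: "joined True (T :: 'b pair_pre_digraph) u0 v0 xss0" "mset (map length xss0) = balanced_parts (n - 2) (l - 3)"
  shows "spex_extremal n (cycle_graph l) T \<and>
    (\<forall>G :: 'a pair_pre_digraph. spex_extremal n (cycle_graph l) G \<longrightarrow> digraph_iso (with_proj G) (with_proj T))"
proof -
  define q where "q = l - 3"
  define N where "N = n - 2"
  have q: "q \<ge> 2" "l = q + 3" "N \<ge> q + 1" "n = N + 2" "N \<ge> 2" using l n unfolding q_def N_def by auto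
  have sumN: "sum_mset (balanced_parts N q) = N" using sum_mset_balanced[OF q(1,3)] .
  obtain t where t: "0 < t" "t \<le> 1 / sqrt (2 * real N)" "t + 1 / t = 1 + 2 * forest_weight t (balanced_parts N q)"
    using hub_equation_solution[OF sumN q(5)] by blast
  have "1 < sqrt (2 * real N)" using q(5) by simp
  then have "t < 1" using t(2) by (smt (verit) divide_less_eq_1)
  have mem: "planar_free n (cycle_graph l) G \<and> \<rho> G = t + 1 / t"
    if G: "joined True G u v xss" "mset (map length xss) = balanced_parts N q" for G :: "'c pair_pre_digraph" and u v xss
  proof
    have "card (pverts G) = n"
      unfolding joined_card[OF G(1)] using sumN G(2) q(4) by (metis sum_mset_sum_list)
    then show "planar_free n (cycle_graph l) G"
      unfolding planar_free_def
      using pair_graph_joined[OF G(1)] joined_planar[OF G(1)] joined_balanced_cycle_free[OF G q(1,2)] by blast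
    show "\<rho> G = t + 1 / t"
      using joined_spectral_radius[OF G(1) t(1) \<open>t < 1\<close>] t(3) G(2) by simp
  qed
  have str: "\<exists>u v xss. joined True G u v xss \<and> mset (map length xss) = balanced_parts N q"
    if G: "planar_free n (cycle_graph l) G" "t + 1 / t \<le> \<rho> G" for G :: "'c pair_pre_digraph"
    unfolding N_def q_def
    by (rule extremal_structure[OF _ _ _ l n]) (use G t in \<open>auto simp: planar_free_def N_def q_def\<close>)
  show ?thesis
    by (rule extremal_iff[OF mem _ _ T(1) _ str str]) (use mem[OF T(1)] T(2) in \<open>auto simp: N_def q_def\<close>)
qed

section \<open>Triangles and K_{2,m}\<close>

lemma joined_singletons_nbrs:
  assumes G: "joined False G u v xss" and one: "\<And>xs. xs \<in> set xss \<Longrightarrow> length xs = 1"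
  shows "nbrs G u = set (concat xss)" "nbrs G v = set (concat xss)"
    "a \<in> set (concat xss) \<Longrightarrow> nbrs G a = {u, v}"
proof -
  define W where "W = set (concat xss)"
  have "\<not> linked xss a b" for a b
  proof
    assume "linked xss a b"
    then obtain xs i where "xs \<in> set xss" "Suc i < length xs" unfolding linked_def succ_in_def by blast
    then show False using one by fastforce
  qed
  then have pG: "parcs G = {u, v} \<times> W \<union> W \<times> {u, v}" and W: "u \<notin> W" "v \<notin> W"
    using G unfolding joined_def W_def by auto
  show "nbrs G u = set (concat xss)" "nbrs G v = set (concat xss)"
    "a \<in> set (concat xss) \<Longrightarrow> nbrs G a = {u, v}"
    unfolding nbrs_def pG W_def[symmetric] using W by auto
qed

text \<open>With \<open>m\<close> vertices besides the hubs and \<open>r^2 = 2 * m\<close>, a hub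
  collects \<open>m * (2 / r) = r\<close>, and every other vertex collects
  \<open>2 = r * (2 / r)\<close> from the two hubs.\<close>

lemma star_weights:
  fixes r :: real
  assumes G: "joined False G u v xss" and one: "\<And>xs. xs \<in> set xss \<Longrightarrow> length xs = 1"
    and r: "r > 0" "r\<^sup>2 = 2 * real (length (concat xss))"
    and a: "a \<in> pverts G"
  defines "z \<equiv> (\<lambda>a. if a \<in> {u, v} then 1 else 2 / r)"
  shows "sum z (nbrs G a) = r * z a"
proof -
  define W where "W = set (concat xss)"
  have D: "u \<noteq> v" "u \<notin> W" "v \<notin> W" "pverts G = {u, v} \<union> W" "distinct (concat xss)"
    using G unfolding joined_def W_def by auto
  note nb = joined_singletons_nbrs[OF G one, folded W_def]
  have "sum z W = (\<Sum>a\<in>W. 2 / r)" using D(2,3) unfolding z_def by (intro sum.cong) auto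
  also have "\<dots> = real (card W) * (2 / r)" by simp
  also have "card W = length (concat xss)" unfolding W_def using D(5) distinct_card by blast
  also have "real (length (concat xss)) * (2 / r) = r" using r by (simp add: field_simps power2_eq_square)
  finally have sW: "sum z W = r" .
  have "a = u \<or> a = v \<or> a \<in> W" using a D(4) by blast
  then show ?thesis
  proof (elim disjE)
    assume a: "a \<in> W"
    then have "sum z (nbrs G a) = 2" using nb(3)[of a] D(1) unfolding z_def by simp
    moreover have "z a = 2 / r" using a D(2,3) unfolding z_def by auto
    ultimately show ?thesis using r(1) by simp
  qed (use nb(1,2) sW in \<open>simp_all add: z_def\<close>)
qed

lemma star_spectral_radius:
  assumes G: "joined False G u v xss" and one: "\<And>xs. xs \<in> set xss \<Longrightarrow> length xs = 1"
    and r: "r > 0" "r\<^sup>2 = 2 * real (length (concat xss))"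
  shows "\<rho> G = r"
proof -
  interpret pair_graph G using pair_graph_joined[OF G] .
  have ne: "pverts G \<noteq> {}" using G unfolding joined_def by auto
  show ?thesis
    by (rule spectral_radius_eq_positive_eigenvalue[OF _ star_weights[OF G one r] ne]) (use r(1) in auto)
qed

lemma triangle_iff:
  assumes G: "pair_graph G"
  shows "contains_graph G (cycle_graph 3) \<longleftrightarrow> (\<exists>a b c. (a, b) \<in> parcs G \<and> (b, c) \<in> parcs G \<and> (c, a) \<in> parcs G)"
proof -
  interpret pair_graph G by fact
  have nl: "(a, a) \<notin> parcs G" for a using pair_no_loops[of "(a, a)"] by auto
  have all3: "(\<forall>i<3. P i) \<longleftrightarrow> P 0 \<and> P (Suc 0) \<and> P (Suc (Suc 0))" for P :: "nat \<Rightarrow> bool"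
    by (simp add: numeral_3_eq_3 All_less_Suc) blast
  have iff: "contains_graph G (cycle_graph 3) \<longleftrightarrow>
    (\<exists>c. length c = 3 \<and> distinct c \<and> (\<forall>i<3. (c ! i, c ! (Suc i mod 3)) \<in> parcs G))"
    by (rule contains_cycle_iff[OF order_refl G])
  show ?thesis
  proof
    assume "contains_graph G (cycle_graph 3)"
    then obtain c where "\<forall>i<3. (c ! i, c ! (Suc i mod 3)) \<in> parcs G" using iff by blast
    then show "\<exists>a b c. (a, b) \<in> parcs G \<and> (b, c) \<in> parcs G \<and> (c, a) \<in> parcs G" unfolding all3 by auto
  next
    assume "\<exists>a b c. (a, b) \<in> parcs G \<and> (b, c) \<in> parcs G \<and> (c, a) \<in> parcs G"
    then obtain a b c where abc: "(a, b) \<in> parcs G" "(b, c) \<in> parcs G" "(c, a) \<in> parcs G" by blast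
    have "a \<noteq> b" "b \<noteq> c" "a \<noteq> c" using abc nl by auto
    then show "contains_graph G (cycle_graph 3)"
      unfolding iff all3 using abc by (intro exI[of _ "[a, b, c]"]) auto
  qed
qed

lemma star_triangle_free:
  assumes G: "joined False G u v xss" and one: "\<And>xs. xs \<in> set xss \<Longrightarrow> length xs = 1"
  shows "\<not> contains_graph G (cycle_graph 3)"
proof -
  define W where "W = set (concat xss)"
  interpret pair_graph G using pair_graph_joined[OF G] .
  have D: "u \<notin> W" "v \<notin> W" "pverts G = {u, v} \<union> W" using G unfolding joined_def W_def by auto
  note nb = joined_singletons_nbrs[OF G one, folded W_def]
  have alt: "a \<in> W \<longleftrightarrow> b \<notin> W" if "(a, b) \<in> parcs G" for a b
  proof -
    have b: "b \<in> nbrs G a" using that unfolding nbrs_def by simp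
    have "a = u \<or> a = v \<or> a \<in> W" using in_arcsD1[OF that] D(3) by simp
    then show ?thesis
    proof (elim disjE)
      assume "a \<in> W"
      then have "b = u \<or> b = v" using b nb(3)[of a] by simp
      then show ?thesis using \<open>a \<in> W\<close> D(1,2) by auto
    qed (use b nb(1,2) D(1,2) in simp_all)
  qed
  show ?thesis unfolding triangle_iff[OF pair_graph_axioms] using alt by blast
qed

text \<open>A common neighbour \<open>d\<close> forbids the edge between the hubs, and an edge
  inside \<open>D\<close> would close a triangle with a hub. So the hub graph without hub edge is
  K_{2,n-2}, whose eigenvector is a supersolution with rate exactly \<open>r\<close>.\<close>

lemma triangle_free_structure:
  assumes G: "planar_graph G" "card (pverts G) = n" "\<not> contains_graph G (cycle_graph 3)"
    and n: "real n \<ge> 2 * 10 ^ 17" and rad: "sqrt (2 * real (n - 2)) \<le> \<rho> G"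
  shows "\<exists>u v xss. joined False G u v xss \<and> mset (map length xss) = replicate_mset (n - 2) 1"
proof -
  define r where "r = sqrt (2 * real (n - 2))"
  have n2: "real (n - 2) = real n - 2" "n - 2 > 0" using n by auto
  have r: "r > 0" "r\<^sup>2 = 2 * real (n - 2)" unfolding r_def using n2 by auto
  have r': "r\<^sup>2 \<ge> 2 * real (card (pverts G)) - 4" using r(2) n2 G(2) by simp
  have big: "real (card (pverts G)) \<ge> 2 * 10 ^ 17" using G(2) n by simp
  obtain y u v where y: "large_subsolution G y r" "u \<in> pverts G" "v \<in> pverts G" "u \<noteq> v"
    "y u \<ge> 998 / 1000" "y v \<ge> 998 / 1000" "\<And>z. z \<in> pverts G - {u, v} \<Longrightarrow> y z \<le> 1 / 10"
    "real (card (nbrs G u \<inter> nbrs G v)) \<ge> 9965 / 10000 * real (card (pverts G))"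
    using planar_large_radius[OF G(1) big _ r(1) r'] rad unfolding r_def by blast
  note r0 = r
  interpret large_subsolution G y r by fact
  define D where "D = nbrs G u \<inter> nbrs G v"
  have free: "\<not> ((a, b) \<in> parcs G \<and> (b, c) \<in> parcs G \<and> (c, a) \<in> parcs G)" for a b c
    using G(3) triangle_iff[OF pair_graph_axioms] by blast
  have "real n > 0" using n by simp
  then have "real (card D) > 0" using y(8) G(2) unfolding D_def by simp
  then have "card D > 0" by simp
  then obtain d where d: "d \<in> D" by (metis card_gt_0_iff ex_in_conv)
  have nuv: "(u, v) \<notin> parcs G"
    using free[of u v d] d parcs_sym unfolding D_def nbrs_def by blast
  have ind: "(a, b) \<notin> parcs G" if "a \<in> D" "b \<in> D" for a b
    using free[of u a b] that parcs_sym unfolding D_def nbrs_def by blast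
  obtain ws where ws: "set ws = pverts G - {u, v}" "distinct ws"
    using finite_distinct_list[of "pverts G - {u, v}"] pair_finite_verts by blast
  define xss where "xss = map (\<lambda>a. [a]) ws"
  have cx: "concat xss = ws" unfolding xss_def by (induction ws) auto
  have lk: "{(a, b). linked xss a b} = {}" unfolding xss_def linked_def succ_in_def by auto
  have "arcs_in G D D = {}" using ind unfolding arcs_in_def by auto
  then have J: "joined False (hub_graph G u v False) u v xss"
    unfolding joined_def cx ws lk hub_graph_def D_def[symmetric] using ws(2) y(2-4)
    by (auto simp: xss_def)
  have one: "length xs = 1" if "xs \<in> set xss" for xs using that unfolding xss_def by auto
  have lw: "length ws = n - 2"
    using ws y(2-4) pair_finite_verts G(2) distinct_card[OF ws(2)] by (simp add: card_Diff_subset)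
  have pvh: "pverts (hub_graph G u v False) = pverts G" unfolding hub_graph_def by simp
  define z where "z = (\<lambda>a. if a \<in> {u, v} then 1 else 2 / r)"
  have zz: "sum z (nbrs (hub_graph G u v False) a) = r * z a" if "a \<in> pverts G" for a
    unfolding z_def by (rule star_weights[OF J one r0(1)]) (use that r0(2) lw cx pvh in simp_all)
  have "parcs G = parcs (hub_graph G u v False)"
  proof (rule hub_graph_eq(1)[OF y(2-7)])
    show "(u, v) \<in> parcs G \<Longrightarrow> False" using nuv by simp
    show "z a > 0" for a unfolding z_def using r(1) by simp
    show "sum z (nbrs (hub_graph G u v False) a) \<le> r * z a" if "a \<in> pverts G" for a using zz[OF that] by simp
  qed
  then have "joined False G u v xss" using J unfolding joined_def pvh by simp
  moreover have "mset (map length xss) = replicate_mset (n - 2) 1"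
  proof -
    have "map length xss = replicate (length ws) 1" unfolding xss_def by (induction ws) auto
    then show ?thesis using lw by simp
  qed
  ultimately show ?thesis by blast
qed

lemma complete_bipartite_joined:
  "joined False (complete_bipartite_graph 2 m) (Inl 0) (Inl 1) (map (\<lambda>i. [Inr i]) [0..<m])"
proof -
  have two: "{..<2::nat} = {0, 1}" by auto
  have lk: "{(a, b). linked (map (\<lambda>i. [Inr i]) [0..<m]) a b} = {}" unfolding linked_def succ_in_def by auto
  have c: "concat (map (\<lambda>i. [Inr i]) ks) = map Inr ks" for ks :: "nat list" by (induction ks) auto
  show ?thesis
    unfolding joined_def lk c complete_bipartite_graph_def two
    by (auto simp: distinct_map atLeast0LessThan)
qed

theorem spex_triangle:
  assumes n: "real n \<ge> 2 * 10 ^ 17"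
  shows "spex_extremal n (cycle_graph 3) (complete_bipartite_graph 2 (n - 2)) \<and>
    (\<forall>G :: 'a pair_pre_digraph. spex_extremal n (cycle_graph 3) G \<longrightarrow>
      digraph_iso (with_proj G) (with_proj (complete_bipartite_graph 2 (n - 2))))"
proof -
  define N where "N = n - 2"
  have N: "n = N + 2" "N > 0" using n unfolding N_def by auto
  have mem: "planar_free n (cycle_graph 3) G \<and> \<rho> G = sqrt (2 * real N)"
    if G: "joined False G u v xss" "mset (map length xss) = replicate_mset N 1" for G :: "'c pair_pre_digraph" and u v xss
  proof
    have one: "length xs = 1" if "xs \<in> set xss" for xs
    proof -
      have "length xs \<in># mset (map length xss)" using that by auto
      then show ?thesis unfolding G(2) by (auto split: if_splits)
    qed
    have "sum_list (map length xss) = sum_mset (mset (map length xss))" by (simp only: sum_mset_sum_list)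
    also have "\<dots> = N" unfolding G(2) by simp
    finally have "sum_list (map length xss) = N" .
    then have len: "length (concat xss) = N" unfolding sum_list_length_concat .
    have "card (pverts G) = n" unfolding joined_card[OF G(1)] N(1) using len sum_list_length_concat[of xss] by simp
    then show "planar_free n (cycle_graph 3) G"
      unfolding planar_free_def
      using pair_graph_joined[OF G(1)] joined_planar[OF G(1)] star_triangle_free[OF G(1) one] by blast
    show "\<rho> G = sqrt (2 * real N)"
      by (rule star_spectral_radius[OF G(1) one]) (use N(2) len in auto)
  qed
  have str: "\<exists>u v xss. joined False G u v xss \<and> mset (map length xss) = replicate_mset N 1"
    if G: "planar_free n (cycle_graph 3) G" "sqrt (2 * real N) \<le> \<rho> G" for G :: "'c pair_pre_digraph"
    unfolding N_def
    by (rule triangle_free_structure[OF _ _ _ n]) (use G in \<open>auto simp: planar_free_def N_def\<close>)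
  define xss0 where "xss0 = map (\<lambda>i. [Inr i :: nat + nat]) [0..<N]"
  have T: "joined False (complete_bipartite_graph 2 (n - 2)) (Inl 0) (Inl 1) xss0"
    unfolding xss0_def N_def by (rule complete_bipartite_joined)
  have "map length xss0 = replicate N 1" unfolding xss0_def by (induction N) (auto simp: replicate_append_same)
  then have M: "mset (map length xss0) = replicate_mset N 1" by simp
  show ?thesis
    by (rule extremal_iff[OF mem _ _ T M str str]) (use mem[OF T M] in auto)
qed

section \<open>Arithmetic of the bounds on \<open>n\<close>\<close>

lemma half_floor_ceiling:
  assumes "3 \<le> l"
  shows "\<lfloor>(real l - 3) / 2\<rfloor> = int ((l - 3) div 2)" "nat \<lceil>(real l - 3) / 2\<rceil> = (l - 3) - (l - 3) div 2"
    "\<lfloor>(real l - 1) / 2\<rfloor> = int ((l - 1) div 2)"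
proof -
  have r: "real l - 3 = real (l - 3)" "real l - 1 = real (l - 1)" using assms by auto
  have fl: "\<lfloor>real m / 2\<rfloor> = int (m div 2)" for m
    using floor_divide_of_nat_eq[of m 2, where 'a = real] by simp
  have "\<lceil>real m / 2\<rceil> = int (m - m div 2)" for m :: nat
  proof (rule ceiling_unique)
    have e: "m = 2 * (m div 2) + m mod 2" "m mod 2 < 2" by auto
    then have "real m = 2 * real (m div 2) + real (m mod 2)" by (metis of_nat_add of_nat_mult of_nat_numeral)
    moreover have "real (m - m div 2) = real m - real (m div 2)" by (simp add: of_nat_diff)
    moreover have "m mod 2 = 0 \<or> m mod 2 = 1" by auto
    ultimately show "of_int (int (m - m div 2)) - 1 < real m / 2" "real m / 2 \<le> of_int (int (m - m div 2))" by auto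
  qed
  then show "nat \<lceil>(real l - 3) / 2\<rceil> = (l - 3) - (l - 3) div 2" unfolding r by simp
  show "\<lfloor>(real l - 3) / 2\<rfloor> = int ((l - 3) div 2)" "\<lfloor>(real l - 1) / 2\<rfloor> = int ((l - 1) div 2)"
    unfolding r fl by simp_all
qed

theorem theorem1p3:
  fixes l n :: nat
  assumes "3 \<le> l"
    and "real n \<ge> max (2.16 * 10 ^ 17)
           (max (9 * 2 ^ nat \<lfloor>(real l - 1) / 2\<rfloor> + 3)
                (625 / 32 * (real_of_int \<lfloor>(real l - 3) / 2\<rfloor>)\<^sup>2 + 2))"
  shows "(l = 3 \<longrightarrow>
            spex_extremal n (cycle_graph 3) (complete_bipartite_graph 2 (n - 2)) \<and>
            (\<forall>G :: 'a pair_pre_digraph. spex_extremal n (cycle_graph 3) G \<longrightarrow>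
               digraph_iso (with_proj G) (with_proj (complete_bipartite_graph 2 (n - 2))))) \<and>
         (5 \<le> l \<longrightarrow>
            (let T = graph_join (complete_graph 2)
                       (H_graph n (nat \<lceil>(real l - 3) / 2\<rceil>) (nat \<lfloor>(real l - 3) / 2\<rfloor>))
             in spex_extremal n (cycle_graph l) T \<and>
                (\<forall>G :: 'a pair_pre_digraph. spex_extremal n (cycle_graph l) G \<longrightarrow>
                   digraph_iso (with_proj G) (with_proj T))))"
proof -
  note hf = half_floor_ceiling[OF assms(1)]
  have n: "real n \<ge> 2 * 10 ^ 17" using assms(2) by simp
  have "real n \<ge> 9 * 2 ^ ((l - 1) div 2) + 3" using assms(2) unfolding hf by simp
  \<comment> \<open>The exponential bound on \<open>n\<close> enters through
    \<open>k + 1 <= 2 ^ k\<close>, which turns it into the linear bound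
    \<open>n >= 4 * l\<close>.\<close>
  moreover have "real (Suc ((l - 1) div 2)) \<le> 2 ^ ((l - 1) div 2)"
    using less_exp[of "(l - 1) div 2"] by (metis Suc_leI of_nat_le_iff of_nat_numeral of_nat_power)
  moreover have "x \<ge> 9 * k + 3" if "x \<ge> 9 * p + 3" "k \<le> p" for x k p :: real using that by linarith
  ultimately have "real n \<ge> 9 * real (Suc ((l - 1) div 2)) + 3" by blast
  then have "n \<ge> 9 * Suc ((l - 1) div 2) + 3" by linarith
  then have "n \<ge> 9 * ((l - 1) div 2) + 12" by simp
  moreover have "l \<le> 2 * ((l - 1) div 2) + 2" by presburger
  ultimately have nl: "n \<ge> 4 * l" by linarith
  have "real n \<ge> 625 / 32 * (real ((l - 3) div 2))\<^sup>2 + 2" using assms(2) unfolding hf by simp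
  then have nK: "n - 2 > 8 * ((l - 3) div 2)\<^sup>2"
  proof -
    define k where "k = (l - 3) div 2"
    assume "real n \<ge> 625 / 32 * (real ((l - 3) div 2))\<^sup>2 + 2"
    then have k: "real n \<ge> 625 / 32 * (real k)\<^sup>2 + 2" unfolding k_def .
    \<comment> \<open>For positive \<open>k\<close> this follows from 625/32 > 8; for
      \<open>k = 0\<close> strictness comes from the absolute bound on \<open>n\<close>.\<close>
    have "real (n - 2) > 8 * (real k)\<^sup>2"
    proof (cases "k = 0")
      case True then show ?thesis using n by simp
    next
      case False
      then have "(real k)\<^sup>2 > 0" by simp
      then have "real n - 2 > 8 * (real k)\<^sup>2" using k by linarith
      then show ?thesis by linarith
    qed
    then have "real (8 * k\<^sup>2) < real (n - 2)" by simp
    then show ?thesis unfolding k_def of_nat_less_iff .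
  qed
  show ?thesis
  proof (intro conjI impI)
    assume "5 \<le> l"
    then have q: "l - 3 \<ge> 2" "n \<ge> l - 3 + 3" using nl by auto
    obtain u v xss where T: "joined True (graph_join (complete_graph 2)
        (H_graph n (l - 3 - (l - 3) div 2) ((l - 3) div 2))) u v xss"
      "mset (map length xss) = balanced_parts (n - 2) (l - 3)"
      using join_H_graph_joined[OF q] by blast
    show "let T = graph_join (complete_graph 2)
                       (H_graph n (nat \<lceil>(real l - 3) / 2\<rceil>) (nat \<lfloor>(real l - 3) / 2\<rfloor>))
             in spex_extremal n (cycle_graph l) T \<and>
                (\<forall>G :: 'a pair_pre_digraph. spex_extremal n (cycle_graph l) G \<longrightarrow>
                   digraph_iso (with_proj G) (with_proj T))"
      unfolding hf Let_def nat_int using spex_long_cycle[OF \<open>5 \<le> l\<close> n nl nK T] .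
  qed (use spex_triangle[OF n] in auto)
qed

end
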